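(* Assume the decay condition and the growth condition (both stated in the context) hold. Let $(s_0,\theta_0)\in\operatorname{int}\mathcal S$ and $y_0=K_0'(s_0;\theta_0)$, and suppose that $\nabla_\theta K_0(s_0;\theta_0)=0$. Write $A=K_0''(s_0;\theta_0)$, $B=\nabla_s\nabla_\theta K_0(s_0;\theta_0)$ and suppose that $H=\nabla_\theta^T\nabla_\theta K_0(s_0;\theta_0)-B^TA^{-1}B$ is negative definite. Let $U\subset\mathcal R$ be a neighbourhood of $\theta_0$ with the following property (such a neighbourhood exists under these hypotheses): there are $n_0\in\mathbb N$ and a neighbourhood $V\subset\mathbb R^{d\times1}$ of $y_0$ such that for all $n\ge n_0$ and $y\in V$, with $x=ny$, the functions $\theta\mapsto\hat L(\theta;x)$ and $\theta\mapsto L(\theta;x)$ have unique local maximisers $\hat\theta_{\mathrm{MLE\,in\,}U}(x)$ and $\theta_{\mathrm{MLE\,in\,}U}(x)$ in $U$, and $|\hat\theta_{\mathrm{MLE\,in\,}U}(x)-\theta_{\mathrm{MLE\,in\,}U}(x)|=O(1/n^2)$ uniformly over $n\ge n_0$, $y\in V$. Suppose also that $\chi_n\in\mathbb R^{d\times1}$ are random variables satisfying $$\frac{\chi_n-ny_0}{\sqrt n}\overset{d}{\longrightarrow}\mathcal N(0,\Sigma)\quad\text{as }n\to\infty,$$ where $\Sigma\in\mathbb R^{d\times d}$ is a positive semi-definite matrix. Then: (1) The joint sampling distribution of the true and saddlepoint MLEs satisfies $$\left(\sqrt n\,(\theta_{\mathrm{MLE\,in\,}U}(\chi_n)-\theta_0),\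 \sqrt n\,(\hat\theta_{\mathrm{MLE\,in\,}U}(\chi_n)-\theta_0)\right)\overset{d}{\longrightarrow}(Z,Z)\quad\text{as }n\to\infty,$$ with $Z\sim\mathcal N\left(0,\ H^{-1}B^TA^{-1}\Sigma A^{-1}BH^{-1}\right)$. (2) If in addition $s_0=0$, $y_0=K_0'(0;\theta_0)$ and $\Sigma=K_0''(0;\theta_0)$, then the limiting distribution has $Z\sim\mathcal N(0,-H^{-1})$.
   Context: Setting. $d,p$ are positive integers and $\mathcal R\subset\mathbb R^{p\times1}$ is open. For each $\theta\in\mathcal R$, $Y_\theta$ is a random column vector in $\mathbb R^{d\times1}$ whose distribution does not depend on $n$, and for $n\in\mathbb N$, $X_\theta=\sum_{i=1}^nY^{(i)}$ where $Y^{(1)},Y^{(2)},\dots$ are i.i.d. copies of $Y_\theta$ (the dependence of $X_\theta$ on $n$ is suppressed). Let $\mathcal S_\theta=\{s\in\mathbb R^{1\times d}:\mathbb E(e^{sY_\theta})<\infty\}$, $\mathcal S=\{(s,\theta):\theta\in\mathcal R,\ s\in\mathcal S_\theta\}$, and let $\operatorname{int}\mathcal S$ be its interior in $\mathbb R^{1\times d}\times\mathbb R^{p\times 1}$. For complex row vectors $z$ with $\operatorname{Re}z\in\mathcal S_\theta$ put $M_0(z;\theta)=\mathbb E(e^{zY_\theta})$, and $K_0(s;\theta)=\log M_0(s;\theta)$ for real $s$. $K_0'=\nabla_sK_0$ is the $d\times1$ gradient and $K_0''$ the $d\times d$ Hessian with respect to $s$; $\nabla_\theta$ of a scalar is a $1\times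 p$ row vector, $\nabla_\theta^T\nabla_\theta K_0$ is the $p\times p$ Hessian in $\theta$, and $\nabla_s\nabla_\theta K_0$ is the $d\times p$ matrix with $i,j$ entry $\partial^2K_0/\partial s_i\partial\theta_j$. Throughout, $x\in\mathbb R^{d\times 1}$ and $y\in\mathbb R^{d\times 1}$ are related by $x=ny$. Decay condition: there is a continuous function $\delta:\operatorname{int}\mathcal S\to(0,\infty)$ such that $\left|\frac{M_0(s+\mathrm i\phi;\theta)}{M_0(s;\theta)}\right|\le(1+\delta(s,\theta)|\phi|^2)^{-\delta(s,\theta)}$ for all $\phi\in\mathbb R^{1\times d}$ and $(s,\theta)\in\operatorname{int}\mathcal S$. (This implies that $K_0''(s;\theta)$ is positive definite.) Growth condition: there is a continuous function $\gamma:\operatorname{int}\mathcal S\to(0,\infty)$ such that $\left|\frac{\partial^{k+\ell}M_0}{\partial\theta_{i_1}\cdots\partial\theta_{i_k}\partial s_{j_1}\cdots\partial s_{j_\ell}}(s+\mathrm i\phi;\theta)\right|\le\gamma(s,\theta)(1+|\phi|)^{\gamma(s,\theta)}$ for all $\phi\in\mathbb R^{1\times d}$ and $(s,\theta)\in\operatorname{int}\mathcal S$, for $k\in\{0,1\}$ with $1\le k+\ell\le6$ and for $k=2$ with $0\le\ell\le2$; and each of these partial derivatives exists and is continuous in all its variables. Saddlepoint. $\mathcal Y^o$ is the set of $(y,\theta)$ for which there is $s$ with $(s,\theta)\in\operatorname{int}\mathcal S$ and $K_0'(s;\theta)=y$; this $s$ is unique (strict convexity of $K_0$ in $s$) and is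 denoted $\hat s_0(\theta,y)$. Likelihoods. $L(\theta;x)$ is the value at $x$ of the continuous density of $X_\theta$ (which exists for $n$ large). For $(y,\theta)\in\mathcal Y^o$, the saddlepoint likelihood is, with $\hat s=\hat s_0(\theta,y)$, $$\hat L(\theta;x)=\frac{\exp\left(n[K_0(\hat s;\theta)-\hat sy]\right)}{\sqrt{\det(2\pi nK_0''(\hat s;\theta))}}.$$ When the maximisers are evaluated at the random point $x=\chi_n$, their values on the event $\{\chi_n/n\notin V\}$ (whose probability tends to $0$) are immaterial and may be assigned arbitrarily. *)

theory Defs
  imports "HOL-Probability.Probability"
begin

section \<open>Partial derivatives\<close>

text \<open>
  The increment is real also when the components are complex, so for a function of
  \<open>z = s + \<i>\<phi>\<close> this is the partial derivative with respect to a component of \<open>s\<close>.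
\<close>

definition pdv ::
    "'n::finite \<Rightarrow> ('b::{real_normed_vector,one} ^ 'n \<Rightarrow> 'a::real_normed_vector) \<Rightarrow> 'b ^ 'n \<Rightarrow> 'a"
  where "pdv i f x = vector_derivative (\<lambda>t. f (x + t *\<^sub>R axis i 1)) (at 0)"

definition has_pdv ::
    "'n::finite \<Rightarrow> ('b::{real_normed_vector,one} ^ 'n \<Rightarrow> 'a::real_normed_vector) \<Rightarrow> 'b ^ 'n \<Rightarrow> bool"
  where "has_pdv i f x \<longleftrightarrow> (\<lambda>t::real. f (x + t *\<^sub>R axis i 1)) differentiable (at 0)"

definition grad :: "(real ^ 'n::finite \<Rightarrow> real) \<Rightarrow> real ^ 'n \<Rightarrow> real ^ 'n"
  where "grad f x = (\<chi> i. pdv i f x)"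

definition hessian :: "(real ^ 'n::finite \<Rightarrow> real) \<Rightarrow> real ^ 'n \<Rightarrow> real ^ 'n ^ 'n"
  where "hessian f x = (\<chi> i j. pdv i (\<lambda>u. pdv j f u) x)"

definition mixed_hessian ::
    "(real ^ 'd::finite \<Rightarrow> real ^ 'p::finite \<Rightarrow> real) \<Rightarrow> real ^ 'd \<Rightarrow> real ^ 'p \<Rightarrow> real ^ 'p ^ 'd"
  where "mixed_hessian f s \<theta> = (\<chi> i j. pdv i (\<lambda>u. pdv j (\<lambda>\<eta>. f u \<eta>) \<theta>) s)"

text \<open>
  For \<open>is = [i\<^sub>1, \<dots>, i\<^sub>k]\<close> and \<open>js = [j\<^sub>1, \<dots>, j\<^sub>l]\<close>, \<open>mixed_pdv is js F\<close> is the derivative of \<open>F\<close>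
  with respect to \<open>\<theta>\<close>-components \<open>is\<close> and \<open>s\<close>-components \<open>js\<close>. As in the order of the usual notation
  (rightmost derivative first), the \<open>s\<close>-derivatives are taken before the \<open>\<theta>\<close>-derivatives.
\<close>

fun mixed_pdv ::
    "'p::finite list \<Rightarrow> 'd::finite list \<Rightarrow> (complex ^ 'd \<Rightarrow> real ^ 'p \<Rightarrow> complex) \<Rightarrow>
      complex ^ 'd \<Rightarrow> real ^ 'p \<Rightarrow> complex"
  where
    "mixed_pdv [] [] F z \<theta> = F z \<theta>"
  | "mixed_pdv [] (j # js) F z \<theta> = pdv j (\<lambda>w. mixed_pdv [] js F w \<theta>) z"
  | "mixed_pdv (i # is) js F z \<theta> = pdv i (\<lambda>\<eta>. mixed_pdv is js F z \<eta>) \<theta>"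

text \<open>Existence of the outermost derivative in \<open>mixed_pdv is js F z \<theta>\<close>.\<close>

fun has_mixed_pdv ::
    "'p::finite list \<Rightarrow> 'd::finite list \<Rightarrow> (complex ^ 'd \<Rightarrow> real ^ 'p \<Rightarrow> complex) \<Rightarrow>
      complex ^ 'd \<Rightarrow> real ^ 'p \<Rightarrow> bool"
  where
    "has_mixed_pdv [] [] F z \<theta> \<longleftrightarrow> True"
  | "has_mixed_pdv [] (j # js) F z \<theta> \<longleftrightarrow> has_pdv j (\<lambda>w. mixed_pdv [] js F w \<theta>) z"
  | "has_mixed_pdv (i # is) js F z \<theta> \<longleftrightarrow> has_pdv i (\<lambda>\<eta>. mixed_pdv is js F z \<eta>) \<theta>"


section \<open>Definite matrices\<close>

definition negative_definite :: "real ^ 'n ^ 'n::finite \<Rightarrow> bool"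
  where "negative_definite A \<longleftrightarrow> transpose A = A \<and> (\<forall>v. v \<noteq> 0 \<longrightarrow> v \<bullet> (A *v v) < 0)"

definition positive_semidefinite :: "real ^ 'n ^ 'n::finite \<Rightarrow> bool"
  where "positive_semidefinite A \<longleftrightarrow> transpose A = A \<and> (\<forall>v. 0 \<le> v \<bullet> (A *v v))"


section \<open>Convergence in distribution and centred normal laws\<close>

text \<open>The random elements may live on different probability spaces; \<open>Q\<close> is the limiting law.\<close>

definition converges_in_distribution ::
    "(nat \<Rightarrow> 'w measure) \<Rightarrow> (nat \<Rightarrow> 'w \<Rightarrow> 'a::topological_space) \<Rightarrow> 'a measure \<Rightarrow> bool"
  where "converges_in_distribution P X Q \<longleftrightarrow>
    (\<forall>f::'a \<Rightarrow> real. continuous_on UNIV f \<longrightarrow> bounded (range f) \<longrightarrow>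
      (\<lambda>n. LINT \<omega>|P n. f (X n \<omega>)) \<longlonglongrightarrow> (LINT x|Q. f x))"

text \<open>
  \<open>Q\<close> is the law \<open>N(0, \<Sigma>)\<close>, where \<open>\<Sigma>\<close> may be singular: every linear functional is univariate
  normal with mean \<open>0\<close> and variance \<open>v\<^sup>T \<Sigma> v\<close>, a point mass at \<open>0\<close> if that variance vanishes.
\<close>

definition centred_normal :: "real ^ 'n ^ 'n::finite \<Rightarrow> (real ^ 'n) measure \<Rightarrow> bool"
  where "centred_normal \<Sigma> Q \<longleftrightarrow>
    positive_semidefinite \<Sigma> \<and> prob_space Q \<and> sets Q = sets borel \<and>
    (\<forall>v. distr Q borel (\<lambda>x. v \<bullet> x) =
      (if v \<bullet> (\<Sigma> *v v) = 0 then return borel 0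
       else density lborel (\<lambda>t. ennreal (normal_density 0 (sqrt (v \<bullet> (\<Sigma> *v v))) t))))"


section \<open>The model and its generating functions\<close>

text \<open>
  For each parameter \<open>\<theta>\<close>, \<open>Y \<theta>\<close> is a random vector on the probability space \<open>\<Omega> \<theta>\<close>, and
  \<open>Yc \<theta> 1, Yc \<theta> 2, \<dots>\<close> are i.i.d. copies of it. Row and column vectors are both elements of
  \<open>real ^ 'd\<close>, so that \<open>s y\<close> is \<open>s \<bullet> y\<close>.
\<close>

definition iid_copies ::
    "'w measure \<Rightarrow> ('w \<Rightarrow> real ^ 'd::finite) \<Rightarrow> (nat \<Rightarrow> 'w \<Rightarrow> real ^ 'd) \<Rightarrow> bool"
  where "iid_copies M Y Yc \<longleftrightarrow>
    prob_space M \<and> Y \<in> borel_measurable M \<and>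
    prob_space.indep_vars M (\<lambda>_. borel) Yc {1..} \<and>
    (\<forall>i\<ge>1. distr M borel (Yc i) = distr M borel Y)"

definition S_dom ::
    "(real ^ 'p::finite) set \<Rightarrow> (real ^ 'p \<Rightarrow> 'w measure) \<Rightarrow> (real ^ 'p \<Rightarrow> 'w \<Rightarrow> real ^ 'd::finite) \<Rightarrow>
      ((real ^ 'd) \<times> (real ^ 'p)) set"
  where "S_dom R \<Omega> Y = {(s, \<theta>). \<theta> \<in> R \<and> integrable (\<Omega> \<theta>) (\<lambda>\<omega>. exp (s \<bullet> Y \<theta> \<omega>))}"

definition cvec :: "real ^ 'd::finite \<Rightarrow> real ^ 'd \<Rightarrow> complex ^ 'd"
  where "cvec s \<phi> = (\<chi> j. Complex (s $ j) (\<phi> $ j))"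

definition M0 ::
    "(real ^ 'p::finite \<Rightarrow> 'w measure) \<Rightarrow> (real ^ 'p \<Rightarrow> 'w \<Rightarrow> real ^ 'd::finite) \<Rightarrow>
      complex ^ 'd \<Rightarrow> real ^ 'p \<Rightarrow> complex"
  where "M0 \<Omega> Y z \<theta> = (CLINT \<omega>|\<Omega> \<theta>. exp (\<Sum>j\<in>UNIV. z $ j * complex_of_real (Y \<theta> \<omega> $ j)))"

definition K0 ::
    "(real ^ 'p::finite \<Rightarrow> 'w measure) \<Rightarrow> (real ^ 'p \<Rightarrow> 'w \<Rightarrow> real ^ 'd::finite) \<Rightarrow>
      real ^ 'd \<Rightarrow> real ^ 'p \<Rightarrow> real"
  where "K0 \<Omega> Y s \<theta> = ln (Re (M0 \<Omega> Y (cvec s 0) \<theta>))"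

definition K0' ::
    "(real ^ 'p::finite \<Rightarrow> 'w measure) \<Rightarrow> (real ^ 'p \<Rightarrow> 'w \<Rightarrow> real ^ 'd::finite) \<Rightarrow>
      real ^ 'd \<Rightarrow> real ^ 'p \<Rightarrow> real ^ 'd"
  where "K0' \<Omega> Y s \<theta> = grad (\<lambda>u. K0 \<Omega> Y u \<theta>) s"

definition K0'' ::
    "(real ^ 'p::finite \<Rightarrow> 'w measure) \<Rightarrow> (real ^ 'p \<Rightarrow> 'w \<Rightarrow> real ^ 'd::finite) \<Rightarrow>
      real ^ 'd \<Rightarrow> real ^ 'p \<Rightarrow> real ^ 'd ^ 'd"
  where "K0'' \<Omega> Y s \<theta> = hessian (\<lambda>u. K0 \<Omega> Y u \<theta>) s"


section \<open>Decay and growth conditions\<close>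

definition decay_condition ::
    "(real ^ 'p::finite) set \<Rightarrow> (real ^ 'p \<Rightarrow> 'w measure) \<Rightarrow> (real ^ 'p \<Rightarrow> 'w \<Rightarrow> real ^ 'd::finite) \<Rightarrow>
      bool"
  where "decay_condition R \<Omega> Y \<longleftrightarrow>
    (\<exists>\<delta>. continuous_on (interior (S_dom R \<Omega> Y)) \<delta> \<and>
      (\<forall>(s, \<theta>) \<in> interior (S_dom R \<Omega> Y). 0 < \<delta> (s, \<theta>) \<and>
        (\<forall>\<phi>. cmod (M0 \<Omega> Y (cvec s \<phi>) \<theta> / M0 \<Omega> Y (cvec s 0) \<theta>)
              \<le> (1 + \<delta> (s, \<theta>) * (norm \<phi>)\<^sup>2) powr (- \<delta> (s, \<theta>)))))"

definition growth_orders :: "nat \<Rightarrow> nat \<Rightarrow> bool"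
  where "growth_orders k l \<longleftrightarrow> (k \<le> 1 \<and> 1 \<le> k + l \<and> k + l \<le> 6) \<or> (k = 2 \<and> l \<le> 2)"

definition growth_condition ::
    "(real ^ 'p::finite) set \<Rightarrow> (real ^ 'p \<Rightarrow> 'w measure) \<Rightarrow> (real ^ 'p \<Rightarrow> 'w \<Rightarrow> real ^ 'd::finite) \<Rightarrow>
      bool"
  where "growth_condition R \<Omega> Y \<longleftrightarrow>
    (\<exists>\<gamma>. continuous_on (interior (S_dom R \<Omega> Y)) \<gamma> \<and>
      (\<forall>(s, \<theta>) \<in> interior (S_dom R \<Omega> Y). 0 < \<gamma> (s, \<theta>)) \<and>
      (\<forall>is js. growth_orders (length is) (length js) \<longrightarrow>
        (\<forall>(s, \<theta>) \<in> interior (S_dom R \<Omega> Y). \<forall>\<phi>.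
          has_mixed_pdv is js (M0 \<Omega> Y) (cvec s \<phi>) \<theta> \<and>
          cmod (mixed_pdv is js (M0 \<Omega> Y) (cvec s \<phi>) \<theta>)
            \<le> \<gamma> (s, \<theta>) * (1 + norm \<phi>) powr \<gamma> (s, \<theta>)) \<and>
        continuous_on {(s, \<phi>, \<theta>). (s, \<theta>) \<in> interior (S_dom R \<Omega> Y)}
          (\<lambda>(s, \<phi>, \<theta>). mixed_pdv is js (M0 \<Omega> Y) (cvec s \<phi>) \<theta>)))"


section \<open>True and saddlepoint likelihoods\<close>

definition continuous_density ::
    "'w measure \<Rightarrow> ('w \<Rightarrow> real ^ 'd::finite) \<Rightarrow> (real ^ 'd \<Rightarrow> real) \<Rightarrow> bool"
  where "continuous_density M X f \<longleftrightarrow>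
    continuous_on UNIV f \<and> (\<forall>x. 0 \<le> f x) \<and> distributed M lborel X (\<lambda>x. ennreal (f x))"

definition X_sum :: "(real ^ 'p::finite \<Rightarrow> nat \<Rightarrow> 'w \<Rightarrow> real ^ 'd::finite) \<Rightarrow>
      nat \<Rightarrow> real ^ 'p \<Rightarrow> 'w \<Rightarrow> real ^ 'd"
  where "X_sum Yc n \<theta> \<omega> = (\<Sum>i=1..n. Yc \<theta> i \<omega>)"

text \<open>A continuous density is unique when it exists, and this is the case for \<open>\<theta> \<in> L_dom\<close>.\<close>

definition L_dom ::
    "(real ^ 'p::finite) set \<Rightarrow> (real ^ 'p \<Rightarrow> 'w measure) \<Rightarrow>
      (real ^ 'p \<Rightarrow> nat \<Rightarrow> 'w \<Rightarrow> real ^ 'd::finite) \<Rightarrow> nat \<Rightarrow> (real ^ 'p) set"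
  where "L_dom R \<Omega> Yc n = {\<theta> \<in> R. \<exists>f. continuous_density (\<Omega> \<theta>) (X_sum Yc n \<theta>) f}"

definition L ::
    "(real ^ 'p::finite \<Rightarrow> 'w measure) \<Rightarrow> (real ^ 'p \<Rightarrow> nat \<Rightarrow> 'w \<Rightarrow> real ^ 'd::finite) \<Rightarrow>
      nat \<Rightarrow> real ^ 'p \<Rightarrow> real ^ 'd \<Rightarrow> real"
  where "L \<Omega> Yc n \<theta> x = (THE f. continuous_density (\<Omega> \<theta>) (X_sum Yc n \<theta>) f) x"

definition Y_open ::
    "(real ^ 'p::finite) set \<Rightarrow> (real ^ 'p \<Rightarrow> 'w measure) \<Rightarrow> (real ^ 'p \<Rightarrow> 'w \<Rightarrow> real ^ 'd::finite) \<Rightarrow>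
      ((real ^ 'd) \<times> (real ^ 'p)) set"
  where "Y_open R \<Omega> Y =
    {(y, \<theta>). \<exists>s. (s, \<theta>) \<in> interior (S_dom R \<Omega> Y) \<and> K0' \<Omega> Y s \<theta> = y}"

definition s_hat ::
    "(real ^ 'p::finite) set \<Rightarrow> (real ^ 'p \<Rightarrow> 'w measure) \<Rightarrow> (real ^ 'p \<Rightarrow> 'w \<Rightarrow> real ^ 'd::finite) \<Rightarrow>
      real ^ 'p \<Rightarrow> real ^ 'd \<Rightarrow> real ^ 'd"
  where "s_hat R \<Omega> Y \<theta> y = (THE s. (s, \<theta>) \<in> interior (S_dom R \<Omega> Y) \<and> K0' \<Omega> Y s \<theta> = y)"

definition L_hat_dom ::
    "(real ^ 'p::finite) set \<Rightarrow> (real ^ 'p \<Rightarrow> 'w measure) \<Rightarrow> (real ^ 'p \<Rightarrow> 'w \<Rightarrow> real ^ 'd::finite) \<Rightarrow>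
      nat \<Rightarrow> real ^ 'd \<Rightarrow> (real ^ 'p) set"
  where "L_hat_dom R \<Omega> Y n x = {\<theta>. (x /\<^sub>R real n, \<theta>) \<in> Y_open R \<Omega> Y}"

definition L_hat ::
    "(real ^ 'p::finite) set \<Rightarrow> (real ^ 'p \<Rightarrow> 'w measure) \<Rightarrow> (real ^ 'p \<Rightarrow> 'w \<Rightarrow> real ^ 'd::finite) \<Rightarrow>
      nat \<Rightarrow> real ^ 'p \<Rightarrow> real ^ 'd \<Rightarrow> real"
  where "L_hat R \<Omega> Y n \<theta> x =
    (let y = x /\<^sub>R real n; s = s_hat R \<Omega> Y \<theta> y in
      exp (real n * (K0 \<Omega> Y s \<theta> - s \<bullet> y)) / sqrt (det ((2 * pi * real n) *\<^sub>R K0'' \<Omega> Y s \<theta>)))"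


section \<open>Maximum likelihood estimators in a neighbourhood\<close>

definition local_maximiser :: "'a::topological_space set \<Rightarrow> ('a \<Rightarrow> real) \<Rightarrow> 'a \<Rightarrow> bool"
  where "local_maximiser D f t \<longleftrightarrow> t \<in> D \<and> (\<forall>\<^sub>F u in at t within D. f u \<le> f t)"

text \<open>
  Both likelihoods are partial functions of \<open>\<theta>\<close>, so a local maximiser in \<open>U\<close> is a local
  maximiser of the restriction to the part of \<open>U\<close> on which the likelihood is defined.
\<close>

definition is_mle ::
    "(real ^ 'p::finite) set \<Rightarrow> (real ^ 'p \<Rightarrow> 'w measure) \<Rightarrow>
      (real ^ 'p \<Rightarrow> nat \<Rightarrow> 'w \<Rightarrow> real ^ 'd::finite) \<Rightarrow> (real ^ 'p) set \<Rightarrow> nat \<Rightarrow> real ^ 'd \<Rightarrow>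
      real ^ 'p \<Rightarrow> bool"
  where "is_mle R \<Omega> Yc U n x = local_maximiser (U \<inter> L_dom R \<Omega> Yc n) (\<lambda>\<theta>. L \<Omega> Yc n \<theta> x)"

definition is_mle_hat ::
    "(real ^ 'p::finite) set \<Rightarrow> (real ^ 'p \<Rightarrow> 'w measure) \<Rightarrow> (real ^ 'p \<Rightarrow> 'w \<Rightarrow> real ^ 'd::finite) \<Rightarrow>
      (real ^ 'p) set \<Rightarrow> nat \<Rightarrow> real ^ 'd \<Rightarrow> real ^ 'p \<Rightarrow> bool"
  where "is_mle_hat R \<Omega> Y U n x =
    local_maximiser (U \<inter> L_hat_dom R \<Omega> Y n x) (\<lambda>\<theta>. L_hat R \<Omega> Y n \<theta> x)"

definition mle ::
    "(real ^ 'p::finite) set \<Rightarrow> (real ^ 'p \<Rightarrow> 'w measure) \<Rightarrow>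
      (real ^ 'p \<Rightarrow> nat \<Rightarrow> 'w \<Rightarrow> real ^ 'd::finite) \<Rightarrow> (real ^ 'p) set \<Rightarrow> nat \<Rightarrow> real ^ 'd \<Rightarrow> real ^ 'p"
  where "mle R \<Omega> Yc U n x = (THE \<theta>. is_mle R \<Omega> Yc U n x \<theta>)"

definition mle_hat ::
    "(real ^ 'p::finite) set \<Rightarrow> (real ^ 'p \<Rightarrow> 'w measure) \<Rightarrow> (real ^ 'p \<Rightarrow> 'w \<Rightarrow> real ^ 'd::finite) \<Rightarrow>
      (real ^ 'p) set \<Rightarrow> nat \<Rightarrow> real ^ 'd \<Rightarrow> real ^ 'p"
  where "mle_hat R \<Omega> Y U n x = (THE \<theta>. is_mle_hat R \<Omega> Y U n x \<theta>)"

definition mle_neighbourhoods ::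
    "(real ^ 'p::finite) set \<Rightarrow> (real ^ 'p \<Rightarrow> 'w measure) \<Rightarrow> (real ^ 'p \<Rightarrow> 'w \<Rightarrow> real ^ 'd::finite) \<Rightarrow>
      (real ^ 'p \<Rightarrow> nat \<Rightarrow> 'w \<Rightarrow> real ^ 'd) \<Rightarrow> (real ^ 'p) set \<Rightarrow> (real ^ 'd) set \<Rightarrow> nat \<Rightarrow> bool"
  where "mle_neighbourhoods R \<Omega> Y Yc U V n\<^sub>0 \<longleftrightarrow>
    (\<forall>n\<ge>n\<^sub>0. \<forall>y\<in>V. (\<exists>!\<theta>. is_mle_hat R \<Omega> Y U n (real n *\<^sub>R y) \<theta>) \<and>
                    (\<exists>!\<theta>. is_mle R \<Omega> Yc U n (real n *\<^sub>R y) \<theta>)) \<and>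
    (\<exists>C. \<forall>n\<ge>n\<^sub>0. \<forall>y\<in>V.
      norm (mle_hat R \<Omega> Y U n (real n *\<^sub>R y) - mle R \<Omega> Yc U n (real n *\<^sub>R y)) \<le> C / (real n)\<^sup>2)"

end

theory Submission
  imports Defs
begin

text \<open>
  The whole theorem is a statement about the saddlepoint maximiser on the scale \<open>r = 1 / sqrt n\<close>.
  Both maximisers differ by \<open>O(1/n\<^sup>2)\<close>, which is \<open>o(r)\<close>, so it suffices to show that
  \<open>sqrt n (\<theta>\<^sub>h\<^sub>a\<^sub>t - \<theta>\<^sub>0)\<close> equals \<open>G w\<close> up to an error that vanishes uniformly for bounded
  \<open>w = (x - n y\<^sub>0) / sqrt n\<close>, with the matrix \<open>G = - H\<^sup>-\<^sup>1 B\<^sup>T A\<^sup>-\<^sup>1\<close>. Since \<open>w\<close> is asymptotically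
  \<open>N(0, \<Sigma>)\<close>, hence tight, a Slutsky argument (\<open>slutsky_continuous_mapping\<close>) then gives the joint limit
  \<open>(G W, G W)\<close>, and \<open>G \<Sigma> G\<^sup>T\<close> is the asserted covariance. When \<open>s\<^sub>0 = 0\<close>, the function \<open>K\<^sub>0(0; \<theta>) = log 1\<close>
  vanishes identically, so \<open>H = - B\<^sup>T A\<^sup>-\<^sup>1 B\<close> and \<open>\<Sigma> = A\<close> gives \<open>G A G\<^sup>T = - H\<^sup>-\<^sup>1\<close>.

  The uniform expansion is an argmax argument. Write \<open>s = s\<^sub>0 + r \<sigma>\<close>, \<open>\<theta> = \<theta>\<^sub>0 + r h\<close>, \<open>y = y\<^sub>0 + r w\<close>.
  By \<open>scaled_taylor\<close>, \<open>n (K\<^sub>0(s; \<theta>) - K\<^sub>0(s\<^sub>0; \<theta>\<^sub>0) - (s - s\<^sub>0) y)\<close> is uniformly close to a quadratic form in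
  \<open>(\<sigma>, h)\<close>, minus \<open>\<sigma> w\<close>. Minimising over \<open>\<sigma>\<close> in a fixed ball gives an interior critical point; it solves
  the saddlepoint equation, and its value is close to the quadratic \<open>profile w h\<close>, whose Hessian in \<open>h\<close>
  is \<open>H\<close> and whose maximum is at \<open>h = G w\<close> (\<open>scaled_saddlepoint\<close>). The determinant factor of the saddlepoint
  likelihood is asymptotically constant on this scale. So the likelihood, maximised over a small ball around
  \<open>\<theta>\<^sub>0 + r G w\<close>, has its maximum in the interior; this is a local maximum in \<open>U\<close>, and as that is unique, it is
  the saddlepoint maximiser (\<open>saddlepoint_mle_expansion\<close>). The implicit function theorem is avoided: both
  steps use the same compactness argument (\<open>perturbed_minimum\<close>), the second one on the compact set of pairs
  \<open>(s, \<theta>)\<close> that satisfy the saddlepoint equation.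

  The smoothness of \<open>K\<^sub>0\<close> comes from the continuity of the partial derivatives in the growth condition. That the
  saddlepoint is unique, and that \<open>A\<close> is positive definite, comes from the decay condition: a direction in which
  the Hessian of \<open>K\<^sub>0\<close> degenerates would be one in which \<open>Y\<close> is almost surely constant, and then the tilted
  characteristic function would not decay (\<open>Kss_positive_definite\<close>).
\<close>

section \<open>Partial derivatives and differentiability\<close>

lemma DERIV_along_line:
  fixes f :: "'a::real_normed_vector \<Rightarrow> real"
  assumes "((\<lambda>u. f (z + t *\<^sub>R b + u *\<^sub>R b)) has_real_derivative D) (at 0)"
  shows "((\<lambda>u. f (z + u *\<^sub>R b)) has_real_derivative D) (at t)"
proof -
  have "((\<lambda>u. f (z + u *\<^sub>R b)) has_real_derivative D) (at (0 + t))"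
    unfolding DERIV_shift using assms by (simp add: algebra_simps)
  then show ?thesis by simp
qed

text \<open>
  Change the coordinates one at a time. Each change is controlled by the mean value inequality, and the
  intermediate points stay in the ball because dropping coordinates does not increase the norm.
\<close>

lemma has_derivative_from_continuous_partials:
  fixes f :: "'a::euclidean_space \<Rightarrow> real"
  assumes S: "open S" "x \<in> S"
    and der: "\<And>z b. z \<in> S \<Longrightarrow> b \<in> Basis \<Longrightarrow>
      ((\<lambda>t. f (z + t *\<^sub>R b)) has_real_derivative g b z) (at 0)"
    and cont: "\<And>b. b \<in> Basis \<Longrightarrow> isCont (g b) x"
  shows "(f has_derivative (\<lambda>h. \<Sum>b\<in>Basis. (h \<bullet> b) * g b x)) (at x)"
  unfolding has_derivative_at_alt
proof (intro conjI allI impI)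
  show "bounded_linear (\<lambda>h. \<Sum>b\<in>Basis. (h \<bullet> b) * g b x)"
    by (intro bounded_linear_sum bounded_linear_mult_const bounded_linear_inner_left)
  fix e :: real
  assume e: "0 < e"
  define e' where "e' = e / real DIM('a)"
  have e': "e' > 0" using e by (simp add: e'_def)
  have "\<forall>b\<in>Basis. \<forall>\<^sub>F z in nhds x. \<bar>g b z - g b x\<bar> < e'"
  proof
    fix b :: 'a assume "b \<in> Basis"
    then have "(g b \<longlongrightarrow> g b x) (nhds x)"
      using cont by (simp add: isCont_def tendsto_at_iff_tendsto_nhds)
    then show "\<forall>\<^sub>F z in nhds x. \<bar>g b z - g b x\<bar> < e'"
      using e' by (auto dest!: tendstoD simp: dist_real_def)
  qed
  then have "\<forall>\<^sub>F z in nhds x. \<forall>b\<in>Basis. \<bar>g b z - g b x\<bar> < e'"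
    by (rule eventually_ball_finite[rotated]) simp
  moreover have "\<forall>\<^sub>F z in nhds x. z \<in> S" using S by (rule eventually_nhds_in_open)
  ultimately have "\<forall>\<^sub>F z in nhds x. z \<in> S \<and> (\<forall>b\<in>Basis. \<bar>g b z - g b x\<bar> < e')"
    by eventually_elim auto
  then obtain d where d: "d > 0" "\<And>z. dist z x < d \<Longrightarrow> z \<in> S"
      "\<And>z b. dist z x < d \<Longrightarrow> b \<in> Basis \<Longrightarrow> \<bar>g b z - g b x\<bar> < e'"
    unfolding eventually_nhds_metric by blast
  have "norm (f y - f x - (\<Sum>b\<in>Basis. ((y - x) \<bullet> b) * g b x)) \<le> e * norm (y - x)"
    if y: "norm (y - x) < d" for y
  proof -
    define h where "h = y - x"
    define P where "P I = (\<Sum>b\<in>I. (h \<bullet> b) *\<^sub>R b)" for I :: "'a set"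
    have step: "\<bar>f (x + P I) - f x - (\<Sum>b\<in>I. (h \<bullet> b) * g b x)\<bar> \<le> real (card I) * (e' * norm h)"
      if "I \<subseteq> Basis" for I
      using finite_subset[OF that finite_Basis] that
    proof (induction I rule: finite_induct)
      case empty
      then show ?case by (simp add: P_def)
    next
      case (insert b I)
      define z where "z = x + P I"
      have near: "dist (z + t *\<^sub>R b) x < d" if t: "t \<in> closed_segment 0 (h \<bullet> b)" for t
      proof -
        have tb: "\<bar>t\<bar> \<le> \<bar>h \<bullet> b\<bar>" using t by (auto simp: closed_segment_eq_real_ivl split: if_splits)
        \<comment> \<open>The increments used so far are coordinates of \<open>h\<close>, the current one a fraction of a coordinate.\<close>
        have "norm (P I + t *\<^sub>R b) \<le> norm h"
        proof (rule norm_le_componentwise)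
          fix b' :: 'a assume b': "b' \<in> Basis"
          have "P I \<bullet> b' = (\<Sum>c\<in>I. if c = b' then h \<bullet> b' else 0)"
            unfolding P_def inner_sum_left using insert.prems b'
            by (intro sum.cong) (auto simp: inner_Basis)
          then have "P I \<bullet> b' = (if b' \<in> I then h \<bullet> b' else 0)"
            using insert.hyps(1) by (simp add: sum.delta)
          moreover have "(t *\<^sub>R b) \<bullet> b' = (if b = b' then t else 0)"
            using insert.prems b' by (auto simp: inner_Basis)
          ultimately show "\<bar>(P I + t *\<^sub>R b) \<bullet> b'\<bar> \<le> \<bar>h \<bullet> b'\<bar>"
            using insert.hyps(2) tb by (auto simp: inner_add_left)
        qed
        then show ?thesis using y by (simp add: dist_norm z_def h_def algebra_simps)
      qed
      have bB: "b \<in> Basis" using insert.prems by simp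
      define k where "k t = f (z + t *\<^sub>R b) - t * g b x" for t
      have "norm (k (h \<bullet> b) - k 0) \<le> e' * norm (h \<bullet> b - 0)"
      proof (rule field_differentiable_bound[where f' = "\<lambda>t. g b (z + t *\<^sub>R b) - g b x"
              and S = "closed_segment 0 (h \<bullet> b)"])
        fix t assume t: "t \<in> closed_segment 0 (h \<bullet> b)"
        have "((\<lambda>u. f (z + t *\<^sub>R b + u *\<^sub>R b)) has_real_derivative g b (z + t *\<^sub>R b)) (at 0)"
          using der d(2)[OF near[OF t]] bB by blast
        then have "((\<lambda>u. f (z + u *\<^sub>R b)) has_real_derivative g b (z + t *\<^sub>R b)) (at t)"
          by (rule DERIV_along_line)
        then show "(k has_field_derivative g b (z + t *\<^sub>R b) - g b x)
            (at t within closed_segment 0 (h \<bullet> b))"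
          unfolding k_def[abs_def]
          by (auto intro!: derivative_eq_intros intro: has_field_derivative_at_within)
        show "norm (g b (z + t *\<^sub>R b) - g b x) \<le> e'"
          using d(3)[OF near[OF t] bB] by simp
      qed auto
      moreover have "e' * norm (h \<bullet> b - 0) \<le> e' * norm h"
        using Basis_le_norm[OF bB] e' by (intro mult_left_mono) auto
      moreover have "x + P (insert b I) = z + (h \<bullet> b) *\<^sub>R b"
        using insert.hyps by (simp add: P_def z_def algebra_simps)
      ultimately show ?case
        using insert by (simp add: k_def z_def algebra_simps)
    qed
    have "x + P Basis = y" unfolding P_def by (simp add: euclidean_representation h_def)
    with step[of Basis] show ?thesis by (simp add: e'_def h_def)
  qed
  with d(1) show "\<exists>d>0. \<forall>y. norm (y - x) < d \<longrightarrow>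
      norm (f y - f x - (\<Sum>b\<in>Basis. ((y - x) \<bullet> b) * g b x)) \<le> e * norm (y - x)"
    by blast
qed

text \<open>
  A strong form of Clairaut's theorem: only one of the two mixed derivatives is supposed to exist. It is used
  for a function whose derivative in \<open>\<theta>\<close> is not known in advance to be differentiable in \<open>s\<close>. The mean value
  inequality, once in each variable, compares the second difference over a rectangle with \<open>h k\<close> times
  the mixed derivative at the origin; then \<open>k \<rightarrow> 0\<close> for fixed \<open>h\<close>.
\<close>

lemma mixed_partials_commute:
  fixes F :: "real \<Rightarrow> real \<Rightarrow> real"
  assumes e: "e > 0"
    and Fa: "\<And>a b. \<bar>a\<bar> < e \<Longrightarrow> \<bar>b\<bar> < e \<Longrightarrow> ((\<lambda>a. F a b) has_real_derivative Fa a b) (at a)"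
    and Fab: "\<And>a b. \<bar>a\<bar> < e \<Longrightarrow> \<bar>b\<bar> < e \<Longrightarrow> ((\<lambda>b. Fa a b) has_real_derivative Fab a b) (at b)"
    and cont: "isCont (\<lambda>(a, b). Fab a b) (0, 0)"
    and Fb: "\<And>a. \<bar>a\<bar> < e \<Longrightarrow> ((\<lambda>b. F a b) has_real_derivative Fb a) (at 0)"
  shows "(Fb has_real_derivative Fab 0 0) (at 0)"
  unfolding DERIV_def LIM_eq
proof (intro allI impI)
  fix r :: real assume r: "r > 0"
  obtain d where d: "d > 0"
      "\<And>z. dist z (0, 0) < d \<Longrightarrow> dist ((\<lambda>(a, b). Fab a b) z) (Fab 0 0) < r / 2"
    using cont r unfolding continuous_at_eps_delta by (metis half_gt_zero case_prod_conv)
  have close: "\<bar>Fab a b - Fab 0 0\<bar> < r / 2" if "\<bar>a\<bar> < d / 2" "\<bar>b\<bar> < d / 2" for a b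
  proof -
    have "dist (a, b) (0, 0) \<le> \<bar>a\<bar> + \<bar>b\<bar>"
      by (simp add: dist_norm norm_Pair sqrt_sum_squares_le_sum_abs)
    then show ?thesis using d(2)[of "(a, b)"] that by (simp add: dist_real_def)
  qed
  define c where "c = min e (d / 2)"
  have c: "c > 0" "c \<le> e" "c \<le> d / 2" using e d by (auto simp: c_def)
  have rect: "\<bar>F h k - F h 0 - F 0 k + F 0 0 - h * k * Fab 0 0\<bar> \<le> r / 2 * (\<bar>h\<bar> * \<bar>k\<bar>)"
    if h: "\<bar>h\<bar> < c" and k: "\<bar>k\<bar> < c" for h k
  proof -
    define u where "u a = F a k - F a 0 - a * k * Fab 0 0" for a
    have "norm (u h - u 0) \<le> (r / 2 * \<bar>k\<bar>) * norm (h - 0)"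
    proof (rule field_differentiable_bound[where S = "closed_segment 0 h"
            and f' = "\<lambda>a. Fa a k - Fa a 0 - k * Fab 0 0"])
      fix a assume "a \<in> closed_segment 0 h"
      then have a: "\<bar>a\<bar> < c" using h by (auto simp: closed_segment_eq_real_ivl split: if_splits)
      show "(u has_field_derivative Fa a k - Fa a 0 - k * Fab 0 0) (at a within closed_segment 0 h)"
        unfolding u_def[abs_def]
        by (rule has_field_derivative_at_within)
          (use a k c e in \<open>auto intro!: derivative_eq_intros Fa\<close>)
      define v where "v b = Fa a b - b * Fab 0 0" for b
      have "norm (v k - v 0) \<le> r / 2 * norm (k - 0)"
      proof (rule field_differentiable_bound[where S = "closed_segment 0 k"
              and f' = "\<lambda>b. Fab a b - Fab 0 0"])
        fix b assume "b \<in> closed_segment 0 k"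
        then have b: "\<bar>b\<bar> < c" using k by (auto simp: closed_segment_eq_real_ivl split: if_splits)
        show "(v has_field_derivative Fab a b - Fab 0 0) (at b within closed_segment 0 k)"
          unfolding v_def[abs_def]
          by (rule has_field_derivative_at_within)
            (use a b c e in \<open>auto intro!: derivative_eq_intros Fab\<close>)
        show "norm (Fab a b - Fab 0 0) \<le> r / 2"
          using close[of a b] a b c by simp
      qed auto
      then show "norm (Fa a k - Fa a 0 - k * Fab 0 0) \<le> r / 2 * \<bar>k\<bar>"
        by (simp add: v_def algebra_simps)
    qed auto
    then show ?thesis by (simp add: u_def algebra_simps)
  qed
  have "\<bar>(Fb h - Fb 0) / h - Fab 0 0\<bar> < r" if h: "h \<noteq> 0" "\<bar>h\<bar> < c" for h
  proof -
    have "((\<lambda>k. (F h k - F h 0) / k - (F 0 k - F 0 0) / k) \<longlongrightarrow> Fb h - Fb 0) (at 0)"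
      using Fb[of h] Fb[of 0] h c e by (intro tendsto_diff) (auto simp: DERIV_def)
    then have lim: "((\<lambda>k. \<bar>((F h k - F h 0) / k - (F 0 k - F 0 0) / k) - h * Fab 0 0\<bar>)
        \<longlongrightarrow> \<bar>(Fb h - Fb 0) - h * Fab 0 0\<bar>) (at 0)"
      by (rule tendsto_rabs[OF tendsto_diff[OF _ tendsto_const]])
    have "\<forall>\<^sub>F k in at 0. \<bar>((F h k - F h 0) / k - (F 0 k - F 0 0) / k) - h * Fab 0 0\<bar> \<le> r / 2 * \<bar>h\<bar>"
      unfolding eventually_at
    proof (intro exI[of _ c] conjI ballI impI)
      fix k :: real assume "k \<noteq> 0 \<and> dist k 0 < c"
      then have k: "k \<noteq> 0" "\<bar>k\<bar> < c" by auto
      have "\<bar>(F h k - F h 0 - F 0 k + F 0 0 - h * k * Fab 0 0) / k\<bar> \<le> r / 2 * \<bar>h\<bar>"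
        using rect[OF h(2) k(2)] k by (simp add: abs_divide divide_simps mult.assoc)
      moreover have "(F h k - F h 0) / k - (F 0 k - F 0 0) / k - h * Fab 0 0
          = (F h k - F h 0 - F 0 k + F 0 0 - h * k * Fab 0 0) / k"
        using k by (simp add: field_simps)
      ultimately show "\<bar>(F h k - F h 0) / k - (F 0 k - F 0 0) / k - h * Fab 0 0\<bar> \<le> r / 2 * \<bar>h\<bar>"
        by simp
    qed (use c in auto)
    then have "\<bar>(Fb h - Fb 0) - h * Fab 0 0\<bar> \<le> r / 2 * \<bar>h\<bar>"
      using lim by (intro tendsto_upperbound[OF lim]) auto
    then have "\<bar>((Fb h - Fb 0) - h * Fab 0 0) / h\<bar> \<le> r / 2"
      using h by (simp add: abs_divide divide_simps)
    moreover have "((Fb h - Fb 0) - h * Fab 0 0) / h = (Fb h - Fb 0) / h - Fab 0 0"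
      using h by (simp add: field_simps)
    ultimately show ?thesis using r by simp
  qed
  then show "\<exists>s>0. \<forall>x. x \<noteq> 0 \<and> norm (x - 0) < s \<longrightarrow>
      norm ((Fb (0 + x) - Fb 0) / x - Fab 0 0) < r"
    using c(1) by auto
qed
lemma open_slices:
  fixes S :: "('a::topological_space \<times> 'b::topological_space) set"
  assumes "open S"
  shows "open {u. (u, v) \<in> S}" "open {w. (u, w) \<in> S}"
proof -
  have "open ((\<lambda>u. (u, v)) -` S)" "open ((\<lambda>w. (u, w)) -` S)"
    using assms by (auto intro!: open_vimage continuous_intros)
  then show "open {u. (u, v) \<in> S}" "open {w. (u, w) \<in> S}" by (simp_all add: vimage_def)
qed

text \<open>
  Only the germ of a function matters for \<open>pdv\<close>, which is a total function with an arbitrary value where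
  the derivative does not exist; iterated partial derivatives are computed with this rule.
\<close>

lemma pdv_eqI:
  fixes f :: "real ^ 'n::finite \<Rightarrow> real"
  assumes "open T" "x \<in> T" "\<And>u. u \<in> T \<Longrightarrow> f u = g u"
    and "((\<lambda>t. g (x + t *\<^sub>R axis i 1)) has_real_derivative D) (at 0)"
  shows "pdv i f x = D"
proof -
  have "open ((\<lambda>t::real. x + t *\<^sub>R axis i 1) -` T)"
    using assms(1) by (intro open_vimage continuous_intros)
  moreover have "((\<lambda>t. g (x + t *\<^sub>R axis i 1)) has_vector_derivative D) (at 0)"
    using assms(4) by (simp add: has_real_derivative_iff_has_vector_derivative)
  ultimately have "((\<lambda>t. f (x + t *\<^sub>R axis i 1)) has_vector_derivative D) (at 0)"
    using assms(2,3) by (elim has_vector_derivative_transform_within_open[rotated]) auto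
  then show ?thesis unfolding pdv_def by (rule vector_derivative_at)
qed

lemma has_derivative_from_continuous_block_partials:
  fixes f :: "real ^ 'd::finite \<Rightarrow> real ^ 'p::finite \<Rightarrow> real"
  assumes S: "open S" "(s, \<theta>) \<in> S"
    and der_s: "\<And>s \<theta> j. (s, \<theta>) \<in> S \<Longrightarrow>
      ((\<lambda>t. f (s + t *\<^sub>R axis j 1) \<theta>) has_real_derivative g s \<theta> $ j) (at 0)"
    and der_\<theta>: "\<And>s \<theta> i. (s, \<theta>) \<in> S \<Longrightarrow>
      ((\<lambda>t. f s (\<theta> + t *\<^sub>R axis i 1)) has_real_derivative h s \<theta> $ i) (at 0)"
    and cont: "continuous_on S (\<lambda>(s, \<theta>). g s \<theta>)" "continuous_on S (\<lambda>(s, \<theta>). h s \<theta>)"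
  shows "((\<lambda>(s, \<theta>). f s \<theta>) has_derivative (\<lambda>(a, b). g s \<theta> \<bullet> a + h s \<theta> \<bullet> b)) (at (s, \<theta>))"
proof -
  define p :: "((real^'d) \<times> (real^'p)) \<Rightarrow> ((real^'d) \<times> (real^'p)) \<Rightarrow> real"
    where "p b z = g (fst z) (snd z) \<bullet> fst b + h (fst z) (snd z) \<bullet> snd b" for b z
  have "((\<lambda>(s, \<theta>). f s \<theta>) has_derivative (\<lambda>x. \<Sum>b\<in>Basis. (x \<bullet> b) * p b (s, \<theta>))) (at (s, \<theta>))"
  proof (rule has_derivative_from_continuous_partials[OF S])
    fix z b :: "(real^'d) \<times> (real^'p)"
    assume z: "z \<in> S" and b: "b \<in> Basis"
    from b consider j where "b = (axis j 1, 0)" | i where "b = (0, axis i 1)"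
      by (auto simp: Basis_prod_def Basis_vec_def)
    then show "((\<lambda>t. case z + t *\<^sub>R b of (s, \<theta>) \<Rightarrow> f s \<theta>) has_real_derivative p b z) (at 0)"
    proof cases
      case 1
      with der_s[of "fst z" "snd z"] z show ?thesis
        by (simp add: p_def inner_axis case_prod_beta)
    next
      case 2
      with der_\<theta>[of "fst z" "snd z"] z show ?thesis
        by (simp add: p_def inner_axis case_prod_beta)
    qed
  next
    fix b :: "(real^'d) \<times> (real^'p)"
    have "continuous_on S (p b)"
      using cont unfolding p_def[abs_def] case_prod_beta by (intro continuous_intros)
    then show "isCont (p b) (s, \<theta>)" using S by (simp add: continuous_on_eq_continuous_at)
  qed
  moreover have "(\<lambda>x. \<Sum>b\<in>Basis. (x \<bullet> b) * p b (s, \<theta>)) = (\<lambda>(a, b). g s \<theta> \<bullet> a + h s \<theta> \<bullet> b)"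
  proof
    fix x :: "(real^'d) \<times> (real^'p)"
    have "(\<Sum>b\<in>Basis. (x \<bullet> b) * p b (s, \<theta>)) = (\<Sum>b\<in>Basis. (x \<bullet> b) * ((g s \<theta>, h s \<theta>) \<bullet> b))"
      by (simp add: p_def inner_prod_def)
    also have "\<dots> = (g s \<theta>, h s \<theta>) \<bullet> x"
      by (subst euclidean_inner) (simp add: mult.commute)
    finally show "(\<Sum>b\<in>Basis. (x \<bullet> b) * p b (s, \<theta>)) = (case x of (a, b) \<Rightarrow> g s \<theta> \<bullet> a + h s \<theta> \<bullet> b)"
      by (simp add: case_prod_beta inner_prod_def)
  qed
  ultimately show ?thesis by simp
qed

lemma directional_derivatives_commute:
  fixes f :: "'a::real_normed_vector \<Rightarrow> real"
  assumes S: "open S" "x \<in> S"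
    and fu: "\<And>z. z \<in> S \<Longrightarrow> ((\<lambda>t. f (z + t *\<^sub>R u)) has_real_derivative fu z) (at 0)"
    and fuv: "\<And>z. z \<in> S \<Longrightarrow> ((\<lambda>t. fu (z + t *\<^sub>R v)) has_real_derivative fuv z) (at 0)"
    and fv: "\<And>z. z \<in> S \<Longrightarrow> ((\<lambda>t. f (z + t *\<^sub>R v)) has_real_derivative fv z) (at 0)"
    and cont: "continuous_on S fuv"
  shows "((\<lambda>t. fv (x + t *\<^sub>R u)) has_real_derivative fuv x) (at 0)"
proof -
  define p where "p = (\<lambda>(a, b). x + a *\<^sub>R u + b *\<^sub>R v)"
  have pc: "continuous_on UNIV p" unfolding p_def case_prod_beta by (intro continuous_intros)
  then have "open (p -` S)" using S(1) by (simp add: continuous_on_open_vimage)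
  moreover have "(0, 0) \<in> p -` S" using S(2) by (simp add: p_def)
  ultimately obtain e where e: "e > 0" "ball (0, 0) e \<subseteq> p -` S"
    unfolding open_contains_ball by blast
  have inS: "x + a *\<^sub>R u + b *\<^sub>R v \<in> S" if "\<bar>a\<bar> < e / 2" "\<bar>b\<bar> < e / 2" for a b
  proof -
    have "dist (0, 0) (a, b) \<le> \<bar>a\<bar> + \<bar>b\<bar>"
      by (simp add: dist_norm norm_Pair sqrt_sum_squares_le_sum_abs)
    then have "(a, b) \<in> ball (0, 0) e" using that by simp
    then show ?thesis using e by (auto simp: p_def)
  qed
  have "((\<lambda>a. fv (x + a *\<^sub>R u)) has_real_derivative fuv (x + 0 *\<^sub>R u + 0 *\<^sub>R v)) (at 0)"
  proof (rule mixed_partials_commute[where e = "e / 2" and F = "\<lambda>a b. f (x + a *\<^sub>R u + b *\<^sub>R v)"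
          and Fa = "\<lambda>a b. fu (x + a *\<^sub>R u + b *\<^sub>R v)"
          and Fab = "\<lambda>a b. fuv (x + a *\<^sub>R u + b *\<^sub>R v)"])
    fix a b :: real
    assume ab: "\<bar>a\<bar> < e / 2" "\<bar>b\<bar> < e / 2"
    have "((\<lambda>t. f (x + b *\<^sub>R v + t *\<^sub>R u)) has_real_derivative fu (x + a *\<^sub>R u + b *\<^sub>R v)) (at a)"
      by (rule DERIV_along_line) (use fu[OF inS[OF ab]] in \<open>simp add: algebra_simps\<close>)
    then show "((\<lambda>a. f (x + a *\<^sub>R u + b *\<^sub>R v)) has_real_derivative fu (x + a *\<^sub>R u + b *\<^sub>R v)) (at a)"
      by (simp add: algebra_simps)
    show "((\<lambda>b. fu (x + a *\<^sub>R u + b *\<^sub>R v)) has_real_derivative fuv (x + a *\<^sub>R u + b *\<^sub>R v)) (at b)"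
      by (rule DERIV_along_line) (use fuv[OF inS[OF ab]] in \<open>simp add: algebra_simps\<close>)
  next
    fix a :: real assume "\<bar>a\<bar> < e / 2"
    then show "((\<lambda>b. f (x + a *\<^sub>R u + b *\<^sub>R v)) has_real_derivative fv (x + a *\<^sub>R u)) (at 0)"
      using fv[OF inS[of a 0]] e by simp
  next
    have "isCont fuv (p (0, 0))"
      using cont S by (simp add: p_def continuous_on_eq_continuous_at)
    then have "isCont (fuv \<circ> p) (0, 0)"
      using pc by (intro continuous_at_compose) (auto simp: continuous_on_eq_continuous_at)
    then show "isCont (\<lambda>(a, b). fuv (x + a *\<^sub>R u + b *\<^sub>R v)) (0, 0)"
      by (simp add: p_def o_def case_prod_unfold)
  qed (use e in auto)
  then show ?thesis by simp
qed

lemma has_derivative_vec_nthI: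
  fixes f :: "'a::real_normed_vector \<Rightarrow> real ^ 'n::finite"
  assumes "\<And>j. ((\<lambda>x. f x $ j) has_derivative (\<lambda>x. f' x $ j)) (at a)"
  shows "(f has_derivative f') (at a)"
  using assms by (subst has_derivative_componentwise_within) (auto simp: Basis_vec_def inner_axis)

text \<open>
  The left-hand side is the Taylor polynomial of \<open>2 cosh x\<close>. The difference \<open>exp x + exp (- x) - 2\<close>
  is the square of \<open>2 sinh (x / 2)\<close>.
\<close>

lemma exp_add_exp_minus_ge:
  fixes x :: real
  shows "2 + x\<^sup>2 \<le> exp x + exp (- x)"
proof -
  have "\<bar>x / 2\<bar> \<le> \<bar>(exp (x / 2) - exp (- x / 2)) / 2\<bar>"
    using real_le_abs_sinh[of "x / 2"] by (simp add: exp_minus)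
  then have "x\<^sup>2 \<le> (exp (x / 2) - exp (- x / 2))\<^sup>2"
    by (simp add: abs_le_square_iff[symmetric])
  also have "\<dots> = exp x + exp (- x) - 2"
    by (simp add: power2_diff exp_add[symmetric] exp_double[symmetric] flip: mult.assoc)
  finally show ?thesis by simp
qed

section \<open>Definite matrices and perturbed minima\<close>

lemma positive_definite_coercive:
  fixes A :: "real ^ 'n ^ 'n::finite"
  assumes "\<And>v. v \<noteq> 0 \<Longrightarrow> 0 < v \<bullet> (A *v v)"
  obtains a where "a > 0" "\<And>v. a * (norm v)\<^sup>2 \<le> v \<bullet> (A *v v)"
proof -
  have "\<exists>x\<in>sphere 0 1. \<forall>y\<in>sphere 0 1. x \<bullet> (A *v x) \<le> y \<bullet> (A *v y)"
  proof (rule continuous_attains_inf)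
    have "axis undefined 1 \<in> sphere (0::real^'n) 1" by simp
    then show "sphere (0::real^'n) 1 \<noteq> {}" by blast
  qed (auto intro!: continuous_intros)
  then obtain x where x: "norm x = 1" "\<And>y. norm y = 1 \<Longrightarrow> x \<bullet> (A *v x) \<le> y \<bullet> (A *v y)"
    by auto
  show ?thesis
  proof (rule that[of "x \<bullet> (A *v x)"])
    show "0 < x \<bullet> (A *v x)" using x by (intro assms) auto
    fix v :: "real^'n"
    show "x \<bullet> (A *v x) * (norm v)\<^sup>2 \<le> v \<bullet> (A *v v)"
    proof (cases "v = 0")
      case False
      define y where "y = v /\<^sub>R norm v"
      have "x \<bullet> (A *v x) \<le> y \<bullet> (A *v y)" by (intro x) (simp add: y_def False)
      then have "x \<bullet> (A *v x) * (norm v)\<^sup>2 \<le> y \<bullet> (A *v y) * (norm v)\<^sup>2"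
        by (intro mult_right_mono) auto
      also have "\<dots> = (norm v *\<^sub>R y) \<bullet> (A *v (norm v *\<^sub>R y))"
        by (simp add: matrix_vector_mult_scaleR power2_eq_square)
      also have "norm v *\<^sub>R y = v" using False by (simp add: y_def)
      finally show ?thesis .
    qed simp
  qed
qed

lemma definite_invertible:
  fixes A :: "real ^ 'n ^ 'n::finite"
  assumes "\<And>v. v \<noteq> 0 \<Longrightarrow> v \<bullet> (A *v v) \<noteq> 0"
  shows "invertible A"
proof -
  have "A *v v = 0 \<Longrightarrow> v = 0" for v using assms[of v] by fastforce
  then show ?thesis
    by (simp add: invertible_left_inverse matrix_left_invertible_ker)
qed

text \<open>
  The determinant does not vanish on the segment from \<open>mat 1\<close> to \<open>A\<close>, since all matrices on it are positive
  definite.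
\<close>

lemma positive_definite_det_pos:
  fixes A :: "real ^ 'n ^ 'n::finite"
  assumes pd: "\<And>v. v \<noteq> 0 \<Longrightarrow> 0 < v \<bullet> (A *v v)"
  shows "0 < det A"
proof (rule ccontr)
  assume neg: "\<not> 0 < det A"
  define P where "P t = t *\<^sub>R A + (1 - t) *\<^sub>R mat 1" for t :: real
  have "\<exists>t\<ge>0. t \<le> 1 \<and> det (P t) = 0"
  proof (rule IVT2')
    show "continuous_on {0..1} (\<lambda>t. det (P t))"
      unfolding P_def det_def by (intro continuous_intros)
  qed (use neg in \<open>auto simp: P_def\<close>)
  then obtain t where t: "0 \<le> t" "t \<le> 1" "det (P t) = 0" by blast
  have "0 < v \<bullet> (P t *v v)" if v: "v \<noteq> 0" for v
  proof -
    have "v \<bullet> (P t *v v) = t * (v \<bullet> (A *v v)) + (1 - t) * (v \<bullet> v)"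
      by (simp add: P_def matrix_vector_mult_add_rdistrib scaleR_matrix_vector_assoc[symmetric] inner_add_right)
    moreover have "t * (v \<bullet> (A *v v)) \<ge> 0" "(1 - t) * (v \<bullet> v) \<ge> 0" using t pd[OF v] by auto
    moreover have "t * (v \<bullet> (A *v v)) > 0 \<or> (1 - t) * (v \<bullet> v) > 0"
      using t pd[OF v] v by (cases "t = 0") auto
    ultimately show ?thesis by linarith
  qed
  then have "invertible (P t)" by (intro definite_invertible) force
  with t show False by (simp add: invertible_det_nz)
qed

lemma matrix_inv_cancel:
  fixes A :: "real ^ 'n ^ 'n::finite"
  assumes "invertible A"
  shows "A ** matrix_inv A = mat 1" "matrix_inv A ** A = mat 1" "A *v (matrix_inv A *v v) = v"
proof -
  have "A ** matrix_inv A = mat 1 \<and> matrix_inv A ** A = mat 1"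
    using assms unfolding invertible_def matrix_inv_def by (rule someI_ex)
  then show "A ** matrix_inv A = mat 1" "matrix_inv A ** A = mat 1" "A *v (matrix_inv A *v v) = v"
    by (auto simp: matrix_vector_mul_assoc)
qed

lemma transpose_matrix_inv:
  fixes A :: "real ^ 'n ^ 'n::finite"
  assumes "invertible A" "transpose A = A"
  shows "transpose (matrix_inv A) = matrix_inv A"
proof -
  have "transpose (matrix_inv A) ** A = mat 1"
    using matrix_inv_cancel(1)[OF assms(1)] assms(2) by (metis matrix_transpose_mul transpose_mat)
  then have "transpose (matrix_inv A) ** A ** matrix_inv A = mat 1 ** matrix_inv A" by simp
  then show ?thesis
    using matrix_inv_cancel(1)[OF assms(1)] by (simp add: matrix_mul_assoc[symmetric])
qed

lemma inner_matrix_transpose: "(A *v x) \<bullet> y = x \<bullet> (transpose A *v (y::real^'m::finite))"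
  for A :: "real ^ 'n::finite ^ 'm"
  by (metis dot_lmul_matrix inner_commute transpose_matrix_vector)

lemma minus_matrix_vector_mult: "(- A) *v x = - (A *v x)" for A :: "real ^ 'n::finite ^ 'm::finite"
  by (simp add: matrix_vector_mult_def vec_eq_iff sum_negf)

lemma complete_the_square:
  fixes A :: "real ^ 'n ^ 'n::finite"
  assumes "transpose A = A"
  shows "x \<bullet> (A *v x) / 2 - x \<bullet> (A *v c) = (x - c) \<bullet> (A *v (x - c)) / 2 - c \<bullet> (A *v c) / 2"
proof -
  have "c \<bullet> (A *v x) = x \<bullet> (A *v c)"
    using inner_matrix_transpose[of A c x] assms by (simp add: inner_commute)
  then show ?thesis
    by (simp add: matrix_vector_mult_diff_distrib inner_diff_left inner_diff_right field_simps)
qed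

lemma det_scaleR:
  fixes A :: "real ^ 'n ^ 'n::finite"
  shows "det (c *\<^sub>R A) = c ^ CARD('n) * det A"
proof -
  have "c *\<^sub>R A = matrix ((*\<^sub>R) c) ** A"
    by (simp add: matrix_eq matrix_vector_mul_assoc[symmetric] scaleR_matrix_vector_assoc[symmetric])
  then show ?thesis by (simp add: det_mul)
qed

lemma continuous_on_det:
  fixes f :: "'a::topological_space \<Rightarrow> real ^ 'n ^ 'n::finite"
  assumes "continuous_on S f"
  shows "continuous_on S (\<lambda>x. det (f x))"
  unfolding det_def using assms by (intro continuous_intros)

lemma matrix_mult_minus:
  fixes X :: "real ^ 'n::finite ^ 'm::finite" and Y :: "real ^ 'k::finite ^ 'n"
  shows "(- X) ** Y = - (X ** Y)" "X ** (- Y) = - (X ** Y)" "transpose (- X) = - transpose X"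
  by (simp_all add: matrix_matrix_mult_def transpose_def vec_eq_iff sum_negf)

text \<open>
  If \<open>f\<close> is within \<open>\<eta>\<close> of a function that grows quadratically away from its minimum over \<open>p = c\<close>, then the
  minimiser of \<open>f\<close> lies over the open \<open>\<epsilon>\<close>-ball: closeness at scale \<open>\<epsilon>\<close> only costs \<open>2 \<eta> < a \<epsilon>\<^sup>2\<close>. The
  projection \<open>p\<close> allows \<open>X\<close> to be a set of pairs \<open>(s, \<theta>)\<close> of which only \<open>\<theta>\<close> is localised.
\<close>

lemma perturbed_minimum:
  fixes f :: "'b::topological_space \<Rightarrow> real" and p :: "'b \<Rightarrow> 'a::real_normed_vector"
  assumes X: "compact X" "continuous_on X f"
    and c: "c' \<in> X" "p c' = c" "f c' \<le> k + \<eta>"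
    and low: "\<And>x. x \<in> X \<Longrightarrow> k + a * (norm (p x - c))\<^sup>2 - \<eta> \<le> f x"
    and a: "0 < a" "2 * \<eta> < a * \<epsilon>\<^sup>2" and e: "0 < \<epsilon>"
  obtains x where "x \<in> X" "norm (p x - c) < \<epsilon>" "\<And>z. z \<in> X \<Longrightarrow> f x \<le> f z" "\<bar>f x - k\<bar> \<le> \<eta>"
proof -
  obtain x where x: "x \<in> X" "\<And>z. z \<in> X \<Longrightarrow> f x \<le> f z"
    using continuous_attains_inf[OF X(1) _ X(2)] c(1) by blast
  have le: "k + a * (norm (p x - c))\<^sup>2 - \<eta> \<le> k + \<eta>"
    using low[OF x(1)] x(2)[OF c(1)] c(3) by linarith
  then have "a * (norm (p x - c))\<^sup>2 < a * \<epsilon>\<^sup>2" using a by linarith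
  then have "(norm (p x - c))\<^sup>2 < \<epsilon>\<^sup>2" using a by simp
  then have "norm (p x - c) < \<epsilon>" using e by (simp add: power2_less_imp_less)
  moreover have "0 \<le> a * (norm (p x - c))\<^sup>2" using a by simp
  then have "\<bar>f x - k\<bar> \<le> \<eta>"
    using low[OF x(1)] x(2)[OF c(1)] c(3) by linarith
  ultimately show ?thesis using that x by blast
qed
section \<open>Convergence in distribution under an approximate map\<close>

text \<open>
  The approximation is supposed only on bounded sets of values of \<open>X n\<close>; the rest has small probability, because
  a sequence that converges in distribution is tight.
\<close>

lemma slutsky_continuous_mapping:
  fixes X :: "nat \<Rightarrow> 'v \<Rightarrow> 'a::euclidean_space" and Z :: "nat \<Rightarrow> 'v \<Rightarrow> 'b::euclidean_space"
    and P :: "nat \<Rightarrow> 'v measure"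
  assumes P: "\<And>n. prob_space (P n)"
    and X: "\<And>n. X n \<in> borel_measurable (P n)" and Z: "\<And>n. Z n \<in> borel_measurable (P n)"
    and Q: "prob_space Q" "sets Q = sets borel"
    and conv: "converges_in_distribution P X Q"
    and g: "continuous_on UNIV g"
    and approx: "\<And>M \<epsilon>. 0 < M \<Longrightarrow> 0 < \<epsilon> \<Longrightarrow>
      \<forall>\<^sub>F n in sequentially. \<forall>\<omega>\<in>space (P n). norm (X n \<omega>) \<le> M \<longrightarrow> dist (Z n \<omega>) (g (X n \<omega>)) < \<epsilon>"
  shows "converges_in_distribution P Z (distr Q borel g)"
  unfolding converges_in_distribution_def
proof (intro allI impI)
  fix f :: "'b \<Rightarrow> real"
  assume f: "continuous_on UNIV f" and bdd: "bounded (range f)"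
  obtain b where b: "b > 0" "\<And>x. \<bar>f x\<bar> \<le> b"
    using bdd unfolding bounded_pos by auto
  have fm [measurable]: "f \<in> borel_measurable borel" using f by (rule borel_measurable_continuous_onI)
  have gm [measurable]: "g \<in> borel_measurable borel" using g by (rule borel_measurable_continuous_onI)
  note [measurable] = X Z
  interpret Q: prob_space Q by (rule Q)
  have lim: "(\<lambda>n. LINT \<omega>|P n. f (g (X n \<omega>))) \<longlonglongrightarrow> (LINT x|Q. f (g x))"
  proof -
    have "continuous_on UNIV (\<lambda>x. f (g x))"
      using continuous_on_compose2[OF f g] by simp
    moreover have "bounded (range (\<lambda>x. f (g x)))"
      using b by (auto simp: bounded_iff)
    ultimately show ?thesis using conv unfolding converges_in_distribution_def by blast
  qed
  have "(\<lambda>n. (LINT \<omega>|P n. f (Z n \<omega>)) - (LINT \<omega>|P n. f (g (X n \<omega>)))) \<longlonglongrightarrow> 0"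
    unfolding LIMSEQ_def
  proof (intro allI impI)
    fix r :: real assume r: "r > 0"
    define e where "e = r / (2 * (1 + 2 * b))"
    have e: "e > 0" using r b by (simp add: e_def)
    \<comment> \<open>A continuous cutoff that dominates the event \<open>norm x > M + 1\<close>, so that its expectation passes to the limit.\<close>
    define \<tau> where "\<tau> M x = max 0 (min 1 (norm x - M))" for M and x :: 'a
    have \<tau>c: "continuous_on UNIV (\<tau> M)" for M
      unfolding \<tau>_def by (intro continuous_intros)
    have \<tau>m [measurable]: "\<tau> M \<in> borel_measurable borel" for M
      using \<tau>c by (rule borel_measurable_continuous_onI)
    have \<tau>01: "0 \<le> \<tau> M x" "\<tau> M x \<le> 1" for M x by (auto simp: \<tau>_def)
    \<comment> \<open>The limit law gives little mass to the outside of a large ball, and by convergence so do the laws of \<open>X n\<close>.\<close>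
    have "(\<lambda>k. LINT x|Q. \<tau> (real k) x) \<longlonglongrightarrow> (LINT x|Q. 0)"
    proof (rule integral_dominated_convergence[where w = "\<lambda>_. 1"])
      show "AE x in Q. (\<lambda>k. \<tau> (real k) x) \<longlonglongrightarrow> 0"
      proof (intro AE_I2 tendsto_eventually)
        fix x :: 'a
        show "\<forall>\<^sub>F k in sequentially. \<tau> (real k) x = 0"
          using eventually_ge_at_top[of "nat \<lceil>norm x\<rceil>"]
        proof eventually_elim
          case (elim k)
          then have "norm x \<le> real k" by linarith
          then show ?case by (simp add: \<tau>_def)
        qed
      qed
    qed (use \<tau>01 Q(2) in \<open>auto simp: measurable_cong_sets[OF Q(2) refl]\<close>)
    then have "\<forall>\<^sub>F k in sequentially. (LINT x|Q. \<tau> (real k) x) < e"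
      using e by (auto dest: order_tendstoD(2))
    then obtain k where k: "(LINT x|Q. \<tau> (real k) x) < e" by (auto simp: eventually_sequentially)
    define M where "M = real k"
    have "(\<lambda>n. LINT \<omega>|P n. \<tau> M (X n \<omega>)) \<longlonglongrightarrow> (LINT x|Q. \<tau> M x)"
    proof -
      have "\<bar>\<tau> M x\<bar> \<le> 1" for x using \<tau>01[of M x] by simp
      then have "bounded (range (\<tau> M))" by (auto simp: bounded_iff)
      then show ?thesis using conv \<tau>c unfolding converges_in_distribution_def by blast
    qed
    then have tight: "\<forall>\<^sub>F n in sequentially. (LINT \<omega>|P n. \<tau> M (X n \<omega>)) < e"
      using k by (auto simp: M_def dest: order_tendstoD(2))
    have "compact (g ` cball 0 (M + 1))"
      using g by (intro compact_continuous_image compact_cball) (auto intro: continuous_on_subset)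
    then have "bounded (g ` cball 0 (M + 1))" by (rule compact_imp_bounded)
    then obtain c where "\<forall>x\<in>cball 0 (M + 1). norm (g x) \<le> c"
      unfolding bounded_iff by auto
    then have c: "\<And>x. norm x \<le> M + 1 \<Longrightarrow> norm (g x) \<le> c" by simp
    have "uniformly_continuous_on (cball 0 (c + 1)) f"
      using f by (intro compact_uniformly_continuous compact_cball) (auto intro: continuous_on_subset)
    then obtain d where d: "d > 0" "\<And>x y. x \<in> cball 0 (c + 1) \<Longrightarrow> y \<in> cball 0 (c + 1) \<Longrightarrow>
        dist y x < d \<Longrightarrow> dist (f y) (f x) < e"
      using e unfolding uniformly_continuous_on_def by meson
    have "M + 1 > 0" "min d 1 > 0" using d by (auto simp: M_def)
    from tight approx[OF this]
    have "\<forall>\<^sub>F n in sequentially. dist ((LINT \<omega>|P n. f (Z n \<omega>)) - (LINT \<omega>|P n. f (g (X n \<omega>)))) 0 < r"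
    proof eventually_elim
      case (elim n)
      interpret prob_space "P n" by (rule P)
      have i: "integrable (P n) (\<lambda>\<omega>. f (Z n \<omega>))" "integrable (P n) (\<lambda>\<omega>. f (g (X n \<omega>)))"
        "integrable (P n) (\<lambda>\<omega>. \<tau> M (X n \<omega>))"
        by (rule integrable_const_bound[of _ b], use b in simp, measurable)
          (rule integrable_const_bound[of _ b], use b in simp, measurable,
            rule integrable_const_bound[of _ 1], use \<tau>01 in simp, measurable)
      have pt: "\<bar>f (Z n \<omega>) - f (g (X n \<omega>))\<bar> \<le> e + 2 * b * \<tau> M (X n \<omega>)" if \<omega>: "\<omega> \<in> space (P n)" for \<omega>
      proof (cases "norm (X n \<omega>) \<le> M + 1")
        case True
        have cl: "dist (Z n \<omega>) (g (X n \<omega>)) < min d 1" using elim(2) \<omega> True by blast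
        then have "norm (Z n \<omega>) \<le> c + 1"
          using c[OF True] norm_triangle_ineq2[of "Z n \<omega>" "g (X n \<omega>)"] by (simp add: dist_norm)
        then have "\<bar>f (Z n \<omega>) - f (g (X n \<omega>))\<bar> < e"
          using d(2)[of "g (X n \<omega>)" "Z n \<omega>"] c[OF True] cl by (simp add: dist_norm)
        moreover have "2 * b * \<tau> M (X n \<omega>) \<ge> 0" using b \<tau>01 by simp
        ultimately show ?thesis by linarith
      next
        case False
        then have "\<tau> M (X n \<omega>) = 1" by (simp add: \<tau>_def)
        then show ?thesis using b(2)[of "Z n \<omega>"] b(2)[of "g (X n \<omega>)"] e by simp
      qed
      have "\<bar>(LINT \<omega>|P n. f (Z n \<omega>)) - (LINT \<omega>|P n. f (g (X n \<omega>)))\<bar>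
          = \<bar>LINT \<omega>|P n. f (Z n \<omega>) - f (g (X n \<omega>))\<bar>"
        using i by simp
      also have "\<dots> \<le> (LINT \<omega>|P n. \<bar>f (Z n \<omega>) - f (g (X n \<omega>))\<bar>)"
        by (rule integral_abs_bound)
      also have "\<dots> \<le> (LINT \<omega>|P n. e + 2 * b * \<tau> M (X n \<omega>))"
        using i pt by (intro integral_mono) auto
      also have "\<dots> = e + 2 * b * (LINT \<omega>|P n. \<tau> M (X n \<omega>))"
        using i by (simp add: prob_space)
      also have "\<dots> \<le> e + 2 * b * e" using elim(1) b by simp
      also have "\<dots> = r / 2"
      proof -
        have "e + 2 * b * e = e * (1 + 2 * b)" by (simp add: algebra_simps)
        also have "\<dots> = r / 2" using b by (simp add: e_def field_simps)
        finally show ?thesis .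
      qed
      also have "\<dots> < r" using r by simp
      finally show ?case by (simp add: dist_real_def)
    qed
    then show "\<exists>no. \<forall>n\<ge>no. dist ((LINT \<omega>|P n. f (Z n \<omega>)) - (LINT \<omega>|P n. f (g (X n \<omega>)))) 0 < r"
      by (simp add: eventually_sequentially)
  qed
  from tendsto_add[OF this lim]
  have "(\<lambda>n. LINT \<omega>|P n. f (Z n \<omega>)) \<longlonglongrightarrow> (LINT x|Q. f (g x))" by simp
  moreover have "(LINT x|distr Q borel g. f x) = (LINT x|Q. f (g x))"
    by (rule integral_distr) (auto simp: measurable_cong_sets[OF Q(2) refl])
  ultimately show "(\<lambda>n. LINT \<omega>|P n. f (Z n \<omega>)) \<longlonglongrightarrow> (LINT x|distr Q borel g. f x)" by simp
qed

text \<open>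
  A linear functional \<open>v\<close> of \<open>G x\<close> is the functional \<open>G\<^sup>T v\<close> of \<open>x\<close>.
\<close>

lemma centred_normal_linear_image:
  fixes G :: "real ^ 'd::finite ^ 'p::finite"
  assumes W: "centred_normal \<Sigma> W"
  shows "centred_normal (G ** \<Sigma> ** transpose G) (distr W borel (\<lambda>x. G *v x))"
proof -
  have psd: "positive_semidefinite \<Sigma>" and pW: "prob_space W" and sW: "sets W = sets borel"
    and nW: "\<And>v. distr W borel (\<lambda>x. v \<bullet> x) = (if v \<bullet> (\<Sigma> *v v) = 0 then return borel 0
       else density lborel (\<lambda>t. ennreal (normal_density 0 (sqrt (v \<bullet> (\<Sigma> *v v))) t)))"
    using W by (auto simp: centred_normal_def)
  have Gm: "(\<lambda>x. G *v x) \<in> borel_measurable borel"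
    by (intro borel_measurable_continuous_onI continuous_intros)
  then have GmW: "(\<lambda>x. G *v x) \<in> measurable W borel"
    by (simp add: measurable_cong_sets[OF sW refl])
  have q: "v \<bullet> ((G ** \<Sigma> ** transpose G) *v v) = (transpose G *v v) \<bullet> (\<Sigma> *v (transpose G *v v))" for v
    using inner_matrix_transpose[of "transpose G" v "\<Sigma> *v (transpose G *v v)"]
    by (simp add: matrix_vector_mul_assoc[symmetric] del: transpose_matrix_vector)
  have l: "(\<lambda>x. v \<bullet> (G *v x)) = (\<lambda>x. (transpose G *v v) \<bullet> x)" for v
    using inner_matrix_transpose[of G _ v] by (simp add: inner_commute del: transpose_matrix_vector)
  have "distr (distr W borel (\<lambda>x. G *v x)) borel (\<lambda>x. v \<bullet> x)
      = distr W borel (\<lambda>x. (transpose G *v v) \<bullet> x)" for v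
    using GmW by (subst distr_distr) (auto simp: o_def l simp del: transpose_matrix_vector)
  moreover have "transpose (G ** \<Sigma> ** transpose G) = G ** \<Sigma> ** transpose G"
    using psd by (simp add: positive_semidefinite_def matrix_transpose_mul matrix_mul_assoc)
  ultimately show ?thesis
    using psd prob_space.prob_space_distr[OF pW GmW]
    by (simp add: centred_normal_def positive_semidefinite_def q nW del: transpose_matrix_vector)
qed

section \<open>Smoothness of the cumulant generating function\<close>

lemma cvec_add_axis: "cvec s 0 + t *\<^sub>R axis j 1 = cvec (s + t *\<^sub>R axis j 1) 0"
  by (simp add: vec_eq_iff cvec_def axis_def complex_eq_iff)

locale cgf_model =
  fixes R :: "(real ^ 'p::finite) set"
    and \<Omega> :: "real ^ 'p \<Rightarrow> 'w measure"
    and Y :: "real ^ 'p \<Rightarrow> 'w \<Rightarrow> real ^ 'd::finite"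
  assumes open_R: "open R"
    and prob: "\<And>\<theta>. \<theta> \<in> R \<Longrightarrow> prob_space (\<Omega> \<theta>)"
    and meas: "\<And>\<theta>. \<theta> \<in> R \<Longrightarrow> Y \<theta> \<in> borel_measurable (\<Omega> \<theta>)"
    and decay: "decay_condition R \<Omega> Y"
    and growth: "growth_condition R \<Omega> Y"
begin

abbreviation S where "S \<equiv> interior (S_dom R \<Omega> Y)"

abbreviation K where "K \<equiv> K0 \<Omega> Y"

text \<open>
  The derivatives of the moment generating function on the real slice \<open>\<phi> = 0\<close>; the empty lists give the
  moment generating function itself.
\<close>

definition mgf_pdv :: "'p list \<Rightarrow> 'd list \<Rightarrow> real ^ 'd \<Rightarrow> real ^ 'p \<Rightarrow> real"
  where "mgf_pdv is js s \<theta> = Re (mixed_pdv is js (M0 \<Omega> Y) (cvec s 0) \<theta>)"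

lemma S_in:
  assumes "(s, \<theta>) \<in> S"
  shows "\<theta> \<in> R" "integrable (\<Omega> \<theta>) (\<lambda>\<omega>. exp (s \<bullet> Y \<theta> \<omega>))"
  using interior_subset[of "S_dom R \<Omega> Y"] assms by (auto simp: S_dom_def)

text \<open>
  The two parts of the growth condition that carry the smoothness: existence of the derivatives at complex
  arguments, and their joint continuity.
\<close>

lemma growthD:
  assumes "growth_orders (length is) (length js)"
  shows "\<And>s \<theta> \<phi>. (s, \<theta>) \<in> S \<Longrightarrow> has_mixed_pdv is js (M0 \<Omega> Y) (cvec s \<phi>) \<theta>"
    and "continuous_on {(s, \<phi>, \<theta>). (s, \<theta>) \<in> S} (\<lambda>(s, \<phi>, \<theta>). mixed_pdv is js (M0 \<Omega> Y) (cvec s \<phi>) \<theta>)"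
  using growth assms unfolding growth_condition_def by blast+

lemma mgf_pdv_deriv_s:
  assumes "growth_orders 0 (Suc (length js))" "(s, \<theta>) \<in> S"
  shows "((\<lambda>t. mgf_pdv [] js (s + t *\<^sub>R axis j 1) \<theta>) has_real_derivative mgf_pdv [] (j # js) s \<theta>) (at 0)"
proof -
  have "has_mixed_pdv [] (j # js) (M0 \<Omega> Y) (cvec s 0) \<theta>"
    using assms by (intro growthD) auto
  then have "((\<lambda>t. mixed_pdv [] js (M0 \<Omega> Y) (cvec s 0 + t *\<^sub>R axis j 1) \<theta>) has_vector_derivative
      mixed_pdv [] (j # js) (M0 \<Omega> Y) (cvec s 0) \<theta>) (at 0)"
    by (simp add: has_pdv_def pdv_def vector_derivative_works)
  from bounded_linear.has_vector_derivative[OF bounded_linear_Re this]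
  show ?thesis
    by (simp add: mgf_pdv_def cvec_add_axis has_real_derivative_iff_has_vector_derivative)
qed

lemma mgf_pdv_deriv_\<theta>:
  assumes "growth_orders (Suc (length is)) (length js)" "(s, \<theta>) \<in> S"
  shows "((\<lambda>t. mgf_pdv is js s (\<theta> + t *\<^sub>R axis i 1)) has_real_derivative mgf_pdv (i # is) js s \<theta>) (at 0)"
proof -
  have "has_mixed_pdv (i # is) js (M0 \<Omega> Y) (cvec s 0) \<theta>"
    using assms by (intro growthD) auto
  then have "((\<lambda>t. mixed_pdv is js (M0 \<Omega> Y) (cvec s 0) (\<theta> + t *\<^sub>R axis i 1)) has_vector_derivative
      mixed_pdv (i # is) js (M0 \<Omega> Y) (cvec s 0) \<theta>) (at 0)"
    by (simp add: has_pdv_def pdv_def vector_derivative_works)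
  from bounded_linear.has_vector_derivative[OF bounded_linear_Re this]
  show ?thesis
    by (simp add: mgf_pdv_def has_real_derivative_iff_has_vector_derivative)
qed

lemma mgf_pdv_continuous:
  assumes "growth_orders (length is) (length js)"
  shows "continuous_on S (\<lambda>(s, \<theta>). mgf_pdv is js s \<theta>)"
proof -
  have "continuous_on S ((\<lambda>(s, \<phi>, \<theta>). mixed_pdv is js (M0 \<Omega> Y) (cvec s \<phi>) \<theta>) \<circ> (\<lambda>z. (fst z, 0, snd z)))"
  proof (rule continuous_on_compose)
    show "continuous_on S (\<lambda>z. (fst z, 0::real^'d, snd z))" by (intro continuous_intros)
    show "continuous_on ((\<lambda>z. (fst z, 0::real^'d, snd z)) ` S)
        (\<lambda>(s, \<phi>, \<theta>). mixed_pdv is js (M0 \<Omega> Y) (cvec s \<phi>) \<theta>)"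
      by (rule continuous_on_subset[OF growthD(2)[OF assms]]) auto
  qed
  then have "continuous_on S (\<lambda>z. Re (((\<lambda>(s, \<phi>, \<theta>). mixed_pdv is js (M0 \<Omega> Y) (cvec s \<phi>) \<theta>) \<circ> (\<lambda>z. (fst z, 0, snd z))) z))"
    by (rule continuous_on_Re)
  then show ?thesis by (simp add: mgf_pdv_def case_prod_beta o_def)
qed

lemma M0_integrand:
  "exp (\<Sum>j\<in>UNIV. cvec s \<phi> $ j * complex_of_real (y $ j))
    = complex_of_real (exp (s \<bullet> y)) * cis (\<phi> \<bullet> y)"
proof -
  have "(\<Sum>j\<in>UNIV. cvec s \<phi> $ j * complex_of_real (y $ j)) = Complex (s \<bullet> y) (\<phi> \<bullet> y)"
    by (simp add: complex_eq_iff cvec_def inner_vec_def)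
  then show ?thesis by (simp add: exp_eq_polar cis_def)
qed

lemma M0_real: "M0 \<Omega> Y (cvec s 0) \<theta> = complex_of_real (LINT \<omega>|\<Omega> \<theta>. exp (s \<bullet> Y \<theta> \<omega>))"
  unfolding M0_def M0_integrand by simp

lemma mgf_pos:
  assumes "\<theta> \<in> R" "integrable (\<Omega> \<theta>) (\<lambda>\<omega>. exp (s \<bullet> Y \<theta> \<omega>))"
  shows "0 < (LINT \<omega>|\<Omega> \<theta>. exp (s \<bullet> Y \<theta> \<omega>))"
proof -
  interpret prob_space "\<Omega> \<theta>" using prob assms by blast
  have "(LINT \<omega>|\<Omega> \<theta>. exp (s \<bullet> Y \<theta> \<omega>)) \<noteq> 0"
    by (subst integral_nonneg_eq_0_iff_AE[OF assms(2)]) auto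
  moreover have "(LINT \<omega>|\<Omega> \<theta>. exp (s \<bullet> Y \<theta> \<omega>)) \<ge> 0" by (intro Bochner_Integration.integral_nonneg) auto
  ultimately show ?thesis by linarith
qed

lemma K_eq: "K s \<theta> = ln (mgf_pdv [] [] s \<theta>)"
  by (simp add: K0_def mgf_pdv_def)

lemma mgf_pdv_nil: "mgf_pdv [] [] s \<theta> = (LINT \<omega>|\<Omega> \<theta>. exp (s \<bullet> Y \<theta> \<omega>))"
  by (simp add: mgf_pdv_def M0_real)

lemma mgf_pdv_pos: "(s, \<theta>) \<in> S \<Longrightarrow> 0 < mgf_pdv [] [] s \<theta>"
  using mgf_pos S_in by (simp add: mgf_pdv_nil)

text \<open>
  The growth condition starts with first derivatives. Continuity of the moment generating function itself follows
  because continuous partial derivatives make it differentiable.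
\<close>

lemma mgf_continuous: "continuous_on S (\<lambda>(s, \<theta>). mgf_pdv [] [] s \<theta>)"
proof (rule differentiable_imp_continuous_on, unfold differentiable_on_def, intro ballI)
  fix z assume z: "z \<in> S"
  have "((\<lambda>(s, \<theta>). mgf_pdv [] [] s \<theta>) has_derivative
      (\<lambda>(a, b). (\<chi> j. mgf_pdv [] [j] (fst z) (snd z)) \<bullet> a + (\<chi> i. mgf_pdv [i] [] (fst z) (snd z)) \<bullet> b)) (at (fst z, snd z))"
    by (rule has_derivative_from_continuous_block_partials[where S = S])
      (use z mgf_pdv_continuous[of "[]" "[_]"] mgf_pdv_continuous[of "[_]" "[]"] in
        \<open>auto simp: growth_orders_def case_prod_beta
          intro!: mgf_pdv_deriv_s mgf_pdv_deriv_\<theta> continuous_on_vec_lambda\<close>)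
  then show "(\<lambda>(s, \<theta>). mgf_pdv [] [] s \<theta>) differentiable at z within S"
    using differentiable_at_withinI differentiableI by fastforce
qed

lemmas mgf_pdv_conts = mgf_continuous[unfolded case_prod_beta] mgf_pdv_continuous[unfolded case_prod_beta]

text \<open>
  The first and second derivatives of \<open>K = log M\<close>, written through those of \<open>M\<close> by the quotient rule. In \<open>Kst\<close> the
  \<open>s\<close>-derivative is taken first, the order for which existence is supposed; the letter t stands for \<open>\<theta>\<close>.
\<close>

definition Ks where "Ks s \<theta> = (\<chi> j. mgf_pdv [] [j] s \<theta> / mgf_pdv [] [] s \<theta>)"
definition Kt where "Kt s \<theta> = (\<chi> i. mgf_pdv [i] [] s \<theta> / mgf_pdv [] [] s \<theta>)"
definition Kss where "Kss s \<theta> = (\<chi> i j. (mgf_pdv [] [i, j] s \<theta> * mgf_pdv [] [] s \<theta> - mgf_pdv [] [j] s \<theta> * mgf_pdv [] [i] s \<theta>)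
  / (mgf_pdv [] [] s \<theta> * mgf_pdv [] [] s \<theta>))"
definition Kst where "Kst s \<theta> = (\<chi> j i. (mgf_pdv [i] [j] s \<theta> * mgf_pdv [] [] s \<theta> - mgf_pdv [] [j] s \<theta> * mgf_pdv [i] [] s \<theta>)
  / (mgf_pdv [] [] s \<theta> * mgf_pdv [] [] s \<theta>))"
definition Ktt where "Ktt s \<theta> = (\<chi> i j. (mgf_pdv [i, j] [] s \<theta> * mgf_pdv [] [] s \<theta> - mgf_pdv [j] [] s \<theta> * mgf_pdv [i] [] s \<theta>)
  / (mgf_pdv [] [] s \<theta> * mgf_pdv [] [] s \<theta>))"

lemma K_continuous:
  "continuous_on S (\<lambda>(s, \<theta>). K s \<theta>)" "continuous_on S (\<lambda>(s, \<theta>). Ks s \<theta>)"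
  "continuous_on S (\<lambda>(s, \<theta>). Kt s \<theta>)" "continuous_on S (\<lambda>(s, \<theta>). Kss s \<theta>)"
  "continuous_on S (\<lambda>(s, \<theta>). Kst s \<theta>)" "continuous_on S (\<lambda>(s, \<theta>). Ktt s \<theta>)"
  unfolding K_eq Ks_def Kt_def Kss_def Kst_def Ktt_def case_prod_beta
  by (intro continuous_on_vec_lambda continuous_intros mgf_pdv_conts ballI;
      force simp: growth_orders_def dest: mgf_pdv_pos)+

lemma K_deriv_s:
  assumes "(s, \<theta>) \<in> S"
  shows "((\<lambda>t. K (s + t *\<^sub>R axis j 1) \<theta>) has_real_derivative Ks s \<theta> $ j) (at 0)"
  unfolding K_eq Ks_def
  by (rule derivative_eq_intros mgf_pdv_deriv_s assms | use mgf_pdv_pos[OF assms] in \<open>simp add: growth_orders_def field_simps\<close>)+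

lemma K_deriv_\<theta>:
  assumes "(s, \<theta>) \<in> S"
  shows "((\<lambda>t. K s (\<theta> + t *\<^sub>R axis i 1)) has_real_derivative Kt s \<theta> $ i) (at 0)"
  unfolding K_eq Kt_def
  by (rule derivative_eq_intros mgf_pdv_deriv_\<theta> assms | use mgf_pdv_pos[OF assms] in \<open>simp add: growth_orders_def field_simps\<close>)+

lemma Ks_deriv_s:
  assumes "(s, \<theta>) \<in> S"
  shows "((\<lambda>t. Ks (s + t *\<^sub>R axis i 1) \<theta> $ j) has_real_derivative Kss s \<theta> $ i $ j) (at 0)"
  unfolding Ks_def Kss_def using mgf_pdv_pos[OF assms] mgf_pdv_deriv_s[OF _ assms, of "[j]"] mgf_pdv_deriv_s[OF _ assms, of "[]"]
  by (auto intro!: derivative_eq_intros simp: growth_orders_def)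

lemma Ks_deriv_\<theta>:
  assumes "(s, \<theta>) \<in> S"
  shows "((\<lambda>t. Ks s (\<theta> + t *\<^sub>R axis i 1) $ j) has_real_derivative Kst s \<theta> $ j $ i) (at 0)"
  unfolding Ks_def Kst_def using mgf_pdv_pos[OF assms] mgf_pdv_deriv_\<theta>[OF _ assms, of "[]" "[j]"] mgf_pdv_deriv_\<theta>[OF _ assms, of "[]" "[]"]
  by (auto intro!: derivative_eq_intros simp: growth_orders_def)

lemma Kt_deriv_\<theta>:
  assumes "(s, \<theta>) \<in> S"
  shows "((\<lambda>t. Kt s (\<theta> + t *\<^sub>R axis i 1) $ j) has_real_derivative Ktt s \<theta> $ i $ j) (at 0)"
  unfolding Kt_def Ktt_def using mgf_pdv_pos[OF assms] mgf_pdv_deriv_\<theta>[OF _ assms, of "[j]" "[]"] mgf_pdv_deriv_\<theta>[OF _ assms, of "[]" "[]"]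
  by (auto intro!: derivative_eq_intros simp: growth_orders_def)

lemma K0'_eq: "(s, \<theta>) \<in> S \<Longrightarrow> K0' \<Omega> Y s \<theta> = Ks s \<theta>"
  unfolding K0'_def grad_def
  by (auto simp: vec_eq_iff intro!: pdv_eqI[of UNIV _ _ "\<lambda>s. K s \<theta>"] K_deriv_s)

lemma grad_\<theta>_eq: "(s, \<theta>) \<in> S \<Longrightarrow> grad (\<lambda>\<theta>. K s \<theta>) \<theta> = Kt s \<theta>"
  unfolding grad_def
  by (auto simp: vec_eq_iff intro!: pdv_eqI[of UNIV] K_deriv_\<theta>)

lemma K0''_eq:
  assumes "(s, \<theta>) \<in> S" shows "K0'' \<Omega> Y s \<theta> = Kss s \<theta>"
proof -
  have "pdv i (\<lambda>u. pdv j (\<lambda>u. K u \<theta>) u) s = Kss s \<theta> $ i $ j" for i j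
  proof (rule pdv_eqI[of "{u. (u, \<theta>) \<in> S}"])
    show "open {u. (u, \<theta>) \<in> S}" by (intro open_slices open_interior)
    show "pdv j (\<lambda>u. K u \<theta>) u = Ks u \<theta> $ j" if "u \<in> {u. (u, \<theta>) \<in> S}" for u
      using that by (auto intro!: pdv_eqI[of UNIV] K_deriv_s)
  qed (use assms Ks_deriv_s in auto)
  then show ?thesis by (simp add: K0''_def hessian_def vec_eq_iff)
qed

lemma hessian_\<theta>_eq:
  assumes "(s, \<theta>) \<in> S" shows "hessian (\<lambda>\<theta>. K s \<theta>) \<theta> = Ktt s \<theta>"
proof -
  have "pdv i (\<lambda>u. pdv j (\<lambda>u. K s u) u) \<theta> = Ktt s \<theta> $ i $ j" for i j
  proof (rule pdv_eqI[of "{u. (s, u) \<in> S}"])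
    show "open {u. (s, u) \<in> S}" by (intro open_slices open_interior)
    show "pdv j (\<lambda>u. K s u) u = Kt s u $ j" if "u \<in> {u. (s, u) \<in> S}" for u
      using that by (auto intro!: pdv_eqI[of UNIV] K_deriv_\<theta>)
  qed (use assms Kt_deriv_\<theta> in auto)
  then show ?thesis by (simp add: hessian_def vec_eq_iff)
qed

lemma open_S: "open S" by (rule open_interior)

lemma Kss_symmetric:
  assumes "(s, \<theta>) \<in> S" shows "Kss s \<theta> $ i $ j = Kss s \<theta> $ j $ i"
proof -
  have "((\<lambda>t. (\<lambda>(s, \<theta>). Ks s \<theta> $ j) ((s, \<theta>) + t *\<^sub>R (axis i 1, 0))) has_real_derivative
      (\<lambda>(s, \<theta>). Kss s \<theta> $ j $ i) (s, \<theta>)) (at 0)"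
  proof (rule directional_derivatives_commute[OF open_S assms,
        where f = "\<lambda>(s, \<theta>). K s \<theta>" and fu = "\<lambda>(s, \<theta>). Ks s \<theta> $ i" and v = "(axis j 1, 0)"])
    show "continuous_on S (\<lambda>(s, \<theta>). Kss s \<theta> $ j $ i)"
      using K_continuous(4) unfolding case_prod_beta by (intro continuous_intros)
  qed (auto intro: K_deriv_s Ks_deriv_s)
  moreover have "((\<lambda>t. (\<lambda>(s, \<theta>). Ks s \<theta> $ j) ((s, \<theta>) + t *\<^sub>R (axis i 1, 0))) has_real_derivative
      Kss s \<theta> $ i $ j) (at 0)"
    using Ks_deriv_s[OF assms] by simp
  ultimately show ?thesis using DERIV_unique by fastforce
qed

lemma transpose_Kss: "(s, \<theta>) \<in> S \<Longrightarrow> transpose (Kss s \<theta>) = Kss s \<theta>"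
  by (simp add: transpose_def vec_eq_iff Kss_symmetric)

text \<open>
  The matrix \<open>B\<close> differentiates first in \<open>\<theta>\<close> and then in \<open>s\<close>, the opposite of the order in the growth condition.
\<close>

lemma Kt_deriv_s:
  assumes "(s, \<theta>) \<in> S"
  shows "((\<lambda>t. Kt (s + t *\<^sub>R axis j 1) \<theta> $ i) has_real_derivative Kst s \<theta> $ j $ i) (at 0)"
proof -
  have "((\<lambda>t. (\<lambda>(s, \<theta>). Kt s \<theta> $ i) ((s, \<theta>) + t *\<^sub>R (axis j 1, 0))) has_real_derivative
      (\<lambda>(s, \<theta>). Kst s \<theta> $ j $ i) (s, \<theta>)) (at 0)"
  proof (rule directional_derivatives_commute[OF open_S assms,
        where f = "\<lambda>(s, \<theta>). K s \<theta>" and fu = "\<lambda>(s, \<theta>). Ks s \<theta> $ j" and v = "(0, axis i 1)"])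
    show "continuous_on S (\<lambda>(s, \<theta>). Kst s \<theta> $ j $ i)"
      using K_continuous(5) unfolding case_prod_beta by (intro continuous_intros)
  qed (auto intro: K_deriv_s K_deriv_\<theta> Ks_deriv_\<theta>)
  then show ?thesis by simp
qed

lemma mixed_hessian_eq:
  assumes "(s, \<theta>) \<in> S" shows "mixed_hessian K s \<theta> = Kst s \<theta>"
proof -
  have "pdv i (\<lambda>u. pdv j (\<lambda>\<eta>. K u \<eta>) \<theta>) s = Kst s \<theta> $ i $ j" for i j
  proof (rule pdv_eqI[of "{u. (u, \<theta>) \<in> S}"])
    show "open {u. (u, \<theta>) \<in> S}" by (intro open_slices open_S)
    show "pdv j (\<lambda>\<eta>. K u \<eta>) \<theta> = Kt u \<theta> $ j" if "u \<in> {u. (u, \<theta>) \<in> S}" for u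
      using that by (auto intro!: pdv_eqI[of UNIV] K_deriv_\<theta>)
  qed (use assms Kt_deriv_s in auto)
  then show ?thesis by (simp add: mixed_hessian_def vec_eq_iff)
qed

lemma K_has_derivative:
  assumes "(s, \<theta>) \<in> S"
  shows "((\<lambda>(s, \<theta>). K s \<theta>) has_derivative (\<lambda>(a, b). Ks s \<theta> \<bullet> a + Kt s \<theta> \<bullet> b)) (at (s, \<theta>))"
  using open_S assms K_deriv_s K_deriv_\<theta> K_continuous(2,3)
  by (rule has_derivative_from_continuous_block_partials)

text \<open>
  The continuity of all second derivatives that occur makes the gradient in \<open>s\<close> differentiable jointly in
  \<open>(s, \<theta>)\<close>; this is where the symmetry of \<open>Kss\<close> removes a transpose.
\<close>

lemma Ks_has_derivative:
  assumes "(s, \<theta>) \<in> S"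
  shows "((\<lambda>(s, \<theta>). Ks s \<theta>) has_derivative (\<lambda>(a, b). Kss s \<theta> *v a + Kst s \<theta> *v b)) (at (s, \<theta>))"
proof (rule has_derivative_vec_nthI)
  fix j
  have "((\<lambda>(s, \<theta>). Ks s \<theta> $ j) has_derivative
      (\<lambda>(a, b). (\<chi> i. Kss s \<theta> $ i $ j) \<bullet> a + (\<chi> i. Kst s \<theta> $ j $ i) \<bullet> b)) (at (s, \<theta>))"
  proof (rule has_derivative_from_continuous_block_partials[OF open_S assms])
    show "continuous_on S (\<lambda>(s, \<theta>). \<chi> i. Kss s \<theta> $ i $ j)"
      "continuous_on S (\<lambda>(s, \<theta>). \<chi> i. Kst s \<theta> $ j $ i)"
      using K_continuous(4,5) unfolding case_prod_beta
      by (intro continuous_on_vec_lambda continuous_intros ballI; simp)+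
  qed (auto intro: Ks_deriv_s Ks_deriv_\<theta>)
  moreover have "(\<chi> i. Kss s \<theta> $ i $ j) = (\<chi> i. Kss s \<theta> $ j $ i)"
    using Kss_symmetric[OF assms] by simp
  ultimately show "((\<lambda>x. (case x of (s, \<theta>) \<Rightarrow> Ks s \<theta>) $ j) has_derivative
      (\<lambda>x. (case x of (a, b) \<Rightarrow> Kss s \<theta> *v a + Kst s \<theta> *v b) $ j)) (at (s, \<theta>))"
    by (simp add: case_prod_unfold matrix_vector_mult_def inner_vec_def)
qed

lemma Kt_has_derivative:
  assumes "(s, \<theta>) \<in> S"
  shows "(Kt s has_derivative (\<lambda>b. transpose (Ktt s \<theta>) *v b)) (at \<theta>)"
proof (rule has_derivative_vec_nthI)
  fix j
  have c: "continuous_on {\<theta>. (s, \<theta>) \<in> S} (\<lambda>\<theta>. Ktt s \<theta> $ i $ j)" for i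
  proof -
    have "continuous_on {\<theta>. (s, \<theta>) \<in> S} (\<lambda>\<theta>. (\<lambda>(s, \<theta>). Ktt s \<theta>) (s, \<theta>))"
      by (rule continuous_on_compose2[OF K_continuous(6)]) (auto intro!: continuous_intros)
    then have "continuous_on {\<theta>. (s, \<theta>) \<in> S} (\<lambda>\<theta>. (\<lambda>(s, \<theta>). Ktt s \<theta>) (s, \<theta>) $ i $ j)"
      by (intro continuous_on_component)
    then show ?thesis by simp
  qed
  have op: "open {\<theta>. (s, \<theta>) \<in> S}" by (intro open_slices open_S)
  have "((\<lambda>\<theta>. Kt s \<theta> $ j) has_derivative
      (\<lambda>h. \<Sum>b\<in>Basis. (h \<bullet> b) * (\<Sum>i\<in>UNIV. b $ i * Ktt s \<theta> $ i $ j))) (at \<theta>)"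
  proof (rule has_derivative_from_continuous_partials[OF op])
    show "\<theta> \<in> {\<theta>. (s, \<theta>) \<in> S}" using assms by simp
    fix b :: "real^'p" assume "b \<in> Basis"
    then obtain i where b: "b = axis i 1" by (auto simp: Basis_vec_def)
    have sm: "(\<Sum>i\<in>UNIV. b $ i * Ktt s \<theta> $ i $ j) = Ktt s \<theta> $ i $ j" for \<theta>
      by (simp add: b axis_def if_distrib[of "\<lambda>x. x * _"] cong: if_cong)
    show "isCont (\<lambda>\<theta>. \<Sum>i\<in>UNIV. b $ i * Ktt s \<theta> $ i $ j) \<theta>"
      using c op assms unfolding sm by (simp add: continuous_on_eq_continuous_at)
    fix z assume "z \<in> {\<theta>. (s, \<theta>) \<in> S}"
    then show "((\<lambda>t. Kt s (z + t *\<^sub>R b) $ j) has_real_derivative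
        (\<Sum>i\<in>UNIV. b $ i * Ktt s z $ i $ j)) (at 0)"
      unfolding sm using Kt_deriv_\<theta> by (simp add: b)
  qed
  moreover have "(\<Sum>b\<in>Basis. (h \<bullet> b) * (\<Sum>i\<in>UNIV. b $ i * Ktt s \<theta> $ i $ j))
      = (transpose (Ktt s \<theta>) *v h) $ j" for h
  proof -
    have "(\<Sum>b\<in>Basis. (h \<bullet> b) * (\<Sum>i\<in>UNIV. b $ i * Ktt s \<theta> $ i $ j))
      = (\<Sum>b\<in>Basis. (h \<bullet> b) * ((\<chi> i. Ktt s \<theta> $ i $ j) \<bullet> b))"
      by (simp add: inner_vec_def mult.commute)
    also have "\<dots> = h \<bullet> (\<chi> i. Ktt s \<theta> $ i $ j)"
      by (rule euclidean_inner[symmetric])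
    finally show ?thesis
      by (simp add: inner_vec_def matrix_vector_mult_def transpose_def mult.commute)
  qed
  ultimately show "((\<lambda>\<theta>. Kt s \<theta> $ j) has_derivative (\<lambda>b. (transpose (Ktt s \<theta>) *v b) $ j)) (at \<theta>)"
    by simp
qed

lemma K_deriv_line:
  assumes "(s + t *\<^sub>R v, \<theta>) \<in> S"
  shows "((\<lambda>t. K (s + t *\<^sub>R v) \<theta>) has_real_derivative Ks (s + t *\<^sub>R v) \<theta> \<bullet> v) (at t)"
proof -
  have "((\<lambda>t. (s + t *\<^sub>R v, \<theta>)) has_derivative (\<lambda>h. (h *\<^sub>R v, 0))) (at t)"
    by (auto intro!: derivative_eq_intros)
  from has_derivative_compose[OF this K_has_derivative[OF assms]]
  show ?thesis by (simp add: has_field_derivative_def mult.commute[of _ "Ks _ _ \<bullet> _"])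
qed

lemma Ks_deriv_line:
  assumes "(s + t *\<^sub>R v, \<theta>) \<in> S"
  shows "((\<lambda>t. Ks (s + t *\<^sub>R v) \<theta> \<bullet> v) has_real_derivative v \<bullet> (Kss (s + t *\<^sub>R v) \<theta> *v v)) (at t)"
proof -
  have "((\<lambda>t. (s + t *\<^sub>R v, \<theta>)) has_derivative (\<lambda>h. (h *\<^sub>R v, 0))) (at t)"
    by (auto intro!: derivative_eq_intros)
  from has_derivative_inner_left[OF has_derivative_compose[OF this Ks_has_derivative[OF assms]], of v]
  show ?thesis
    by (simp add: has_field_derivative_def matrix_vector_mult_scaleR inner_commute mult.commute[of _ "_ \<bullet> _"])
qed

lemma K_deriv_line_\<theta>:
  assumes "(s, \<theta> + t *\<^sub>R v) \<in> S"
  shows "((\<lambda>t. K s (\<theta> + t *\<^sub>R v)) has_real_derivative Kt s (\<theta> + t *\<^sub>R v) \<bullet> v) (at t)"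
proof -
  have "((\<lambda>t. (s, \<theta> + t *\<^sub>R v)) has_derivative (\<lambda>h. (0, h *\<^sub>R v))) (at t)"
    by (auto intro!: derivative_eq_intros)
  from has_derivative_compose[OF this K_has_derivative[OF assms]]
  show ?thesis by (simp add: has_field_derivative_def mult.commute[of _ "Kt _ _ \<bullet> _"])
qed

section \<open>Strict convexity and uniqueness of the saddlepoint\<close>

text \<open>
  By convexity of the exponential, the domain of finiteness is convex in \<open>s\<close>. The interior is taken in the
  product space: balls around the two endpoints are translates of one another after shrinking, with the same
  \<open>\<theta>\<close>-shifts, so a ball of that radius around an intermediate point is covered.
\<close>

lemma slice_convex:
  assumes "(s1, \<theta>) \<in> S" "(s2, \<theta>) \<in> S" "0 \<le> t" "t \<le> 1"
  shows "(s1 + t *\<^sub>R (s2 - s1), \<theta>) \<in> S"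
proof -
  have cvx: "(a + t *\<^sub>R (b - a), \<eta>) \<in> S_dom R \<Omega> Y" if "(a, \<eta>) \<in> S_dom R \<Omega> Y" "(b, \<eta>) \<in> S_dom R \<Omega> Y" for a b \<eta>
  proof -
    have R: "\<eta> \<in> R" and i: "integrable (\<Omega> \<eta>) (\<lambda>\<omega>. exp (a \<bullet> Y \<eta> \<omega>))" "integrable (\<Omega> \<eta>) (\<lambda>\<omega>. exp (b \<bullet> Y \<eta> \<omega>))"
      using that by (auto simp: S_dom_def)
    note [measurable] = meas[OF R]
    have "integrable (\<Omega> \<eta>) (\<lambda>\<omega>. exp ((a + t *\<^sub>R (b - a)) \<bullet> Y \<eta> \<omega>))"
    proof (rule Bochner_Integration.integrable_bound[OF Bochner_Integration.integrable_add[OF i]])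
      show "AE \<omega> in \<Omega> \<eta>. norm (exp ((a + t *\<^sub>R (b - a)) \<bullet> Y \<eta> \<omega>))
          \<le> norm (exp (a \<bullet> Y \<eta> \<omega>) + exp (b \<bullet> Y \<eta> \<omega>))"
      proof (intro AE_I2)
        fix \<omega>
        define p q where "p = a \<bullet> Y \<eta> \<omega>" and "q = b \<bullet> Y \<eta> \<omega>"
        have "(a + t *\<^sub>R (b - a)) \<bullet> Y \<eta> \<omega> = (1 - t) * p + t * q"
          by (simp add: p_def q_def inner_add_left inner_diff_left algebra_simps)
        also have "\<dots> \<le> max p q"
          using assms(3,4) by (intro convex_bound_le) auto
        finally have "exp ((a + t *\<^sub>R (b - a)) \<bullet> Y \<eta> \<omega>) \<le> exp (max p q)" by simp
        also have "\<dots> \<le> exp p + exp q" by (simp add: max_def)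
        finally show "norm (exp ((a + t *\<^sub>R (b - a)) \<bullet> Y \<eta> \<omega>))
          \<le> norm (exp (a \<bullet> Y \<eta> \<omega>) + exp (b \<bullet> Y \<eta> \<omega>))" by (simp add: p_def q_def)
      qed
    qed measurable
    then show ?thesis using R by (simp add: S_dom_def)
  qed
  obtain e1 e2 where e: "e1 > 0" "ball (s1, \<theta>) e1 \<subseteq> S_dom R \<Omega> Y" "e2 > 0" "ball (s2, \<theta>) e2 \<subseteq> S_dom R \<Omega> Y"
    using assms(1,2) by (auto simp: mem_interior)
  have "ball (s1 + t *\<^sub>R (s2 - s1), \<theta>) (min e1 e2) \<subseteq> S_dom R \<Omega> Y"
  proof
    fix z assume z: "z \<in> ball (s1 + t *\<^sub>R (s2 - s1), \<theta>) (min e1 e2)"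
    obtain a b where ab: "z = (s1 + t *\<^sub>R (s2 - s1) + a, \<theta> + b)"
      by (metis add.commute diff_add_cancel surj_pair)
    have "norm (a, b) < min e1 e2" using z by (simp add: ab dist_norm norm_Pair)
    then have "(s1 + a, \<theta> + b) \<in> ball (s1, \<theta>) e1" "(s2 + a, \<theta> + b) \<in> ball (s2, \<theta>) e2"
      by (auto simp: dist_norm norm_Pair)
    then have "(s1 + a, \<theta> + b) \<in> S_dom R \<Omega> Y" "(s2 + a, \<theta> + b) \<in> S_dom R \<Omega> Y" using e by auto
    from cvx[OF this] show "z \<in> S_dom R \<Omega> Y" by (simp add: ab algebra_simps)
  qed
  then show ?thesis using e unfolding mem_interior by (intro exI[of _ "min e1 e2"]) auto
qed

text \<open>
  Under the law tilted by \<open>exp (s Y)\<close>, the symmetric second difference of the generating function of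
  \<open>W = v Y - \<mu>\<close> is at least \<open>t\<^sup>2 E(W\<^sup>2)\<close>, since \<open>2 cosh x \<ge> 2 + x\<^sup>2\<close>. If \<open>E(W\<^sup>2) = 0\<close>, then \<open>v Y\<close> is constant
  almost surely and \<open>M\<^sub>0(s + \<i> v) / M\<^sub>0(s)\<close> has modulus \<open>1\<close>, which contradicts the decay condition. This
  replaces the identification of \<open>Kss\<close> with a covariance, and with it differentiation under the expectation.
\<close>

lemma tilted_mgf_second_difference_bound:
  assumes S: "(s, \<theta>) \<in> S" and v: "v \<noteq> 0"
  obtains c where "c > 0"
    "\<And>t. (s + t *\<^sub>R v, \<theta>) \<in> S \<Longrightarrow> (s - t *\<^sub>R v, \<theta>) \<in> S \<Longrightarrow>
      2 + c * t\<^sup>2 \<le> exp (K (s + t *\<^sub>R v) \<theta> - K s \<theta> - t * \<mu>) + exp (K (s - t *\<^sub>R v) \<theta> - K s \<theta> + t * \<mu>)"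
proof -
  have R: "\<theta> \<in> R" using S_in S by blast
  interpret prob_space "\<Omega> \<theta>" using prob R .
  note [measurable] = meas[OF R]
  define w where "w \<omega> = exp (s \<bullet> Y \<theta> \<omega>)" for \<omega>
  define W where "W \<omega> = v \<bullet> Y \<theta> \<omega> - \<mu>" for \<omega>
  have wi: "integrable (\<Omega> \<theta>) w" using S_in(2)[OF S] unfolding w_def .
  have [measurable]: "w \<in> borel_measurable (\<Omega> \<theta>)" "W \<in> borel_measurable (\<Omega> \<theta>)"
    unfolding w_def W_def by measurable
  define m where "m = mgf_pdv [] [] s \<theta>"
  have m: "m > 0" "m = expectation w" using mgf_pdv_pos[OF S] by (auto simp: m_def mgf_pdv_nil w_def[abs_def])
  have tilt: "integrable (\<Omega> \<theta>) (\<lambda>\<omega>. w \<omega> * exp (t * W \<omega>))"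
    "exp (K (s + t *\<^sub>R v) \<theta> - K s \<theta> - t * \<mu>) = expectation (\<lambda>\<omega>. w \<omega> * exp (t * W \<omega>)) / m"
    if t: "(s + t *\<^sub>R v, \<theta>) \<in> S" for t
  proof -
    have eq: "w \<omega> * exp (t * W \<omega>) = exp ((s + t *\<^sub>R v) \<bullet> Y \<theta> \<omega>) * exp (- (t * \<mu>))" for \<omega>
      by (simp add: w_def W_def inner_add_left algebra_simps flip: exp_add)
    show "integrable (\<Omega> \<theta>) (\<lambda>\<omega>. w \<omega> * exp (t * W \<omega>))"
      unfolding eq using S_in(2)[OF t] by simp
    have "expectation (\<lambda>\<omega>. w \<omega> * exp (t * W \<omega>)) = mgf_pdv [] [] (s + t *\<^sub>R v) \<theta> * exp (- (t * \<mu>))"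
      unfolding eq by (simp add: mgf_pdv_nil)
    then show "exp (K (s + t *\<^sub>R v) \<theta> - K s \<theta> - t * \<mu>) = expectation (\<lambda>\<omega>. w \<omega> * exp (t * W \<omega>)) / m"
      unfolding K_eq exp_diff using mgf_pdv_pos[OF t] mgf_pdv_pos[OF S] by (simp add: exp_minus m_def divide_inverse)
  qed
  define E where "E t = (\<lambda>\<omega>. w \<omega> * exp (t * W \<omega>) + w \<omega> * exp (- t * W \<omega>))" for t
  have lower: "w \<omega> * (2 + t\<^sup>2 * (W \<omega>)\<^sup>2) \<le> E t \<omega>" for t \<omega>
  proof -
    have "w \<omega> * (2 + (t * W \<omega>)\<^sup>2) \<le> w \<omega> * (exp (t * W \<omega>) + exp (- (t * W \<omega>)))"
      by (intro mult_left_mono exp_add_exp_minus_ge) (simp add: w_def)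
    then show ?thesis by (simp add: E_def algebra_simps power_mult_distrib)
  qed
  have "open ((\<lambda>t. (s + t *\<^sub>R v, \<theta>)) -` S)"
    by (intro open_vimage open_S continuous_intros)
  moreover have "0 \<in> (\<lambda>t. (s + t *\<^sub>R v, \<theta>)) -` S" using S by simp
  ultimately obtain e where e: "e > 0" "ball 0 e \<subseteq> (\<lambda>t. (s + t *\<^sub>R v, \<theta>)) -` S"
    unfolding open_contains_ball by blast
  have "e / 2 \<in> ball 0 e" "- e / 2 \<in> ball 0 e" using e by auto
  then have e2: "(s + (e / 2) *\<^sub>R v, \<theta>) \<in> S" "(s + (- e / 2) *\<^sub>R v, \<theta>) \<in> S" using e by blast+
  have Ei: "integrable (\<Omega> \<theta>) (E (e / 2))"
    unfolding E_def using tilt(1)[OF e2(1)] tilt(1)[OF e2(2)] by (simp add: Bochner_Integration.integrable_add)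
  have i2: "integrable (\<Omega> \<theta>) (\<lambda>\<omega>. w \<omega> * (W \<omega>)\<^sup>2)"
  proof (rule Bochner_Integration.integrable_bound)
    show "integrable (\<Omega> \<theta>) (\<lambda>\<omega>. E (e / 2) \<omega> * (4 / e\<^sup>2))" using Ei by simp
    show "AE \<omega> in \<Omega> \<theta>. norm (w \<omega> * (W \<omega>)\<^sup>2) \<le> norm (E (e / 2) \<omega> * (4 / e\<^sup>2))"
    proof (intro AE_I2)
      fix \<omega>
      have w0: "w \<omega> > 0" by (simp add: w_def)
      have "w \<omega> * (W \<omega>)\<^sup>2 = (w \<omega> * ((e / 2)\<^sup>2 * (W \<omega>)\<^sup>2)) * (4 / e\<^sup>2)"
        using e by (simp add: power_divide field_simps)
      also have "\<dots> \<le> (w \<omega> * (2 + (e / 2)\<^sup>2 * (W \<omega>)\<^sup>2)) * (4 / e\<^sup>2)"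
        using w0 by (intro mult_right_mono mult_left_mono) auto
      also have "\<dots> \<le> E (e / 2) \<omega> * (4 / e\<^sup>2)" by (intro mult_right_mono lower) auto
      also have "\<dots> \<le> norm (E (e / 2) \<omega> * (4 / e\<^sup>2))" by (simp only: real_norm_def abs_ge_self)
      finally show "norm (w \<omega> * (W \<omega>)\<^sup>2) \<le> norm (E (e / 2) \<omega> * (4 / e\<^sup>2))"
        using w0 by (simp only: real_norm_def abs_mult abs_of_pos abs_power2)
    qed
  qed measurable
  define c where "c = expectation (\<lambda>\<omega>. w \<omega> * (W \<omega>)\<^sup>2) / m"
  have "expectation (\<lambda>\<omega>. w \<omega> * (W \<omega>)\<^sup>2) \<noteq> 0"
  proof
    assume "expectation (\<lambda>\<omega>. w \<omega> * (W \<omega>)\<^sup>2) = 0"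
    then have ae: "AE \<omega> in \<Omega> \<theta>. w \<omega> * (W \<omega>)\<^sup>2 = 0"
      by (subst (asm) integral_nonneg_eq_0_iff_AE[OF i2]) (auto simp: w_def)
    have "M0 \<Omega> Y (cvec s v) \<theta> = (CLINT \<omega>|\<Omega> \<theta>. complex_of_real (w \<omega>) * cis \<mu>)"
      unfolding M0_def M0_integrand
    proof (rule integral_cong_AE)
      show "AE \<omega> in \<Omega> \<theta>. complex_of_real (exp (s \<bullet> Y \<theta> \<omega>)) * cis (v \<bullet> Y \<theta> \<omega>) = complex_of_real (w \<omega>) * cis \<mu>"
        using ae by eventually_elim (auto simp: w_def W_def)
      show "(\<lambda>\<omega>. complex_of_real (exp (s \<bullet> Y \<theta> \<omega>)) * cis (v \<bullet> Y \<theta> \<omega>)) \<in> borel_measurable (\<Omega> \<theta>)"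
        unfolding cis_conv_exp by measurable
    qed measurable
    also have "\<dots> = complex_of_real m * cis \<mu>" by (simp add: m)
    finally have "cmod (M0 \<Omega> Y (cvec s v) \<theta> / M0 \<Omega> Y (cvec s 0) \<theta>) = 1"
      using m(1) by (simp add: M0_real norm_divide norm_mult m_def mgf_pdv_nil)
    moreover obtain \<delta> where \<delta>: "0 < \<delta> (s, \<theta>)" "cmod (M0 \<Omega> Y (cvec s v) \<theta> / M0 \<Omega> Y (cvec s 0) \<theta>)
        \<le> (1 + \<delta> (s, \<theta>) * (norm v)\<^sup>2) powr (- \<delta> (s, \<theta>))"
      using decay S unfolding decay_condition_def by blast
    ultimately have "1 \<le> (1 + \<delta> (s, \<theta>) * (norm v)\<^sup>2) powr (- \<delta> (s, \<theta>))" by simp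
    moreover have "(1 + \<delta> (s, \<theta>) * (norm v)\<^sup>2) powr (- \<delta> (s, \<theta>)) < (1 + \<delta> (s, \<theta>) * (norm v)\<^sup>2) powr 0"
      using \<delta>(1) v by (intro powr_less_mono) auto
    moreover have "1 + \<delta> (s, \<theta>) * (norm v)\<^sup>2 > 0"
      using \<delta>(1) by (intro add_pos_nonneg) auto
    then have "(1 + \<delta> (s, \<theta>) * (norm v)\<^sup>2) powr 0 = 1" by simp
    ultimately show False by linarith
  qed
  moreover have "expectation (\<lambda>\<omega>. w \<omega> * (W \<omega>)\<^sup>2) \<ge> 0"
    by (intro Bochner_Integration.integral_nonneg) (simp add: w_def)
  ultimately have c: "c > 0" using m by (simp add: c_def less_le)
  have "2 + c * t\<^sup>2 \<le> exp (K (s + t *\<^sub>R v) \<theta> - K s \<theta> - t * \<mu>) + exp (K (s - t *\<^sub>R v) \<theta> - K s \<theta> + t * \<mu>)"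
    if t: "(s + t *\<^sub>R v, \<theta>) \<in> S" "(s - t *\<^sub>R v, \<theta>) \<in> S" for t
  proof -
    have t': "(s + (- t) *\<^sub>R v, \<theta>) \<in> S" using t by simp
    have "2 + c * t\<^sup>2 = expectation (\<lambda>\<omega>. w \<omega> * 2 + t\<^sup>2 * (w \<omega> * (W \<omega>)\<^sup>2)) / m"
    proof -
      have "expectation (\<lambda>\<omega>. w \<omega> * 2 + t\<^sup>2 * (w \<omega> * (W \<omega>)\<^sup>2))
          = m * 2 + t\<^sup>2 * expectation (\<lambda>\<omega>. w \<omega> * (W \<omega>)\<^sup>2)"
        using wi i2 m by simp
      then show ?thesis using m(1) by (simp add: c_def add_divide_distrib)
    qed
    also have "expectation (\<lambda>\<omega>. w \<omega> * 2 + t\<^sup>2 * (w \<omega> * (W \<omega>)\<^sup>2)) \<le> expectation (E t)"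
    proof (rule integral_mono)
      show "integrable (\<Omega> \<theta>) (E t)"
        unfolding E_def using tilt(1)[OF t(1)] tilt(1)[OF t'] by (simp add: Bochner_Integration.integrable_add)
      show "w \<omega> * 2 + t\<^sup>2 * (w \<omega> * (W \<omega>)\<^sup>2) \<le> E t \<omega>" for \<omega>
        using lower[of \<omega> t] by (simp add: algebra_simps)
    qed (use wi i2 in auto)
    also have "expectation (E t) / m = exp (K (s + t *\<^sub>R v) \<theta> - K s \<theta> - t * \<mu>) + exp (K (s - t *\<^sub>R v) \<theta> - K s \<theta> + t * \<mu>)"
      unfolding E_def using tilt[OF t(1)] tilt[OF t']
      by (simp add: Bochner_Integration.integral_add add_divide_distrib)
    finally show ?thesis using m by (simp add: divide_right_mono)
  qed
  with c that show ?thesis by blast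
qed

text \<open>
  Let \<open>u\<close> be the generating function along \<open>v\<close>, tilted and centred by \<open>\<mu> = K\<^sub>0' v\<close>, so that \<open>u'(0) = 0\<close> and
  \<open>u''(0) = \<kappa>\<close> is the quadratic form. The lower bound on \<open>u(t) + u(-t)\<close> forces \<open>\<kappa> \<ge> c\<close>: otherwise
  \<open>q(t) = u(t) + u(-t) - c t\<^sup>2\<close> would decrease strictly to the right of \<open>0\<close>, where \<open>q(0) = 2\<close>.
\<close>

lemma Kss_positive_definite:
  assumes S: "(s, \<theta>) \<in> S" and v: "v \<noteq> 0"
  shows "0 < v \<bullet> (Kss s \<theta> *v v)"
proof -
  define \<mu> where "\<mu> = Ks s \<theta> \<bullet> v"
  obtain c where c: "c > 0" and low: "\<And>t. (s + t *\<^sub>R v, \<theta>) \<in> S \<Longrightarrow> (s - t *\<^sub>R v, \<theta>) \<in> S \<Longrightarrow>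
      2 + c * t\<^sup>2 \<le> exp (K (s + t *\<^sub>R v) \<theta> - K s \<theta> - t * \<mu>) + exp (K (s - t *\<^sub>R v) \<theta> - K s \<theta> + t * \<mu>)"
    using tilted_mgf_second_difference_bound[OF assms] by blast
  have "open ((\<lambda>t. (s + t *\<^sub>R v, \<theta>)) -` S)"
    by (intro open_vimage open_S continuous_intros)
  moreover have "0 \<in> (\<lambda>t. (s + t *\<^sub>R v, \<theta>)) -` S" using S by simp
  ultimately obtain e where e: "e > 0" "ball 0 e \<subseteq> (\<lambda>t. (s + t *\<^sub>R v, \<theta>)) -` S"
    unfolding open_contains_ball by blast
  have inS: "(s + t *\<^sub>R v, \<theta>) \<in> S" if "\<bar>t\<bar> < e" for t
    using subsetD[OF e(2), of t] that by simp
  define f where "f t = K (s + t *\<^sub>R v) \<theta>" for t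
  define f' where "f' t = Ks (s + t *\<^sub>R v) \<theta> \<bullet> v" for t
  define \<kappa> where "\<kappa> = v \<bullet> (Kss s \<theta> *v v)"
  have df: "(f has_real_derivative f' t) (at t)" if "\<bar>t\<bar> < e" for t
    unfolding f_def f'_def by (rule K_deriv_line[OF inS[OF that]])
  have df': "(f' has_real_derivative \<kappa>) (at 0)"
    unfolding f'_def \<kappa>_def using Ks_deriv_line[OF inS[of 0]] e by simp
  have f'0: "f' 0 = \<mu>" by (simp add: f'_def \<mu>_def)
  define u where "u t = exp (f t - f 0 - t * \<mu>)" for t
  have u0: "u 0 = 1" by (simp add: u_def)
  define u' where "u' t = (f' t - \<mu>) * u t" for t
  have du: "(u has_real_derivative u' t) (at t)" if "\<bar>t\<bar> < e" for t
    unfolding u_def u'_def by (auto intro!: derivative_eq_intros df that)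
  have du': "(u' has_real_derivative \<kappa>) (at 0)"
    using DERIV_mult[OF DERIV_diff[OF df' DERIV_const[of \<mu>]] du[of 0]] e f'0
    by (simp add: u'_def[abs_def] u0)
  define q where "q t = u t + u (- t) - c * t\<^sup>2" for t
  define q' where "q' t = u' t - u' (- t) - 2 * c * t" for t
  have dq: "(q has_real_derivative q' t) (at t)" if "\<bar>t\<bar> < e" for t
  proof -
    have "((\<lambda>t. u (- t)) has_real_derivative u' (- t) * (- 1)) (at t)"
      by (rule DERIV_chain2[where f = u]) (use du[of "- t"] that in \<open>auto intro!: derivative_eq_intros\<close>)
    then show ?thesis unfolding q_def q'_def
      using du[OF that] by (auto intro!: derivative_eq_intros)
  qed
  have "((\<lambda>t. u' (- t)) has_real_derivative \<kappa> * (- 1)) (at 0)"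
    by (rule DERIV_chain2[where f = u']) (use du' in \<open>auto intro!: derivative_eq_intros\<close>)
  then have dq': "(q' has_real_derivative 2 * \<kappa> - 2 * c) (at 0)"
    unfolding q'_def using du' by (auto intro!: derivative_eq_intros)
  have "\<kappa> \<ge> c"
  proof (rule ccontr)
    assume "\<not> \<kappa> \<ge> c"
    then have "2 * \<kappa> - 2 * c < 0" by simp
    from DERIV_neg_dec_right[OF dq' this]
    obtain d where d: "d > 0" "\<And>h. h > 0 \<Longrightarrow> h < d \<Longrightarrow> q' (0 + h) < q' 0" by blast
    define t where "t = min d e / 2"
    have t: "0 < t" "t < d" "t < e" using d e by (auto simp: t_def)
    have "q t < q 0"
    proof (rule DERIV_neg_imp_decreasing_open[OF t(1)])
      fix x assume x: "0 < x" "x < t"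
      have "q' x < 0" using d(2)[of x] x t by (simp add: q'_def)
      then show "\<exists>y. (q has_real_derivative y) (at x) \<and> y < 0" using dq[of x] x t by auto
    next
      show "continuous_on {0..t} q"
        by (rule DERIV_continuous_on[where D = q']) (use dq t in \<open>auto intro: has_field_derivative_at_within\<close>)
    qed
    moreover have "q t \<ge> 2"
      using low[of t] inS[of t] inS[of "- t"] t by (simp add: q_def u_def f_def)
    ultimately show False by (simp add: q_def u_def)
  qed
  with c show ?thesis by (simp add: \<kappa>_def)
qed

text \<open>
  Along the segment between two solutions, which stays in the domain by \<open>slice_convex\<close>, the directional derivative
  of \<open>K\<close> is strictly increasing.
\<close>

lemma saddlepoint_unique:
  assumes "(s1, \<theta>) \<in> S" "(s2, \<theta>) \<in> S" "Ks s1 \<theta> = Ks s2 \<theta>"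
  shows "s1 = s2"
proof (rule ccontr)
  assume ne: "s1 \<noteq> s2"
  define v where "v = s2 - s1"
  have v: "v \<noteq> 0" using ne by (simp add: v_def)
  have "Ks (s1 + 0 *\<^sub>R v) \<theta> \<bullet> v < Ks (s1 + 1 *\<^sub>R v) \<theta> \<bullet> v"
  proof (rule DERIV_pos_imp_increasing[of 0 1 "\<lambda>t. Ks (s1 + t *\<^sub>R v) \<theta> \<bullet> v"])
    fix t :: real assume "0 \<le> t" "t \<le> 1"
    then have "(s1 + t *\<^sub>R v, \<theta>) \<in> S" using slice_convex[OF assms(1,2)] by (simp add: v_def)
    then show "\<exists>y. ((\<lambda>t. Ks (s1 + t *\<^sub>R v) \<theta> \<bullet> v) has_real_derivative y) (at t) \<and> 0 < y"
      using Ks_deriv_line Kss_positive_definite v by blast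
  qed simp
  with assms(3) show False by (simp add: v_def)
qed

lemma L_hat_dom_iff:
  assumes "0 < n"
  shows "\<theta> \<in> L_hat_dom R \<Omega> Y n (real n *\<^sub>R y) \<longleftrightarrow> (\<exists>s. (s, \<theta>) \<in> S \<and> Ks s \<theta> = y)"
  using assms K0'_eq by (auto simp: L_hat_dom_def Y_open_def)

lemma L_hat_eq:
  fixes y :: "real ^ 'd"
  assumes n: "0 < n" and s: "(s, \<theta>) \<in> S" "Ks s \<theta> = y"
  shows "L_hat R \<Omega> Y n \<theta> (real n *\<^sub>R y) =
    exp (real n * (K s \<theta> - s \<bullet> y)) / sqrt ((2 * pi * real n) ^ CARD('d) * det (Kss s \<theta>))"
proof -
  have "s_hat R \<Omega> Y \<theta> y = s"
    unfolding s_hat_def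
  proof (rule the_equality)
    fix s' assume "(s', \<theta>) \<in> S \<and> K0' \<Omega> Y s' \<theta> = y"
    then show "s' = s" using s K0'_eq[of s' \<theta>] by (intro saddlepoint_unique[of s' \<theta> s]) simp_all
  next
    show "(s, \<theta>) \<in> S \<and> K0' \<Omega> Y s \<theta> = y" using s K0'_eq[OF s(1)] by simp
  qed
  moreover have "(real n *\<^sub>R y) /\<^sub>R real n = y" using n by simp
  ultimately show ?thesis
    by (simp only: L_hat_def Let_def det_scaleR K0''_eq[OF s(1)])
qed

section \<open>Local expansion at the critical point\<close>

text \<open>
  The increment is split into a step in \<open>s\<close> at \<open>\<theta>\<^sub>0 + r h\<close> and a step in \<open>\<theta>\<close> at \<open>s\<^sub>0\<close>. In each, subtracting
  the quadratic leaves a function of one real variable whose derivative is controlled by the differentiability of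
  \<open>Ks\<close> and of \<open>Kt s\<^sub>0\<close> at the base point.
\<close>

lemma scaled_taylor:
  assumes S: "(s\<^sub>0, \<theta>\<^sub>0) \<in> S" and crit: "Kt s\<^sub>0 \<theta>\<^sub>0 = 0" and M: "0 < M" and \<eta>: "0 < \<eta>"
  obtains r\<^sub>0 where "0 < r\<^sub>0"
    "\<And>r \<sigma> h. 0 < r \<Longrightarrow> r \<le> r\<^sub>0 \<Longrightarrow> norm \<sigma> \<le> M \<Longrightarrow> norm h \<le> M \<Longrightarrow>
      (s\<^sub>0 + r *\<^sub>R \<sigma>, \<theta>\<^sub>0 + r *\<^sub>R h) \<in> S"
    "\<And>r \<sigma> h. 0 < r \<Longrightarrow> r \<le> r\<^sub>0 \<Longrightarrow> norm \<sigma> \<le> M \<Longrightarrow> norm h \<le> M \<Longrightarrow>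
      \<bar>K (s\<^sub>0 + r *\<^sub>R \<sigma>) (\<theta>\<^sub>0 + r *\<^sub>R h) - K s\<^sub>0 \<theta>\<^sub>0 - r * (Ks s\<^sub>0 \<theta>\<^sub>0 \<bullet> \<sigma>)
        - r\<^sup>2 * (\<sigma> \<bullet> (Kss s\<^sub>0 \<theta>\<^sub>0 *v \<sigma>) / 2 + \<sigma> \<bullet> (Kst s\<^sub>0 \<theta>\<^sub>0 *v h) + h \<bullet> (Ktt s\<^sub>0 \<theta>\<^sub>0 *v h) / 2)\<bar>
      \<le> \<eta> * r\<^sup>2"
proof -
  \<comment> \<open>The step in \<open>s\<close> contributes \<open>2 e M\<^sup>2 r\<^sup>2\<close> and the step in \<open>\<theta>\<close> contributes \<open>e M\<^sup>2 r\<^sup>2\<close>.\<close>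
  define e where "e = \<eta> / (3 * M\<^sup>2)"
  have e: "e > 0" using \<eta> M by (simp add: e_def)
  define A where "A = Kss s\<^sub>0 \<theta>\<^sub>0"
  define B where "B = Kst s\<^sub>0 \<theta>\<^sub>0"
  define C where "C = Ktt s\<^sub>0 \<theta>\<^sub>0"
  obtain d0 where d0: "d0 > 0" "ball (s\<^sub>0, \<theta>\<^sub>0) d0 \<subseteq> S"
    using open_S S unfolding open_contains_ball by blast
  obtain d1 where d1: "d1 > 0" "\<And>z. norm (z - (s\<^sub>0, \<theta>\<^sub>0)) < d1 \<Longrightarrow>
      norm ((case z of (s, \<theta>) \<Rightarrow> Ks s \<theta>) - Ks s\<^sub>0 \<theta>\<^sub>0 - (case z - (s\<^sub>0, \<theta>\<^sub>0) of (a, b) \<Rightarrow> A *v a + B *v b))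
      \<le> e * norm (z - (s\<^sub>0, \<theta>\<^sub>0))"
    using Ks_has_derivative[OF S] e unfolding has_derivative_at_alt A_def B_def by fastforce
  obtain d2 where d2: "d2 > 0" "\<And>\<theta>. norm (\<theta> - \<theta>\<^sub>0) < d2 \<Longrightarrow>
      norm (Kt s\<^sub>0 \<theta> - Kt s\<^sub>0 \<theta>\<^sub>0 - transpose C *v (\<theta> - \<theta>\<^sub>0)) \<le> e * norm (\<theta> - \<theta>\<^sub>0)"
    using Kt_has_derivative[OF S] e unfolding has_derivative_at_alt C_def by meson
  define d where "d = min d0 (min d1 d2)"
  have d: "d > 0" "d \<le> d0" "d \<le> d1" "d \<le> d2" using d0 d1 d2 by (auto simp: d_def)
  define r0 where "r0 = d / (4 * M)"
  have r0: "r0 > 0" using d M by (simp add: r0_def)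
  have small: "norm (r *\<^sub>R a, r *\<^sub>R b) \<le> 2 * M * r \<and> 2 * M * r < d"
    if r: "0 < r" "r \<le> r0" and ab: "norm a \<le> M" "norm b \<le> M" for r and a :: "real^'d" and b :: "real^'p"
  proof -
    have "norm (r *\<^sub>R a, r *\<^sub>R b) \<le> r * norm a + r * norm b"
      using norm_Pair_le[of "r *\<^sub>R a" "r *\<^sub>R b"] r by simp
    also have "\<dots> \<le> r * M + r * M" using r ab by (intro add_mono mult_left_mono) auto
    finally have "norm (r *\<^sub>R a, r *\<^sub>R b) \<le> 2 * M * r" by simp
    moreover have "2 * M * r \<le> 2 * M * r0" using r M by simp
    moreover have "2 * M * r0 < d" using d M by (simp add: r0_def)
    ultimately show ?thesis by linarith
  qed
  have inS: "(s\<^sub>0 + r *\<^sub>R a, \<theta>\<^sub>0 + r *\<^sub>R b) \<in> S"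
    if "0 < r" "r \<le> r0" "norm a \<le> M" "norm b \<le> M" for r a b
  proof -
    have "dist (s\<^sub>0, \<theta>\<^sub>0) (s\<^sub>0 + r *\<^sub>R a, \<theta>\<^sub>0 + r *\<^sub>R b) = norm (r *\<^sub>R a, r *\<^sub>R b)"
      by (simp add: dist_norm norm_Pair)
    then have "(s\<^sub>0 + r *\<^sub>R a, \<theta>\<^sub>0 + r *\<^sub>R b) \<in> ball (s\<^sub>0, \<theta>\<^sub>0) d0"
      using small[OF that] d by simp
    then show ?thesis using d0 by blast
  qed
  show ?thesis
  proof (rule that[OF r0 inS])
    fix r :: real and \<sigma> :: "real^'d" and h :: "real^'p"
    assume r: "0 < r" "r \<le> r0" and bd: "norm \<sigma> \<le> M" "norm h \<le> M"
    let ?\<theta> = "\<theta>\<^sub>0 + r *\<^sub>R h"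
    have tb: "norm (t *\<^sub>R x) \<le> M" if "t \<in> {0..1}" "norm x \<le> M" for t and x :: "'x::real_normed_vector"
      using mult_mono[of "\<bar>t\<bar>" 1 "norm x" M] that by simp
    define k where "k t = K (s\<^sub>0 + t *\<^sub>R (r *\<^sub>R \<sigma>)) ?\<theta> - t * (r * (Ks s\<^sub>0 \<theta>\<^sub>0 \<bullet> \<sigma>))
      - r\<^sup>2 * (t\<^sup>2 * (\<sigma> \<bullet> (A *v \<sigma>)) / 2 + t * (\<sigma> \<bullet> (B *v h)))" for t
    have "norm (k 1 - k 0) \<le> (2 * e * M\<^sup>2 * r\<^sup>2) * norm (1 - 0 :: real)"
    proof (rule field_differentiable_bound[where S = "{0..1}" and f' =
          "\<lambda>t. r *\<^sub>R \<sigma> \<bullet> (Ks (s\<^sub>0 + t *\<^sub>R (r *\<^sub>R \<sigma>)) ?\<theta> - Ks s\<^sub>0 \<theta>\<^sub>0 - (A *v (t *\<^sub>R (r *\<^sub>R \<sigma>)) + B *v (r *\<^sub>R h)))"])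
      fix t :: real assume t: "t \<in> {0..1}"
      note sm = small[OF r tb[OF t bd(1)] bd(2)]
      have mem: "(s\<^sub>0 + t *\<^sub>R (r *\<^sub>R \<sigma>), ?\<theta>) \<in> S"
        using inS[OF r tb[OF t bd(1)] bd(2)] by (simp add: mult.commute)
      have dk: "(k has_real_derivative (Ks (s\<^sub>0 + t *\<^sub>R (r *\<^sub>R \<sigma>)) ?\<theta> \<bullet> (r *\<^sub>R \<sigma>) - r * (Ks s\<^sub>0 \<theta>\<^sub>0 \<bullet> \<sigma>)
          - r\<^sup>2 * (t * (\<sigma> \<bullet> (A *v \<sigma>)) + \<sigma> \<bullet> (B *v h)))) (at t)"
        unfolding k_def[abs_def]
        by (rule derivative_eq_intros K_deriv_line[OF mem] refl | simp)+
      have "r *\<^sub>R \<sigma> \<bullet> (Ks (s\<^sub>0 + t *\<^sub>R (r *\<^sub>R \<sigma>)) ?\<theta> - Ks s\<^sub>0 \<theta>\<^sub>0 - (A *v (t *\<^sub>R (r *\<^sub>R \<sigma>)) + B *v (r *\<^sub>R h)))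
          = Ks (s\<^sub>0 + t *\<^sub>R (r *\<^sub>R \<sigma>)) ?\<theta> \<bullet> (r *\<^sub>R \<sigma>) - r * (Ks s\<^sub>0 \<theta>\<^sub>0 \<bullet> \<sigma>)
          - r\<^sup>2 * (t * (\<sigma> \<bullet> (A *v \<sigma>)) + \<sigma> \<bullet> (B *v h))"
        by (simp add: matrix_vector_mult_scaleR inner_add_right inner_diff_right inner_commute
            power2_eq_square algebra_simps)
      with dk show "(k has_field_derivative r *\<^sub>R \<sigma> \<bullet> (Ks (s\<^sub>0 + t *\<^sub>R (r *\<^sub>R \<sigma>)) ?\<theta> - Ks s\<^sub>0 \<theta>\<^sub>0
          - (A *v (t *\<^sub>R (r *\<^sub>R \<sigma>)) + B *v (r *\<^sub>R h)))) (at t within {0..1})"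
        by (simp add: has_field_derivative_at_within)
      have "norm (r *\<^sub>R \<sigma> \<bullet> (Ks (s\<^sub>0 + t *\<^sub>R (r *\<^sub>R \<sigma>)) ?\<theta> - Ks s\<^sub>0 \<theta>\<^sub>0 - (A *v (t *\<^sub>R (r *\<^sub>R \<sigma>)) + B *v (r *\<^sub>R h))))
          \<le> norm (r *\<^sub>R \<sigma>) * norm (Ks (s\<^sub>0 + t *\<^sub>R (r *\<^sub>R \<sigma>)) ?\<theta> - Ks s\<^sub>0 \<theta>\<^sub>0 - (A *v (t *\<^sub>R (r *\<^sub>R \<sigma>)) + B *v (r *\<^sub>R h)))"
        by (simp only: real_norm_def Cauchy_Schwarz_ineq2)
      also have "\<dots> \<le> (r * M) * (e * (2 * M * r))"
      proof (rule mult_mono)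
        show "norm (r *\<^sub>R \<sigma>) \<le> r * M" using r bd by simp
        have n: "norm (t *\<^sub>R (r *\<^sub>R \<sigma>), r *\<^sub>R h) \<le> 2 * M * r" "norm (t *\<^sub>R (r *\<^sub>R \<sigma>), r *\<^sub>R h) < d1"
          using sm d by (auto simp: mult.commute)
        have "norm (Ks (s\<^sub>0 + t *\<^sub>R (r *\<^sub>R \<sigma>)) ?\<theta> - Ks s\<^sub>0 \<theta>\<^sub>0 - (A *v (t *\<^sub>R (r *\<^sub>R \<sigma>)) + B *v (r *\<^sub>R h)))
            \<le> e * norm (t *\<^sub>R (r *\<^sub>R \<sigma>), r *\<^sub>R h)"
          using d1(2)[of "(s\<^sub>0 + t *\<^sub>R (r *\<^sub>R \<sigma>), ?\<theta>)"] n(2) by simp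
        also have "\<dots> \<le> e * (2 * M * r)" using n(1) e by (intro mult_left_mono) auto
        finally show "norm (Ks (s\<^sub>0 + t *\<^sub>R (r *\<^sub>R \<sigma>)) ?\<theta> - Ks s\<^sub>0 \<theta>\<^sub>0 - (A *v (t *\<^sub>R (r *\<^sub>R \<sigma>)) + B *v (r *\<^sub>R h)))
            \<le> e * (2 * M * r)" .
      qed (use r M in auto)
      finally show "norm (r *\<^sub>R \<sigma> \<bullet> (Ks (s\<^sub>0 + t *\<^sub>R (r *\<^sub>R \<sigma>)) ?\<theta> - Ks s\<^sub>0 \<theta>\<^sub>0
          - (A *v (t *\<^sub>R (r *\<^sub>R \<sigma>)) + B *v (r *\<^sub>R h)))) \<le> 2 * e * M\<^sup>2 * r\<^sup>2"
        by (simp add: power2_eq_square algebra_simps)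
    qed auto
    then have part1: "\<bar>k 1 - k 0\<bar> \<le> 2 * e * M\<^sup>2 * r\<^sup>2" by simp
    define l where "l t = K s\<^sub>0 (\<theta>\<^sub>0 + t *\<^sub>R (r *\<^sub>R h)) - r\<^sup>2 * (t\<^sup>2 * (h \<bullet> (C *v h)) / 2)" for t
    have Csym: "h \<bullet> (transpose C *v h) = h \<bullet> (C *v h)"
      using inner_matrix_transpose[of C h h] by (simp add: inner_commute)
    have "norm (l 1 - l 0) \<le> (e * M\<^sup>2 * r\<^sup>2) * norm (1 - 0 :: real)"
    proof (rule field_differentiable_bound[where S = "{0..1}" and f' =
          "\<lambda>t. r *\<^sub>R h \<bullet> (Kt s\<^sub>0 (\<theta>\<^sub>0 + t *\<^sub>R (r *\<^sub>R h)) - Kt s\<^sub>0 \<theta>\<^sub>0 - transpose C *v (t *\<^sub>R (r *\<^sub>R h)))"])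
      fix t :: real assume t: "t \<in> {0..1}"
      note sm = small[OF r _ tb[OF t bd(2)], of 0]
      have mem: "(s\<^sub>0, \<theta>\<^sub>0 + t *\<^sub>R (r *\<^sub>R h)) \<in> S"
        using inS[OF r _ tb[OF t bd(2)], of 0] M by (simp add: mult.commute)
      have dl: "(l has_real_derivative (Kt s\<^sub>0 (\<theta>\<^sub>0 + t *\<^sub>R (r *\<^sub>R h)) \<bullet> (r *\<^sub>R h)
          - r\<^sup>2 * (t * (h \<bullet> (C *v h))))) (at t)"
        unfolding l_def[abs_def]
        by (rule derivative_eq_intros K_deriv_line_\<theta>[OF mem] refl | simp)+
      have "r *\<^sub>R h \<bullet> (Kt s\<^sub>0 (\<theta>\<^sub>0 + t *\<^sub>R (r *\<^sub>R h)) - Kt s\<^sub>0 \<theta>\<^sub>0 - transpose C *v (t *\<^sub>R (r *\<^sub>R h)))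
          = Kt s\<^sub>0 (\<theta>\<^sub>0 + t *\<^sub>R (r *\<^sub>R h)) \<bullet> (r *\<^sub>R h) - r\<^sup>2 * (t * (h \<bullet> (C *v h)))"
        using Csym by (simp add: crit matrix_vector_mult_scaleR inner_add_right inner_diff_right inner_commute
            power2_eq_square algebra_simps del: transpose_matrix_vector)
      with dl show "(l has_field_derivative r *\<^sub>R h \<bullet> (Kt s\<^sub>0 (\<theta>\<^sub>0 + t *\<^sub>R (r *\<^sub>R h)) - Kt s\<^sub>0 \<theta>\<^sub>0
          - transpose C *v (t *\<^sub>R (r *\<^sub>R h)))) (at t within {0..1})"
        by (simp add: has_field_derivative_at_within del: transpose_matrix_vector)
      have "norm (r *\<^sub>R h \<bullet> (Kt s\<^sub>0 (\<theta>\<^sub>0 + t *\<^sub>R (r *\<^sub>R h)) - Kt s\<^sub>0 \<theta>\<^sub>0 - transpose C *v (t *\<^sub>R (r *\<^sub>R h))))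
          \<le> norm (r *\<^sub>R h) * norm (Kt s\<^sub>0 (\<theta>\<^sub>0 + t *\<^sub>R (r *\<^sub>R h)) - Kt s\<^sub>0 \<theta>\<^sub>0 - transpose C *v (t *\<^sub>R (r *\<^sub>R h)))"
        by (simp only: real_norm_def Cauchy_Schwarz_ineq2)
      also have "\<dots> \<le> (r * M) * (e * (r * M))"
      proof (rule mult_mono)
        show "norm (r *\<^sub>R h) \<le> r * M" using r bd by simp
        have n: "norm (t *\<^sub>R (r *\<^sub>R h)) \<le> r * M"
          using mult_left_mono[OF tb[OF t bd(2)], of r] r by (simp add: mult_ac abs_mult)
        have "norm (t *\<^sub>R (r *\<^sub>R h)) < d2" using sm d M by (simp add: mult.commute norm_Pair)
        then have "norm (Kt s\<^sub>0 (\<theta>\<^sub>0 + t *\<^sub>R (r *\<^sub>R h)) - Kt s\<^sub>0 \<theta>\<^sub>0 - transpose C *v (t *\<^sub>R (r *\<^sub>R h)))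
            \<le> e * norm (t *\<^sub>R (r *\<^sub>R h))"
          using d2(2)[of "\<theta>\<^sub>0 + t *\<^sub>R (r *\<^sub>R h)"] by simp
        also have "\<dots> \<le> e * (r * M)" using n e by (intro mult_left_mono) auto
        finally show "norm (Kt s\<^sub>0 (\<theta>\<^sub>0 + t *\<^sub>R (r *\<^sub>R h)) - Kt s\<^sub>0 \<theta>\<^sub>0 - transpose C *v (t *\<^sub>R (r *\<^sub>R h)))
            \<le> e * (r * M)" .
      qed (use r M in auto)
      finally show "norm (r *\<^sub>R h \<bullet> (Kt s\<^sub>0 (\<theta>\<^sub>0 + t *\<^sub>R (r *\<^sub>R h)) - Kt s\<^sub>0 \<theta>\<^sub>0
          - transpose C *v (t *\<^sub>R (r *\<^sub>R h)))) \<le> e * M\<^sup>2 * r\<^sup>2"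
        by (simp add: power2_eq_square algebra_simps)
    qed auto
    then have part2: "\<bar>l 1 - l 0\<bar> \<le> e * M\<^sup>2 * r\<^sup>2" by simp
    have "K (s\<^sub>0 + r *\<^sub>R \<sigma>) ?\<theta> - K s\<^sub>0 \<theta>\<^sub>0 - r * (Ks s\<^sub>0 \<theta>\<^sub>0 \<bullet> \<sigma>)
        - r\<^sup>2 * (\<sigma> \<bullet> (A *v \<sigma>) / 2 + \<sigma> \<bullet> (B *v h) + h \<bullet> (C *v h) / 2) = (k 1 - k 0) + (l 1 - l 0)"
      by (simp add: k_def l_def algebra_simps)
    moreover have "2 * e * M\<^sup>2 * r\<^sup>2 + e * M\<^sup>2 * r\<^sup>2 = \<eta> * r\<^sup>2"
      using M by (simp add: e_def)
    ultimately show "\<bar>K (s\<^sub>0 + r *\<^sub>R \<sigma>) ?\<theta> - K s\<^sub>0 \<theta>\<^sub>0 - r * (Ks s\<^sub>0 \<theta>\<^sub>0 \<bullet> \<sigma>)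
        - r\<^sup>2 * (\<sigma> \<bullet> (Kss s\<^sub>0 \<theta>\<^sub>0 *v \<sigma>) / 2 + \<sigma> \<bullet> (Kst s\<^sub>0 \<theta>\<^sub>0 *v h) + h \<bullet> (Ktt s\<^sub>0 \<theta>\<^sub>0 *v h) / 2)\<bar> \<le> \<eta> * r\<^sup>2"
      using part1 part2 unfolding A_def[symmetric] B_def[symmetric] C_def[symmetric] by linarith
  qed
qed

text \<open>
  The moment generating function at \<open>0\<close> is the total mass.
\<close>

lemma K_at_0: "\<theta> \<in> R \<Longrightarrow> K 0 \<theta> = 0"
  using prob_space.prob_space[OF prob] by (simp add: K_eq mgf_pdv_nil)

lemma Ktt_at_0:
  assumes "(0, \<theta>) \<in> S" shows "Ktt 0 \<theta> = 0"
proof -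
  have "pdv j (\<lambda>\<theta>. K 0 \<theta>) u = 0" if "u \<in> R" for u j
    using open_R that by (rule pdv_eqI[where g = "\<lambda>_. 0"]) (auto simp: K_at_0)
  note inner_zero = this
  have "pdv i (\<lambda>u. pdv j (\<lambda>\<theta>. K 0 \<theta>) u) \<theta> = 0" for i j
    using S_in(1)[OF assms] by (rule pdv_eqI[OF open_R, where g = "\<lambda>_. 0"]) (auto simp: inner_zero)
  then show ?thesis
    unfolding hessian_\<theta>_eq[OF assms, symmetric] by (simp add: hessian_def vec_eq_iff)
qed

end

text \<open>
  A base point at which \<open>\<theta>\<close> is critical for \<open>K(s\<^sub>0; \<cdot>)\<close>; the matrix of the last condition is the Hessian of the
  profile \<open>\<theta> \<mapsto> min\<^sub>s (K(s; \<theta>) - s y\<^sub>0)\<close> at \<open>\<theta>\<^sub>0\<close>.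
\<close>

locale critical_point = cgf_model R \<Omega> Y
  for R :: "(real ^ 'p::finite) set" and \<Omega> :: "real ^ 'p \<Rightarrow> 'w measure"
    and Y :: "real ^ 'p \<Rightarrow> 'w \<Rightarrow> real ^ 'd::finite" +
  fixes s\<^sub>0 :: "real ^ 'd" and \<theta>\<^sub>0 :: "real ^ 'p"
  assumes S0: "(s\<^sub>0, \<theta>\<^sub>0) \<in> S" and crit: "Kt s\<^sub>0 \<theta>\<^sub>0 = 0"
    and neg_def: "negative_definite (Ktt s\<^sub>0 \<theta>\<^sub>0
      - transpose (Kst s\<^sub>0 \<theta>\<^sub>0) ** matrix_inv (Kss s\<^sub>0 \<theta>\<^sub>0) ** Kst s\<^sub>0 \<theta>\<^sub>0)"
begin

definition "A = Kss s\<^sub>0 \<theta>\<^sub>0"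
definition "B = Kst s\<^sub>0 \<theta>\<^sub>0"
definition "C = Ktt s\<^sub>0 \<theta>\<^sub>0"
definition "H = C - transpose B ** matrix_inv A ** B"
text \<open>
  The derivative at \<open>y\<^sub>0\<close> of the limiting maximiser as a function of \<open>y\<close>: \<open>profile w\<close> is maximal at \<open>G w\<close>.
\<close>

definition "G = - (matrix_inv H ** transpose B ** matrix_inv A)"
definition "y\<^sub>0 = Ks s\<^sub>0 \<theta>\<^sub>0"

text \<open>
  The limit of the rescaled log-likelihood: the minimum over \<open>\<sigma>\<close> of the quadratic form of \<open>scaled_taylor\<close>
  minus \<open>\<sigma> w\<close>, attained at \<open>\<sigma> = A\<^sup>-\<^sup>1 (w - B h)\<close>.
\<close>

definition profile :: "real ^ 'd \<Rightarrow> real ^ 'p \<Rightarrow> real" where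
  "profile w h = h \<bullet> (C *v h) / 2 - (w - B *v h) \<bullet> (matrix_inv A *v (w - B *v h)) / 2"

lemma A_pos: "v \<noteq> 0 \<Longrightarrow> 0 < v \<bullet> (A *v v)"
  unfolding A_def by (rule Kss_positive_definite[OF S0])

lemma A_sym: "transpose A = A" unfolding A_def by (rule transpose_Kss[OF S0])

lemma A_inv: "invertible A" using A_pos by (intro definite_invertible) force

lemma H_sym: "transpose H = H" and H_neg: "v \<noteq> 0 \<Longrightarrow> v \<bullet> (H *v v) < 0"
  using neg_def by (auto simp: negative_definite_def H_def A_def B_def C_def)

lemma H_inv: "invertible H" using H_neg by (intro definite_invertible) force

lemma inv_sym: "transpose (matrix_inv A) = matrix_inv A" "transpose (matrix_inv H) = matrix_inv H"
  by (simp_all add: transpose_matrix_inv A_inv A_sym H_inv H_sym)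

lemma profile_expand:
  "profile w h = h \<bullet> (H *v h) / 2 + h \<bullet> (transpose B *v (matrix_inv A *v w)) - w \<bullet> (matrix_inv A *v w) / 2"
proof -
  define Ai where "Ai = matrix_inv A"
  have sym: "x \<bullet> (Ai *v y) = y \<bullet> (Ai *v x)" for x y
    using inner_matrix_transpose[of Ai y x] inv_sym(1) by (simp add: Ai_def inner_commute)
  have Bt: "(B *v h) \<bullet> x = h \<bullet> (transpose B *v x)" for x
    by (rule inner_matrix_transpose)
  have "H *v h = C *v h - transpose B *v (Ai *v (B *v h))"
    by (simp add: H_def Ai_def matrix_vector_mult_diff_rdistrib matrix_vector_mul_assoc matrix_mul_assoc del: transpose_matrix_vector)
  then have "h \<bullet> (H *v h) = h \<bullet> (C *v h) - (B *v h) \<bullet> (Ai *v (B *v h))"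
    by (simp add: Bt inner_diff_right del: transpose_matrix_vector)
  then show ?thesis
    unfolding profile_def Bt[symmetric] Ai_def[symmetric]
    using sym[of w "B *v h"]
    by (simp add: matrix_vector_mult_diff_distrib inner_diff_left inner_diff_right field_simps)
qed

lemma profile_square:
  "profile w h = profile w (G *v w) + (h - G *v w) \<bullet> (H *v (h - G *v w)) / 2"
proof -
  have HG: "H *v (G *v w) = - (transpose B *v (matrix_inv A *v w))"
  proof -
    have "G *v w = - (matrix_inv H *v (transpose B *v (matrix_inv A *v w)))"
      by (simp add: G_def matrix_vector_mul_assoc matrix_mul_assoc minus_matrix_vector_mult del: transpose_matrix_vector)
    then show ?thesis
      using matrix_inv_cancel(3)[OF H_inv] by (simp add: vec.neg del: transpose_matrix_vector)
  qed
  have p: "profile w h = h \<bullet> (H *v h) / 2 - h \<bullet> (H *v (G *v w)) - w \<bullet> (matrix_inv A *v w) / 2" for h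
    unfolding profile_expand HG by simp
  show ?thesis
    unfolding p using complete_the_square[OF H_sym, of h "G *v w"] complete_the_square[OF H_sym, of "G *v w" "G *v w"]
    by simp
qed

text \<open>
  The existence of a saddlepoint near \<open>s\<^sub>0\<close>, with the value of the exponent there. The rescaled objective \<open>f\<close> is
  uniformly close to a quadratic with Hessian \<open>A\<close> and minimum \<open>profile w h\<close>, so by \<open>perturbed_minimum\<close> it has
  a minimiser inside the unit ball around \<open>A\<^sup>-\<^sup>1 (w - B h)\<close>, and a minimum in the interior is a critical point. The
  bound \<open>N\<close> covers these balls for all \<open>h\<close> and \<open>w\<close> of norm at most \<open>M\<close>.
\<close>

lemma scaled_saddlepoint:
  assumes M: "0 < M" and \<eta>: "0 < \<eta>"
  obtains r\<^sub>0 N where "0 < r\<^sub>0" "M \<le> N"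
    "\<And>r s \<theta>. 0 < r \<Longrightarrow> r \<le> r\<^sub>0 \<Longrightarrow> norm (s - s\<^sub>0) \<le> r * N \<Longrightarrow> norm (\<theta> - \<theta>\<^sub>0) \<le> r * N \<Longrightarrow> (s, \<theta>) \<in> S"
    "\<And>r h w. 0 < r \<Longrightarrow> r \<le> r\<^sub>0 \<Longrightarrow> norm h \<le> M \<Longrightarrow> norm w \<le> M \<Longrightarrow>
      \<exists>s. norm (s - s\<^sub>0) \<le> r * N \<and> Ks s (\<theta>\<^sub>0 + r *\<^sub>R h) = y\<^sub>0 + r *\<^sub>R w \<and>
        \<bar>(K s (\<theta>\<^sub>0 + r *\<^sub>R h) - K s\<^sub>0 \<theta>\<^sub>0 - (s - s\<^sub>0) \<bullet> (y\<^sub>0 + r *\<^sub>R w)) / r\<^sup>2 - profile w h\<bar> \<le> \<eta>"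
proof -
  obtain a where a: "a > 0" "\<And>v. a * (norm v)\<^sup>2 \<le> v \<bullet> (A *v v)"
    using positive_definite_coercive A_pos by blast
  define \<eta>' where "\<eta>' = min \<eta> (a / 8)"
  have \<eta>': "0 < \<eta>'" "\<eta>' \<le> \<eta>" "2 * \<eta>' < a / 2 * 1\<^sup>2" using \<eta> a by (auto simp: \<eta>'_def min_def)
  define sg where "sg w h = matrix_inv A *v (w - B *v h)" for w h
  obtain b1 where b1: "b1 > 0" "\<And>x. norm (matrix_inv A *v x) \<le> b1 * norm x"
    using bounded_linear.pos_bounded[OF matrix_vector_mul_bounded_linear[of "matrix_inv A"]]
    by (metis mult.commute)
  obtain b2 where b2: "b2 > 0" "\<And>x. norm (B *v x) \<le> b2 * norm x"
    using bounded_linear.pos_bounded[OF matrix_vector_mul_bounded_linear[of B]]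
    by (metis mult.commute)
  define N where "N = max M (b1 * (M + b2 * M) + 1)"
  have N: "N > 0" "M \<le> N" using M by (auto simp: N_def)
  have sgN: "norm (sg w h) + 1 \<le> N" if "norm h \<le> M" "norm w \<le> M" for w h
  proof -
    have "norm (w - B *v h) \<le> M + b2 * M"
      using norm_triangle_ineq4[of w "B *v h"] b2(2)[of h] that mult_left_mono[of "norm h" M b2] b2(1)
      by linarith
    then have "b1 * norm (w - B *v h) \<le> b1 * (M + b2 * M)" using b1 by (intro mult_left_mono) auto
    then show ?thesis using b1(2)[of "w - B *v h"] by (simp add: sg_def N_def)
  qed
  obtain r0 where r0: "r0 > 0"
    and mem: "\<And>r \<sigma> h. 0 < r \<Longrightarrow> r \<le> r0 \<Longrightarrow> norm \<sigma> \<le> N \<Longrightarrow> norm h \<le> N \<Longrightarrow>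
      (s\<^sub>0 + r *\<^sub>R \<sigma>, \<theta>\<^sub>0 + r *\<^sub>R h) \<in> S"
    and tay: "\<And>r \<sigma> h. 0 < r \<Longrightarrow> r \<le> r0 \<Longrightarrow> norm \<sigma> \<le> N \<Longrightarrow> norm h \<le> N \<Longrightarrow>
      \<bar>K (s\<^sub>0 + r *\<^sub>R \<sigma>) (\<theta>\<^sub>0 + r *\<^sub>R h) - K s\<^sub>0 \<theta>\<^sub>0 - r * (y\<^sub>0 \<bullet> \<sigma>)
        - r\<^sup>2 * (\<sigma> \<bullet> (A *v \<sigma>) / 2 + \<sigma> \<bullet> (B *v h) + h \<bullet> (C *v h) / 2)\<bar> \<le> \<eta>' * r\<^sup>2"
    using scaled_taylor[OF S0 crit N(1) \<eta>'(1)] unfolding A_def B_def C_def y\<^sub>0_def by metis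
  show ?thesis
  proof (rule that[OF r0 N(2)])
    fix r :: real and s :: "real^'d" and \<theta> :: "real^'p"
    assume r: "0 < r" "r \<le> r0" and n: "norm (s - s\<^sub>0) \<le> r * N" "norm (\<theta> - \<theta>\<^sub>0) \<le> r * N"
    have "norm ((s - s\<^sub>0) /\<^sub>R r) \<le> N" "norm ((\<theta> - \<theta>\<^sub>0) /\<^sub>R r) \<le> N"
      using n r by (simp_all add: inverse_eq_divide pos_divide_le_eq mult.commute)
    from mem[OF r this] r show "(s, \<theta>) \<in> S" by simp
  next
    fix r :: real and h :: "real^'p" and w :: "real^'d"
    assume r: "0 < r" "r \<le> r0" and hw: "norm h \<le> M" "norm w \<le> M"
    define \<theta> where "\<theta> = \<theta>\<^sub>0 + r *\<^sub>R h"
    define y where "y = y\<^sub>0 + r *\<^sub>R w"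
    define f where "f \<sigma> = (K (s\<^sub>0 + r *\<^sub>R \<sigma>) \<theta> - K s\<^sub>0 \<theta>\<^sub>0 - (r *\<^sub>R \<sigma>) \<bullet> y) / r\<^sup>2" for \<sigma>
    have hN: "norm h \<le> N" using hw N by simp
    have near: "norm \<sigma> \<le> N" if "norm (\<sigma> - sg w h) \<le> 1" for \<sigma>
      using norm_triangle_ineq2[of \<sigma> "sg w h"] sgN[OF hw] that by linarith
    have approx: "\<bar>f \<sigma> - (profile w h + (\<sigma> - sg w h) \<bullet> (A *v (\<sigma> - sg w h)) / 2)\<bar> \<le> \<eta>'"
      if "norm (\<sigma> - sg w h) \<le> 1" for \<sigma>
    proof -
      let ?q = "\<sigma> \<bullet> (A *v \<sigma>) / 2 + \<sigma> \<bullet> (B *v h) + h \<bullet> (C *v h) / 2"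
      let ?T = "K (s\<^sub>0 + r *\<^sub>R \<sigma>) \<theta> - K s\<^sub>0 \<theta>\<^sub>0 - r * (y\<^sub>0 \<bullet> \<sigma>) - r\<^sup>2 * ?q"
      have Asg: "A *v sg w h = w - B *v h"
        unfolding sg_def by (rule matrix_inv_cancel(3)[OF A_inv])
      have "sg w h \<bullet> (A *v sg w h) = (w - B *v h) \<bullet> (matrix_inv A *v (w - B *v h))"
        unfolding Asg by (simp add: sg_def inner_commute)
      then have sq: "?q - \<sigma> \<bullet> w = profile w h + (\<sigma> - sg w h) \<bullet> (A *v (\<sigma> - sg w h)) / 2"
        using complete_the_square[OF A_sym, of \<sigma> "sg w h"]
        by (simp add: profile_def Asg inner_diff_right)
      have "f \<sigma> - (profile w h + (\<sigma> - sg w h) \<bullet> (A *v (\<sigma> - sg w h)) / 2) = ?T / r\<^sup>2"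
        unfolding sq[symmetric] f_def y_def using r
        by (simp add: inner_add_right inner_commute power2_eq_square field_simps)
      also have "\<bar>\<dots>\<bar> \<le> \<eta>'"
        using tay[OF r near[OF that] hN] r by (simp add: \<theta>_def abs_divide divide_le_eq)
      finally show ?thesis .
    qed
    have inS: "(s\<^sub>0 + r *\<^sub>R \<sigma>, \<theta>) \<in> S" if "norm (\<sigma> - sg w h) \<le> 1" for \<sigma>
      using mem[OF r near[OF that] hN] by (simp add: \<theta>_def)
    have "continuous_on (cball (sg w h) 1) (\<lambda>\<sigma>. (\<lambda>(s, \<theta>). K s \<theta>) (s\<^sub>0 + r *\<^sub>R \<sigma>, \<theta>))"
      by (rule continuous_on_compose2[OF K_continuous(1)])
        (auto intro!: continuous_intros inS simp: dist_norm norm_minus_commute)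
    then have fc: "continuous_on (cball (sg w h) 1) f"
      unfolding f_def using r by (intro continuous_intros) auto
    obtain \<sigma> where \<sigma>: "\<sigma> \<in> cball (sg w h) 1" "norm (id \<sigma> - sg w h) < 1"
        "\<And>z. z \<in> cball (sg w h) 1 \<Longrightarrow> f \<sigma> \<le> f z" "\<bar>f \<sigma> - profile w h\<bar> \<le> \<eta>'"
    proof (rule perturbed_minimum[OF compact_cball fc, where p = id and c' = "sg w h" and c = "sg w h"
          and k = "profile w h" and \<eta> = \<eta>' and a = "a / 2" and \<epsilon> = 1])
      show "f (sg w h) \<le> profile w h + \<eta>'" using approx[of "sg w h"] by simp
      fix x assume "x \<in> cball (sg w h) 1"
      then have "norm (x - sg w h) \<le> 1" by (simp add: dist_norm norm_minus_commute)
      from approx[OF this] a(2)[of "x - sg w h"]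
      show "profile w h + a / 2 * (norm (id x - sg w h))\<^sup>2 - \<eta>' \<le> f x" by simp
    qed (use a \<eta>' in auto)
    have n1: "norm (\<sigma> - sg w h) < 1" using \<sigma>(2) by simp
    have "Ks (s\<^sub>0 + r *\<^sub>R \<sigma>) \<theta> $ j = y $ j" for j
    proof -
      define g where "g t = K (s\<^sub>0 + r *\<^sub>R \<sigma> + t *\<^sub>R axis j 1) \<theta> - (s\<^sub>0 + r *\<^sub>R \<sigma> + t *\<^sub>R axis j 1) \<bullet> y" for t
      have "(g has_real_derivative Ks (s\<^sub>0 + r *\<^sub>R \<sigma>) \<theta> $ j - y $ j) (at 0)"
        unfolding g_def inner_add_left inner_scaleR_left
        by (rule derivative_eq_intros K_deriv_s inS less_imp_le n1 refl | simp add: inner_axis')+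
      moreover have "0 < r * (1 - norm (\<sigma> - sg w h))" using r n1 by simp
      moreover have "\<forall>t. \<bar>0 - t\<bar> < r * (1 - norm (\<sigma> - sg w h)) \<longrightarrow> g 0 \<le> g t"
      proof (intro allI impI)
        fix t assume t: "\<bar>0 - t\<bar> < r * (1 - norm (\<sigma> - sg w h))"
        define z where "z = \<sigma> + (t / r) *\<^sub>R axis j 1"
        have "norm (z - sg w h) \<le> norm (\<sigma> - sg w h) + \<bar>t\<bar> / r"
          using norm_triangle_ineq[of "\<sigma> - sg w h" "(t / r) *\<^sub>R axis j (1::real)"] r
          by (simp add: z_def algebra_simps abs_divide)
        also have "\<dots> < 1" using t r by (simp add: field_simps)
        finally have "z \<in> cball (sg w h) 1" by (simp add: dist_norm norm_minus_commute)
        then have "f \<sigma> \<le> f z" by (rule \<sigma>(3))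
        moreover have "s\<^sub>0 + r *\<^sub>R z = s\<^sub>0 + r *\<^sub>R \<sigma> + t *\<^sub>R axis j 1"
          using r by (simp add: z_def algebra_simps)
        moreover have "r * (z \<bullet> y) = r * (\<sigma> \<bullet> y) + t * (axis j 1 \<bullet> y)"
          using r by (simp add: z_def inner_add_left distrib_left)
        ultimately show "g 0 \<le> g t"
          using r by (simp add: f_def g_def divide_le_cancel inner_add_left)
      qed
      ultimately have "Ks (s\<^sub>0 + r *\<^sub>R \<sigma>) \<theta> $ j - y $ j = 0" by (rule DERIV_local_min)
      then show ?thesis by simp
    qed
    then have "Ks (s\<^sub>0 + r *\<^sub>R \<sigma>) \<theta> = y" by (simp add: vec_eq_iff)
    moreover have "norm (s\<^sub>0 + r *\<^sub>R \<sigma> - s\<^sub>0) \<le> r * N" using near[of \<sigma>] n1 r by simp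
    moreover have "\<bar>(K (s\<^sub>0 + r *\<^sub>R \<sigma>) \<theta> - K s\<^sub>0 \<theta>\<^sub>0 - (s\<^sub>0 + r *\<^sub>R \<sigma> - s\<^sub>0) \<bullet> y) / r\<^sup>2 - profile w h\<bar> \<le> \<eta>"
      using \<sigma>(4) \<eta>' by (simp add: f_def)
    ultimately show "\<exists>s. norm (s - s\<^sub>0) \<le> r * N \<and> Ks s (\<theta>\<^sub>0 + r *\<^sub>R h) = y\<^sub>0 + r *\<^sub>R w \<and>
        \<bar>(K s (\<theta>\<^sub>0 + r *\<^sub>R h) - K s\<^sub>0 \<theta>\<^sub>0 - (s - s\<^sub>0) \<bullet> (y\<^sub>0 + r *\<^sub>R w)) / r\<^sup>2 - profile w h\<bar> \<le> \<eta>"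
      unfolding \<theta>_def[symmetric] y_def[symmetric] by blast
  qed
qed

section \<open>The saddlepoint maximiser\<close>

text \<open>
  The set \<open>X\<close> consists of the pairs \<open>(s, \<theta>)\<close> with \<open>\<theta>\<close> in the ball of radius \<open>r \<epsilon>\<close> around \<open>\<theta>\<^sub>0 + r G w\<close>
  that satisfy the saddlepoint equation. On \<open>X\<close> the likelihood is a constant times \<open>exp (- f)\<close>, and \<open>- f\<close> is close
  to the profile, which falls off quadratically with \<open>H\<close>. Working with pairs makes the continuity of
  \<open>s\<close> as a function of \<open>\<theta>\<close> unnecessary: compactness of \<open>X\<close> and continuity of \<open>f\<close> suffice for a maximiser.
\<close>

lemma saddlepoint_mle_expansion:
  assumes U: "\<theta>\<^sub>0 \<in> interior U" and M: "0 < M" and \<epsilon>: "0 < \<epsilon>"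
  obtains r\<^sub>0 where "0 < r\<^sub>0"
    "\<And>n w. 0 < n \<Longrightarrow> 1 / sqrt (real n) \<le> r\<^sub>0 \<Longrightarrow> norm w \<le> M \<Longrightarrow>
      \<exists>\<theta>. is_mle_hat R \<Omega> Y U n (real n *\<^sub>R (y\<^sub>0 + w /\<^sub>R sqrt (real n))) \<theta> \<and>
        norm (sqrt (real n) *\<^sub>R (\<theta> - \<theta>\<^sub>0) - G *v w) < \<epsilon>"
proof -
  obtain b where b: "b > 0" "\<And>v. b * (norm v)\<^sup>2 \<le> v \<bullet> ((- H) *v v)"
    using positive_definite_coercive[of "- H"] H_neg by (auto simp: minus_matrix_vector_mult)
  obtain g where g: "g > 0" "\<And>x. norm (G *v x) \<le> g * norm x"
    using bounded_linear.pos_bounded[OF matrix_vector_mul_bounded_linear[of G]]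
    by (metis mult.commute)
  define M' where "M' = max M (g * M + \<epsilon>)"
  have M': "M' > 0" "M \<le> M'" using M by (auto simp: M'_def)
  \<comment> \<open>The exponent and half of \<open>ld\<close> each contribute an error \<open>\<eta>\<close>, so the total error is \<open>2 \<eta>\<close>, and
    \<open>2 (2 \<eta>) < (b / 2) \<epsilon>\<^sup>2\<close> is what \<open>perturbed_minimum\<close> needs.\<close>
  define \<eta> where "\<eta> = b * \<epsilon>\<^sup>2 / 16"
  have \<eta>: "\<eta> > 0" using b \<epsilon> by (simp add: \<eta>_def)
  obtain r1 N where r1: "0 < r1" and N: "M' \<le> N"
    and mem: "\<And>r s \<theta>. 0 < r \<Longrightarrow> r \<le> r1 \<Longrightarrow> norm (s - s\<^sub>0) \<le> r * N \<Longrightarrow> norm (\<theta> - \<theta>\<^sub>0) \<le> r * N \<Longrightarrow> (s, \<theta>) \<in> S"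
    and sad: "\<And>r h w. 0 < r \<Longrightarrow> r \<le> r1 \<Longrightarrow> norm h \<le> M' \<Longrightarrow> norm w \<le> M' \<Longrightarrow>
      \<exists>s. norm (s - s\<^sub>0) \<le> r * N \<and> Ks s (\<theta>\<^sub>0 + r *\<^sub>R h) = y\<^sub>0 + r *\<^sub>R w \<and>
        \<bar>(K s (\<theta>\<^sub>0 + r *\<^sub>R h) - K s\<^sub>0 \<theta>\<^sub>0 - (s - s\<^sub>0) \<bullet> (y\<^sub>0 + r *\<^sub>R w)) / r\<^sup>2 - profile w h\<bar> \<le> \<eta>"
    using scaled_saddlepoint[OF M'(1) \<eta>] by metis
  have N0: "N > 0" using N M' by simp
  have detc: "continuous_on S (\<lambda>(s, \<theta>). det (Kss s \<theta>))"
    using continuous_on_det[OF K_continuous(4)] by (simp add: case_prod_unfold)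
  have detpos: "0 < det (Kss s \<theta>)" if "(s, \<theta>) \<in> S" for s \<theta>
    by (rule positive_definite_det_pos) (rule Kss_positive_definite[OF that])
  \<comment> \<open>The logarithm of the determinant enters only through its oscillation, which is small near the base point.\<close>
  define ld where "ld = (\<lambda>(s, \<theta>). ln (det (Kss s \<theta>)))"
  have ldc: "continuous_on S ld"
    using detc detpos unfolding ld_def case_prod_unfold by (intro continuous_intros) force+
  then have "isCont ld (s\<^sub>0, \<theta>\<^sub>0)" using S0 open_S by (simp add: continuous_on_eq_continuous_at)
  then obtain d where d: "d > 0" "\<And>z. dist z (s\<^sub>0, \<theta>\<^sub>0) < d \<Longrightarrow> dist (ld z) (ld (s\<^sub>0, \<theta>\<^sub>0)) < 2 * \<eta>"
    unfolding continuous_at_eps_delta using \<eta> by (metis mult_pos_pos zero_less_numeral)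
  obtain e where e: "e > 0" "ball \<theta>\<^sub>0 e \<subseteq> U" using U by (auto simp: mem_interior)
  define r0 where "r0 = min r1 (min (d / (3 * N)) (e / (2 * N)))"
  have r0: "r0 > 0" "r0 \<le> r1" "r0 \<le> d / (3 * N)" "r0 \<le> e / (2 * N)"
    using r1 d e N0 by (auto simp: r0_def)
  show ?thesis
  proof (rule that[OF r0(1)])
    fix n :: nat and w :: "real ^ 'd"
    assume n: "0 < n" "1 / sqrt (real n) \<le> r0" and w: "norm w \<le> M"
    define r where "r = 1 / sqrt (real n)"
    have r: "0 < r" "r \<le> r0" "r \<le> r1" using n r0 by (auto simp: r_def)
    have nr: "real n = 1 / r\<^sup>2" using n by (simp add: r_def power_divide)
    have "r * N \<le> d / (3 * N) * N" using r r0 N0 by (intro mult_right_mono) auto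
    then have rd: "r * N + r * N < d" using N0 d by (simp add: field_simps)
    have "r * N \<le> e / (2 * N) * N" using r r0 N0 by (intro mult_right_mono) auto
    then have re: "r * N < e" using N0 e by (simp add: field_simps)
    define y where "y = y\<^sub>0 + r *\<^sub>R w"
    define c where "c = G *v w"
    have wM: "norm w \<le> M'" using w M' by simp
    have hM: "norm h \<le> M'" if "norm (h - c) \<le> \<epsilon>" for h
    proof -
      have "norm c \<le> g * M" using g(2)[of w] mult_left_mono[OF w less_imp_le[OF g(1)]] by (simp add: c_def)
      then show ?thesis using norm_triangle_ineq2[of h c] that by (simp add: M'_def)
    qed
    define X where "X = {z \<in> cball s\<^sub>0 (r * N) \<times> cball (\<theta>\<^sub>0 + r *\<^sub>R c) (r * \<epsilon>). (\<lambda>(s, \<theta>). Ks s \<theta>) z = y}"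
    define p where "p = (\<lambda>z::(real^'d)\<times>(real^'p). (snd z - \<theta>\<^sub>0) /\<^sub>R r)"
    have box: "norm (s - s\<^sub>0) \<le> r * N" "norm ((\<theta> - \<theta>\<^sub>0) /\<^sub>R r - c) \<le> \<epsilon>" "norm (\<theta> - \<theta>\<^sub>0) \<le> r * N" "(s, \<theta>) \<in> S"
      if z: "(s, \<theta>) \<in> cball s\<^sub>0 (r * N) \<times> cball (\<theta>\<^sub>0 + r *\<^sub>R c) (r * \<epsilon>)" for s \<theta>
    proof -
      show 1: "norm (s - s\<^sub>0) \<le> r * N" using z by (simp add: dist_norm norm_minus_commute)
      have "norm (\<theta> - \<theta>\<^sub>0 - r *\<^sub>R c) \<le> r * \<epsilon>" using z by (simp add: dist_norm norm_minus_commute algebra_simps)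
      moreover have "\<theta> - \<theta>\<^sub>0 - r *\<^sub>R c = r *\<^sub>R ((\<theta> - \<theta>\<^sub>0) /\<^sub>R r - c)" using r by (simp add: algebra_simps)
      ultimately show 2: "norm ((\<theta> - \<theta>\<^sub>0) /\<^sub>R r - c) \<le> \<epsilon>" using r by simp
      have "norm ((\<theta> - \<theta>\<^sub>0) /\<^sub>R r) \<le> N" using hM[OF 2] N by linarith
      then show 3: "norm (\<theta> - \<theta>\<^sub>0) \<le> r * N"
        using r by (simp add: inverse_eq_divide pos_divide_le_eq mult.commute)
      show "(s, \<theta>) \<in> S" using mem r 1 3 by blast
    qed
    have boxI: "\<theta> \<in> cball (\<theta>\<^sub>0 + r *\<^sub>R c) (r * \<epsilon>)" if "norm ((\<theta> - \<theta>\<^sub>0) /\<^sub>R r - c) \<le> \<epsilon>" for \<theta>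
    proof -
      have "\<theta> - \<theta>\<^sub>0 - r *\<^sub>R c = r *\<^sub>R ((\<theta> - \<theta>\<^sub>0) /\<^sub>R r - c)" using r by (simp add: algebra_simps)
      then have "norm (\<theta> - \<theta>\<^sub>0 - r *\<^sub>R c) \<le> r * \<epsilon>" using that r by simp
      then show ?thesis by (simp add: dist_norm norm_minus_commute algebra_simps)
    qed
    have X_ex: "\<exists>s. (s, \<theta>) \<in> X \<and>
        \<bar>real n * (K s \<theta> - K s\<^sub>0 \<theta>\<^sub>0 - (s - s\<^sub>0) \<bullet> y) - profile w ((\<theta> - \<theta>\<^sub>0) /\<^sub>R r)\<bar> \<le> \<eta>"
      if "norm ((\<theta> - \<theta>\<^sub>0) /\<^sub>R r - c) \<le> \<epsilon>" for \<theta>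
    proof -
      have "\<theta>\<^sub>0 + r *\<^sub>R ((\<theta> - \<theta>\<^sub>0) /\<^sub>R r) = \<theta>" using r by simp
      with sad[OF r(1,3) hM[OF that] wM] obtain s where
        "norm (s - s\<^sub>0) \<le> r * N" "Ks s \<theta> = y"
        "\<bar>(K s \<theta> - K s\<^sub>0 \<theta>\<^sub>0 - (s - s\<^sub>0) \<bullet> y) / r\<^sup>2 - profile w ((\<theta> - \<theta>\<^sub>0) /\<^sub>R r)\<bar> \<le> \<eta>"
        unfolding y_def by auto
      then show ?thesis using boxI[OF that]
        by (intro exI[of _ s]) (auto simp: X_def nr dist_norm norm_minus_commute)
    qed
    have X_S: "X \<subseteq> S" using box(4) by (auto simp: X_def)
    have Xcomp: "compact X"
    proof -
      let ?C = "cball s\<^sub>0 (r * N) \<times> cball (\<theta>\<^sub>0 + r *\<^sub>R c) (r * \<epsilon>)"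
      have C: "compact ?C" by (intro compact_Times compact_cball)
      have "?C \<subseteq> S" using box(4) by auto
      then have "continuous_on ?C (\<lambda>(s, \<theta>). Ks s \<theta>)"
        using K_continuous(2) continuous_on_subset by blast
      then have "closed X" unfolding X_def
        using compact_imp_closed[OF C] by (rule continuous_closed_preimage_constant)
      then have "compact (?C \<inter> X)" using C by (intro compact_Int_closed)
      moreover have "?C \<inter> X = X" by (auto simp: X_def)
      ultimately show ?thesis by simp
    qed
    define f where "f = (\<lambda>(s, \<theta>). ld (s, \<theta>) / 2 - ld (s\<^sub>0, \<theta>\<^sub>0) / 2
      - real n * (K s \<theta> - K s\<^sub>0 \<theta>\<^sub>0 - (s - s\<^sub>0) \<bullet> y))"
    have "continuous_on X ld" "continuous_on X (\<lambda>(s, \<theta>). K s \<theta>)"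
      using ldc K_continuous(1) X_S continuous_on_subset by blast+
    then have fc: "continuous_on X f"
      unfolding f_def case_prod_unfold by (intro continuous_intros) auto
    have f_approx: "\<bar>f (s, \<theta>) + profile w ((\<theta> - \<theta>\<^sub>0) /\<^sub>R r)\<bar> \<le> 2 * \<eta>" if sX: "(s, \<theta>) \<in> X" for s \<theta>
    proof -
      have bx: "(s, \<theta>) \<in> cball s\<^sub>0 (r * N) \<times> cball (\<theta>\<^sub>0 + r *\<^sub>R c) (r * \<epsilon>)" "Ks s \<theta> = y"
        using sX by (auto simp: X_def)
      obtain s' where s': "(s', \<theta>) \<in> X"
        "\<bar>real n * (K s' \<theta> - K s\<^sub>0 \<theta>\<^sub>0 - (s' - s\<^sub>0) \<bullet> y) - profile w ((\<theta> - \<theta>\<^sub>0) /\<^sub>R r)\<bar> \<le> \<eta>"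
        using X_ex[OF box(2)[OF bx(1)]] by blast
      \<comment> \<open>Every element of \<open>X\<close> is the saddlepoint found before, by uniqueness.\<close>
      have "s' = s"
        using s' sX X_S by (intro saddlepoint_unique[of s' \<theta> s]) (auto simp: X_def)
      have "dist (s, \<theta>) (s\<^sub>0, \<theta>\<^sub>0) \<le> norm (s - s\<^sub>0) + norm (\<theta> - \<theta>\<^sub>0)"
        using norm_Pair_le[of "s - s\<^sub>0" "\<theta> - \<theta>\<^sub>0"] by (simp add: dist_norm)
      also have "\<dots> < d" using box(1,3)[OF bx(1)] rd by linarith
      finally have "\<bar>ld (s, \<theta>) - ld (s\<^sub>0, \<theta>\<^sub>0)\<bar> < 2 * \<eta>" using d(2) by (simp add: dist_real_def)
      then show ?thesis using s'(2) unfolding \<open>s' = s\<close> f_def by simp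
    qed
    obtain sc where sc: "(sc, \<theta>\<^sub>0 + r *\<^sub>R c) \<in> X"
      using X_ex[of "\<theta>\<^sub>0 + r *\<^sub>R c"] r \<epsilon> by auto
    obtain z where z: "z \<in> X" "norm (p z - c) < \<epsilon>" "\<And>z'. z' \<in> X \<Longrightarrow> f z \<le> f z'"
    proof (rule perturbed_minimum[OF Xcomp fc sc, where p = p and c = c and k = "- profile w c"
          and \<eta> = "2 * \<eta>" and a = "b / 2" and \<epsilon> = \<epsilon>])
      show "p (sc, \<theta>\<^sub>0 + r *\<^sub>R c) = c" using r by (simp add: p_def)
      show "f (sc, \<theta>\<^sub>0 + r *\<^sub>R c) \<le> - profile w c + 2 * \<eta>"
        using f_approx[OF sc] r by simp
      fix x assume x: "x \<in> X"
      obtain s \<theta> where st: "x = (s, \<theta>)" by (cases x)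
      have "b * (norm (p x - c))\<^sup>2 \<le> - ((p x - c) \<bullet> (H *v (p x - c)))"
        using b(2)[of "p x - c"] by (simp add: minus_matrix_vector_mult)
      then show "- profile w c + b / 2 * (norm (p x - c))\<^sup>2 - 2 * \<eta> \<le> f x"
        using f_approx[OF x[unfolded st]] profile_square[of w "p x"]
        unfolding c_def[symmetric] by (simp add: st p_def)
    next
      have "0 < b * \<epsilon>\<^sup>2" using b \<epsilon> by simp
      then show "2 * (2 * \<eta>) < b / 2 * \<epsilon>\<^sup>2" by (simp add: \<eta>_def)
    qed (use b \<epsilon> in auto)
    obtain s \<theta> where st: "z = (s, \<theta>)" by (cases z)
    have sx: "(s, \<theta>) \<in> X" and sS: "(s, \<theta>) \<in> S" and sy: "Ks s \<theta> = y"
      using z st X_S by (auto simp: X_def)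
    have near: "norm ((\<theta> - \<theta>\<^sub>0) /\<^sub>R r - c) < \<epsilon>" using z(2) by (simp add: st p_def)
    have L: "L_hat R \<Omega> Y n \<theta>' (real n *\<^sub>R y) = exp (real n * (K s\<^sub>0 \<theta>\<^sub>0 - s\<^sub>0 \<bullet> y))
        / (sqrt ((2 * pi * real n) ^ CARD('d)) * exp (ld (s\<^sub>0, \<theta>\<^sub>0) / 2)) * exp (- f (s', \<theta>'))"
      if sX: "(s', \<theta>') \<in> X" for s' \<theta>'
    proof -
      have s': "(s', \<theta>') \<in> S" "Ks s' \<theta>' = y" using sX X_S by (auto simp: X_def)
      have "sqrt (det (Kss s' \<theta>')) = exp (ld (s', \<theta>') / 2)"
        using detpos[OF s'(1)] by (simp add: ld_def ln_sqrt[symmetric])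
      then have "L_hat R \<Omega> Y n \<theta>' (real n *\<^sub>R y) = exp (real n * (K s' \<theta>' - s' \<bullet> y))
          / (sqrt ((2 * pi * real n) ^ CARD('d)) * exp (ld (s', \<theta>') / 2))"
        using L_hat_eq[OF n(1) s'] by (simp add: real_sqrt_mult)
      also have "real n * (K s' \<theta>' - s' \<bullet> y) = real n * (K s\<^sub>0 \<theta>\<^sub>0 - s\<^sub>0 \<bullet> y)
          + (ld (s', \<theta>') / 2 - ld (s\<^sub>0, \<theta>\<^sub>0) / 2 - f (s', \<theta>'))"
        by (simp add: f_def inner_diff_left algebra_simps)
      finally have eq: "L_hat R \<Omega> Y n \<theta>' (real n *\<^sub>R y) =
        exp (real n * (K s\<^sub>0 \<theta>\<^sub>0 - s\<^sub>0 \<bullet> y) + (ld (s', \<theta>') / 2 - ld (s\<^sub>0, \<theta>\<^sub>0) / 2 - f (s', \<theta>')))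
          / (sqrt ((2 * pi * real n) ^ CARD('d)) * exp (ld (s', \<theta>') / 2))" .
      have "exp (\<alpha> + (\<beta> - \<gamma> - x)) / (q * exp \<beta>) = exp \<alpha> / (q * exp \<gamma>) * exp (- x)"
        for \<alpha> \<beta> \<gamma> x q :: real
        by (cases "q = 0") (simp_all add: exp_add exp_diff exp_minus field_simps)
      from this[of "real n * (K s\<^sub>0 \<theta>\<^sub>0 - s\<^sub>0 \<bullet> y)" "ld (s', \<theta>') / 2" "ld (s\<^sub>0, \<theta>\<^sub>0) / 2" "f (s', \<theta>')"
          "sqrt ((2 * pi * real n) ^ CARD('d))"]
      show ?thesis unfolding eq .
    qed
    have yn: "y\<^sub>0 + w /\<^sub>R sqrt (real n) = y" by (simp add: y_def r_def inverse_eq_divide)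
    have "is_mle_hat R \<Omega> Y U n (real n *\<^sub>R y) \<theta>"
      unfolding is_mle_hat_def local_maximiser_def
    proof
      have "norm (\<theta> - \<theta>\<^sub>0) < e" using box(3) sx re unfolding X_def by fastforce
      then have "\<theta> \<in> U" using e by (auto simp: dist_norm norm_minus_commute)
      then show "\<theta> \<in> U \<inter> L_hat_dom R \<Omega> Y n (real n *\<^sub>R y)"
        using sS sy L_hat_dom_iff[OF n(1)] by blast
      define \<rho> where "\<rho> = r * (\<epsilon> - norm ((\<theta> - \<theta>\<^sub>0) /\<^sub>R r - c))"
      have \<rho>: "\<rho> > 0" using near r by (simp add: \<rho>_def)
      show "\<forall>\<^sub>F u in at \<theta> within U \<inter> L_hat_dom R \<Omega> Y n (real n *\<^sub>R y).
          L_hat R \<Omega> Y n u (real n *\<^sub>R y) \<le> L_hat R \<Omega> Y n \<theta> (real n *\<^sub>R y)"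
        unfolding eventually_at
      proof (intro exI[of _ \<rho>] conjI \<rho> ballI impI)
        fix u assume "u \<noteq> \<theta> \<and> dist u \<theta> < \<rho>"
        then have u: "norm (u - \<theta>) < \<rho>" by (simp add: dist_norm)
        have "(u - \<theta>\<^sub>0) /\<^sub>R r - c = ((\<theta> - \<theta>\<^sub>0) /\<^sub>R r - c) + (u - \<theta>) /\<^sub>R r"
          by (simp add: algebra_simps)
        then have "norm ((u - \<theta>\<^sub>0) /\<^sub>R r - c) \<le> norm ((\<theta> - \<theta>\<^sub>0) /\<^sub>R r - c) + norm ((u - \<theta>) /\<^sub>R r)"
          using norm_triangle_ineq by metis
        moreover have "norm ((u - \<theta>) /\<^sub>R r) < \<epsilon> - norm ((\<theta> - \<theta>\<^sub>0) /\<^sub>R r - c)"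
          using u r by (simp add: \<rho>_def inverse_eq_divide pos_divide_less_eq mult.commute)
        ultimately have "norm ((u - \<theta>\<^sub>0) /\<^sub>R r - c) \<le> \<epsilon>" by linarith
        then obtain s' where s': "(s', u) \<in> X" using X_ex by blast
        have "f (s, \<theta>) \<le> f (s', u)" using z(3)[OF s'] by (simp add: st)
        then show "L_hat R \<Omega> Y n u (real n *\<^sub>R y) \<le> L_hat R \<Omega> Y n \<theta> (real n *\<^sub>R y)"
          unfolding L[OF s'] L[OF sx] by (intro mult_left_mono) auto
      qed
    qed
    moreover have "sqrt (real n) *\<^sub>R (\<theta> - \<theta>\<^sub>0) = (\<theta> - \<theta>\<^sub>0) /\<^sub>R r" by (simp add: r_def)
    ultimately show "\<exists>\<theta>. is_mle_hat R \<Omega> Y U n (real n *\<^sub>R (y\<^sub>0 + w /\<^sub>R sqrt (real n))) \<theta> \<and>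
        norm (sqrt (real n) *\<^sub>R (\<theta> - \<theta>\<^sub>0) - G *v w) < \<epsilon>"
      using near unfolding yn c_def by metis
  qed
qed

text \<open>
  By uniqueness the local maximiser just found is \<open>mle_hat\<close>, and \<open>mle\<close> differs from it by \<open>O(1/n\<^sup>2)\<close>, which
  is still negligible after multiplication by \<open>sqrt n\<close>.
\<close>

lemma mle_expansion:
  assumes U: "\<theta>\<^sub>0 \<in> interior U" and V: "y\<^sub>0 \<in> interior V"
    and nbhd: "mle_neighbourhoods R \<Omega> Y Yc U V n\<^sub>0" and M: "0 < M" and \<epsilon>: "0 < \<epsilon>"
  shows "\<forall>\<^sub>F n in sequentially. n\<^sub>0 \<le> n \<and> 0 < n \<and> (\<forall>w. norm w \<le> M \<longrightarrow>
    (let y = y\<^sub>0 + w /\<^sub>R sqrt (real n) in y \<in> V \<and>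
      norm (sqrt (real n) *\<^sub>R (mle R \<Omega> Yc U n (real n *\<^sub>R y) - \<theta>\<^sub>0) - G *v w) < \<epsilon> \<and>
      norm (sqrt (real n) *\<^sub>R (mle_hat R \<Omega> Y U n (real n *\<^sub>R y) - \<theta>\<^sub>0) - G *v w) < \<epsilon>))"
proof -
  obtain r where r: "0 < r"
    "\<And>n w. 0 < n \<Longrightarrow> 1 / sqrt (real n) \<le> r \<Longrightarrow> norm w \<le> M \<Longrightarrow>
      \<exists>\<theta>. is_mle_hat R \<Omega> Y U n (real n *\<^sub>R (y\<^sub>0 + w /\<^sub>R sqrt (real n))) \<theta> \<and>
        norm (sqrt (real n) *\<^sub>R (\<theta> - \<theta>\<^sub>0) - G *v w) < \<epsilon> / 2"
    using saddlepoint_mle_expansion[OF U M, of "\<epsilon> / 2"] \<epsilon> by (metis half_gt_zero)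
  obtain e where e: "e > 0" "ball y\<^sub>0 e \<subseteq> V" using V by (auto simp: mem_interior)
  obtain c where c: "\<And>n y. n \<ge> n\<^sub>0 \<Longrightarrow> y \<in> V \<Longrightarrow>
      norm (mle_hat R \<Omega> Y U n (real n *\<^sub>R y) - mle R \<Omega> Yc U n (real n *\<^sub>R y)) \<le> c / (real n)\<^sup>2"
    using nbhd unfolding mle_neighbourhoods_def by blast
  have "(\<lambda>n. 1 / sqrt (real n)) \<longlonglongrightarrow> 0" by real_asymp
  then have "\<forall>\<^sub>F n in sequentially. 1 / sqrt (real n) < r" using r(1) by (rule order_tendstoD)
  moreover have "(\<lambda>n. M / sqrt (real n)) \<longlonglongrightarrow> 0" by real_asymp
  then have "\<forall>\<^sub>F n in sequentially. M / sqrt (real n) < e" using e(1) by (rule order_tendstoD)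
  moreover have "(\<lambda>n. sqrt (real n) * (c / (real n)\<^sup>2)) \<longlonglongrightarrow> 0" by real_asymp
  then have "\<forall>\<^sub>F n in sequentially. sqrt (real n) * (c / (real n)\<^sup>2) < \<epsilon> / 2"
    using \<epsilon> by (intro order_tendstoD(2)) auto
  moreover have "\<forall>\<^sub>F n in sequentially. max n\<^sub>0 1 \<le> n" by (rule eventually_ge_at_top)
  ultimately show ?thesis
  proof eventually_elim
    case (elim n)
    then have n: "n\<^sub>0 \<le> n" "0 < n" by auto
    have "y\<^sub>0 + w /\<^sub>R sqrt (real n) \<in> V \<and>
      norm (sqrt (real n) *\<^sub>R (mle R \<Omega> Yc U n (real n *\<^sub>R (y\<^sub>0 + w /\<^sub>R sqrt (real n))) - \<theta>\<^sub>0) - G *v w) < \<epsilon> \<and>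
      norm (sqrt (real n) *\<^sub>R (mle_hat R \<Omega> Y U n (real n *\<^sub>R (y\<^sub>0 + w /\<^sub>R sqrt (real n))) - \<theta>\<^sub>0) - G *v w) < \<epsilon>"
      if w: "norm w \<le> M" for w
    proof -
      define y where "y = y\<^sub>0 + w /\<^sub>R sqrt (real n)"
      define t where "t = mle R \<Omega> Yc U n (real n *\<^sub>R y)"
      define t' where "t' = mle_hat R \<Omega> Y U n (real n *\<^sub>R y)"
      have "norm (w /\<^sub>R sqrt (real n)) \<le> M / sqrt (real n)"
        using w by (simp add: divide_inverse mult.commute mult_right_mono)
      then have "dist y\<^sub>0 y < e" using elim(2) by (simp add: y_def dist_norm)
      then have yV: "y \<in> V" using e by auto
      obtain \<theta> where \<theta>: "is_mle_hat R \<Omega> Y U n (real n *\<^sub>R y) \<theta>"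
          "norm (sqrt (real n) *\<^sub>R (\<theta> - \<theta>\<^sub>0) - G *v w) < \<epsilon> / 2"
        using r(2)[OF n(2) less_imp_le[OF elim(1)] w] unfolding y_def by blast
      have "\<exists>!\<theta>. is_mle_hat R \<Omega> Y U n (real n *\<^sub>R y) \<theta>"
        using nbhd n(1) yV unfolding mle_neighbourhoods_def by blast
      then have "t' = \<theta>"
        unfolding t'_def mle_hat_def using \<theta>(1) by (rule the1_equality)
      then have hat: "norm (sqrt (real n) *\<^sub>R (t' - \<theta>\<^sub>0) - G *v w) < \<epsilon> / 2" using \<theta>(2) by simp
      have "norm (sqrt (real n) *\<^sub>R (t' - t)) \<le> sqrt (real n) * (c / (real n)\<^sup>2)"
        using mult_left_mono[OF c[OF n(1) yV], of "sqrt (real n)"] by (simp add: t_def t'_def)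
      then have close: "norm (sqrt (real n) *\<^sub>R (t' - t)) < \<epsilon> / 2" using elim(3) by linarith
      have eq: "sqrt (real n) *\<^sub>R (t - \<theta>\<^sub>0) - G *v w
          = (sqrt (real n) *\<^sub>R (t' - \<theta>\<^sub>0) - G *v w) - sqrt (real n) *\<^sub>R (t' - t)"
        by (simp add: algebra_simps)
      have "norm (sqrt (real n) *\<^sub>R (t - \<theta>\<^sub>0) - G *v w)
          \<le> norm (sqrt (real n) *\<^sub>R (t' - \<theta>\<^sub>0) - G *v w) + norm (sqrt (real n) *\<^sub>R (t' - t))"
        unfolding eq by (rule norm_triangle_ineq4)
      then have "norm (sqrt (real n) *\<^sub>R (t - \<theta>\<^sub>0) - G *v w) < \<epsilon>" using hat close by linarith
      then show ?thesis
        using hat yV \<epsilon> unfolding y_def[symmetric] t_def[symmetric] t'_def[symmetric] by simp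
    qed
    then show ?case using n by (simp add: Let_def)
  qed
qed

lemma limit_covariance:
  "G ** \<Sigma> ** transpose G
    = matrix_inv H ** transpose B ** matrix_inv A ** \<Sigma> ** matrix_inv A ** B ** matrix_inv H"
  by (simp add: G_def matrix_mult_minus matrix_transpose_mul inv_sym transpose_transpose matrix_mul_assoc)

text \<open>
  If \<open>K(s\<^sub>0; \<cdot>)\<close> is flat to second order, then \<open>B\<^sup>T A\<^sup>-\<^sup>1 B = - H\<close> collapses the covariance.
\<close>

lemma limit_covariance_at_0:
  assumes "C = 0"
  shows "G ** A ** transpose G = - matrix_inv H"
proof -
  have BAB: "transpose B ** matrix_inv A ** B = - H" using assms by (simp add: H_def)
  have "matrix_inv A ** A ** matrix_inv A = matrix_inv A" using matrix_inv_cancel(2)[OF A_inv] by simp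
  then have "G ** A ** transpose G = matrix_inv H ** (transpose B ** matrix_inv A ** B) ** matrix_inv H"
    unfolding limit_covariance by (simp add: matrix_mul_assoc[symmetric])
  also have "\<dots> = - (matrix_inv H ** H ** matrix_inv H)" by (simp add: BAB matrix_mult_minus)
  finally show ?thesis using matrix_inv_cancel(2)[OF H_inv] by simp
qed

end

section \<open>The joint limit law\<close>

theorem theorem4:
  fixes R U :: "(real ^ 'p::finite) set"
    and V :: "(real ^ 'd::finite) set"
    and n\<^sub>0 :: nat
    and \<Omega> :: "real ^ 'p \<Rightarrow> 'w measure"
    and Y :: "real ^ 'p \<Rightarrow> 'w \<Rightarrow> real ^ 'd"
    and Yc :: "real ^ 'p \<Rightarrow> nat \<Rightarrow> 'w \<Rightarrow> real ^ 'd"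
    and s\<^sub>0 y\<^sub>0 :: "real ^ 'd" and \<theta>\<^sub>0 :: "real ^ 'p"
    and A \<Sigma> :: "real ^ 'd ^ 'd" and B :: "real ^ 'p ^ 'd" and H :: "real ^ 'p ^ 'p"
    and P :: "nat \<Rightarrow> 'v measure"
    and chi :: "nat \<Rightarrow> 'v \<Rightarrow> real ^ 'd"
    and W :: "(real ^ 'd) measure"
    and T T_hat :: "nat \<Rightarrow> 'v \<Rightarrow> real ^ 'p"
  assumes "open R"
    and "\<And>\<theta>. \<theta> \<in> R \<Longrightarrow> iid_copies (\<Omega> \<theta>) (Y \<theta>) (Yc \<theta>)"
    and "decay_condition R \<Omega> Y"
    and "growth_condition R \<Omega> Y"
    and "(s\<^sub>0, \<theta>\<^sub>0) \<in> interior (S_dom R \<Omega> Y)"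
    and "y\<^sub>0 = K0' \<Omega> Y s\<^sub>0 \<theta>\<^sub>0"
    and "grad (\<lambda>\<theta>. K0 \<Omega> Y s\<^sub>0 \<theta>) \<theta>\<^sub>0 = 0"
    and "A = K0'' \<Omega> Y s\<^sub>0 \<theta>\<^sub>0"
    and "B = mixed_hessian (K0 \<Omega> Y) s\<^sub>0 \<theta>\<^sub>0"
    and "H = hessian (\<lambda>\<theta>. K0 \<Omega> Y s\<^sub>0 \<theta>) \<theta>\<^sub>0 - transpose B ** matrix_inv A ** B"
    and "negative_definite H"
    and "U \<subseteq> R" and "\<theta>\<^sub>0 \<in> interior U"
    and "1 \<le> n\<^sub>0" and "y\<^sub>0 \<in> interior V"
    and "mle_neighbourhoods R \<Omega> Y Yc U V n\<^sub>0"
    and "\<And>n. prob_space (P n)"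
    and "\<And>n. chi n \<in> borel_measurable (P n)"
    and "positive_semidefinite \<Sigma>"
    and "centred_normal \<Sigma> W"
    and "converges_in_distribution P (\<lambda>n \<omega>. (chi n \<omega> - real n *\<^sub>R y\<^sub>0) /\<^sub>R sqrt (real n)) W"
    and "\<And>n. T n \<in> borel_measurable (P n)"
    and "\<And>n. T_hat n \<in> borel_measurable (P n)"
    and "\<And>n \<omega>. n\<^sub>0 \<le> n \<Longrightarrow> \<omega> \<in> space (P n) \<Longrightarrow> chi n \<omega> /\<^sub>R real n \<in> V \<Longrightarrow>
           T n \<omega> = mle R \<Omega> Yc U n (chi n \<omega>) \<and> T_hat n \<omega> = mle_hat R \<Omega> Y U n (chi n \<omega>)"
  shows "\<exists>Z. centred_normal
               (matrix_inv H ** transpose B ** matrix_inv A ** \<Sigma> ** matrix_inv A ** B ** matrix_inv H) Z \<and>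
             converges_in_distribution P
               (\<lambda>n \<omega>. (sqrt (real n) *\<^sub>R (T n \<omega> - \<theta>\<^sub>0), sqrt (real n) *\<^sub>R (T_hat n \<omega> - \<theta>\<^sub>0)))
               (distr Z borel (\<lambda>z. (z, z))) \<and>
             (s\<^sub>0 = 0 \<and> y\<^sub>0 = K0' \<Omega> Y 0 \<theta>\<^sub>0 \<and> \<Sigma> = K0'' \<Omega> Y 0 \<theta>\<^sub>0 \<longrightarrow>
               centred_normal (- matrix_inv H) Z)"
proof -
  have iid: "prob_space (\<Omega> \<theta>) \<and> Y \<theta> \<in> borel_measurable (\<Omega> \<theta>)" if "\<theta> \<in> R" for \<theta>
    using assms(2)[OF that] unfolding iid_copies_def by blast
  interpret cgf_model R \<Omega> Y
  proof (rule cgf_model.intro)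
    show "open R" "decay_condition R \<Omega> Y" "growth_condition R \<Omega> Y" by fact+
    show "prob_space (\<Omega> \<theta>)" "Y \<theta> \<in> borel_measurable (\<Omega> \<theta>)" if "\<theta> \<in> R" for \<theta>
      using iid[OF that] by simp_all
  qed
  have S0: "(s\<^sub>0, \<theta>\<^sub>0) \<in> S" by fact
  have A: "A = Kss s\<^sub>0 \<theta>\<^sub>0" and B: "B = Kst s\<^sub>0 \<theta>\<^sub>0" and y0: "y\<^sub>0 = Ks s\<^sub>0 \<theta>\<^sub>0"
    using assms(6,8,9) K0'_eq[OF S0] K0''_eq[OF S0] mixed_hessian_eq[OF S0] by simp_all
  have H: "H = Ktt s\<^sub>0 \<theta>\<^sub>0 - transpose B ** matrix_inv A ** B"
    using assms(10) hessian_\<theta>_eq[OF S0] by simp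
  interpret c: critical_point R \<Omega> Y s\<^sub>0 \<theta>\<^sub>0
    by unfold_locales (use S0 assms(7,11) grad_\<theta>_eq[OF S0] in \<open>simp_all add: A B H\<close>)
  have A: "c.A = A" and B: "c.B = B" and H: "c.H = H" and y0: "c.y\<^sub>0 = y\<^sub>0"
    using A B H y0 by (simp_all add: c.A_def c.B_def c.H_def c.C_def c.y\<^sub>0_def)
  \<comment> \<open>The limit law is the image of \<open>W\<close> under \<open>G\<close>, and \<open>g\<close> doubles it, so that both estimators are handled at once.\<close>
  define X where "X n \<omega> = (chi n \<omega> - real n *\<^sub>R y\<^sub>0) /\<^sub>R sqrt (real n)" for n \<omega>
  define g where "g x = (c.G *v x, c.G *v x)" for x
  define Z where "Z = distr W borel (\<lambda>x. c.G *v x)"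
  have W: "prob_space W" "sets W = sets borel" using assms(20) by (auto simp: centred_normal_def)
  have gc: "continuous_on UNIV g" unfolding g_def by (intro continuous_intros)
  have Gm: "(\<lambda>x. c.G *v x) \<in> measurable W borel"
    unfolding measurable_cong_sets[OF W(2) refl]
    by (intro borel_measurable_continuous_onI continuous_intros)
  have "converges_in_distribution P
      (\<lambda>n \<omega>. (sqrt (real n) *\<^sub>R (T n \<omega> - \<theta>\<^sub>0), sqrt (real n) *\<^sub>R (T_hat n \<omega> - \<theta>\<^sub>0))) (distr W borel g)"
  proof (rule slutsky_continuous_mapping[OF assms(17) _ _ W _ gc, where X = X])
    show "converges_in_distribution P X W" using assms(21) by (simp add: X_def[abs_def])
    show "X n \<in> borel_measurable (P n)" for n
      using assms(18)[of n] unfolding X_def[abs_def] by measurable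
    show "(\<lambda>\<omega>. (sqrt (real n) *\<^sub>R (T n \<omega> - \<theta>\<^sub>0), sqrt (real n) *\<^sub>R (T_hat n \<omega> - \<theta>\<^sub>0)))
        \<in> borel_measurable (P n)" for n
    proof -
      note [measurable] = assms(22)[of n] assms(23)[of n]
      show ?thesis by (rule borel_measurable_Pair; measurable)
    qed
    fix M \<epsilon> :: real assume M: "0 < M" and \<epsilon>: "0 < \<epsilon>"
    have "c.y\<^sub>0 \<in> interior V" using assms(15) y0 by simp
    from c.mle_expansion[OF assms(13) this assms(16) M half_gt_zero[OF \<epsilon>]]
    show "\<forall>\<^sub>F n in sequentially. \<forall>\<omega>\<in>space (P n). norm (X n \<omega>) \<le> M \<longrightarrow>
        dist (sqrt (real n) *\<^sub>R (T n \<omega> - \<theta>\<^sub>0), sqrt (real n) *\<^sub>R (T_hat n \<omega> - \<theta>\<^sub>0)) (g (X n \<omega>)) < \<epsilon>"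
    proof eventually_elim
      case (elim n)
      show ?case
      proof (intro ballI impI)
        fix \<omega> assume \<omega>: "\<omega> \<in> space (P n)" and le: "norm (X n \<omega>) \<le> M"
        have n: "n\<^sub>0 \<le> n" "0 < n" using elim by auto
        define y where "y = y\<^sub>0 + X n \<omega> /\<^sub>R sqrt (real n)"
        have chi: "chi n \<omega> = real n *\<^sub>R y"
        proof -
          have "real n *\<^sub>R (X n \<omega> /\<^sub>R sqrt (real n)) = chi n \<omega> - real n *\<^sub>R y\<^sub>0"
            using n(2) by (simp add: X_def real_sqrt_mult_self flip: inverse_mult_distrib)
          then show ?thesis by (simp add: y_def scaleR_right_distrib)
        qed
        have ex: "y \<in> V"
          "norm (sqrt (real n) *\<^sub>R (mle R \<Omega> Yc U n (real n *\<^sub>R y) - \<theta>\<^sub>0) - c.G *v X n \<omega>) < \<epsilon> / 2"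
          "norm (sqrt (real n) *\<^sub>R (mle_hat R \<Omega> Y U n (real n *\<^sub>R y) - \<theta>\<^sub>0) - c.G *v X n \<omega>) < \<epsilon> / 2"
          using elim le unfolding y0 y_def Let_def by blast+
        have "chi n \<omega> /\<^sub>R real n \<in> V" using ex(1) n(2) by (simp add: chi)
        from assms(24)[OF n(1) \<omega> this] ex(2,3)
        have "norm (sqrt (real n) *\<^sub>R (T n \<omega> - \<theta>\<^sub>0) - c.G *v X n \<omega>) < \<epsilon> / 2"
          "norm (sqrt (real n) *\<^sub>R (T_hat n \<omega> - \<theta>\<^sub>0) - c.G *v X n \<omega>) < \<epsilon> / 2"
          by (simp_all add: chi)
        then show "dist (sqrt (real n) *\<^sub>R (T n \<omega> - \<theta>\<^sub>0), sqrt (real n) *\<^sub>R (T_hat n \<omega> - \<theta>\<^sub>0)) (g (X n \<omega>)) < \<epsilon>"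
          using norm_Pair_le[of "sqrt (real n) *\<^sub>R (T n \<omega> - \<theta>\<^sub>0) - c.G *v X n \<omega>"
              "sqrt (real n) *\<^sub>R (T_hat n \<omega> - \<theta>\<^sub>0) - c.G *v X n \<omega>"]
          by (simp add: g_def dist_norm)
      qed
    qed
  qed
  moreover have "distr Z borel (\<lambda>z. (z, z)) = distr W borel g"
    unfolding Z_def g_def using Gm
    by (subst distr_distr) (auto simp: o_def intro!: borel_measurable_continuous_onI continuous_intros)
  moreover have Zn: "centred_normal (c.G ** \<Sigma> ** transpose c.G) Z"
    unfolding Z_def by (rule centred_normal_linear_image) fact
  moreover have "centred_normal (- matrix_inv H) Z" if "s\<^sub>0 = 0" "\<Sigma> = K0'' \<Omega> Y 0 \<theta>\<^sub>0"
  proof -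
    have "c.C = 0" unfolding c.C_def using S0 Ktt_at_0 that(1) by simp
    moreover have "\<Sigma> = c.A" using that assms(8) A by simp
    ultimately show ?thesis using Zn c.limit_covariance_at_0 H by simp
  qed
  ultimately show ?thesis
    unfolding c.limit_covariance A B H by auto
qed

end
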